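(* Let $G$ be a (finite, simple, connected) distance-regular graph. Then $G$ is Lichnerowicz sharp if and only if $G$ is isomorphic to one of the following graphs: a cocktail party graph $CP(n)$ with $n\ge 2$, a Hamming graph $H(d,n)$ with $d\ge 1$ and $n\ge 2$, a Johnson graph $J(n,k)$ with $1\le k\le n-1$, a demi-cube $Q^n_{(2)}$ with $n\ge 2$, the Schläfli graph, or the Gosset graph.
   Context: All graphs are finite, simple and connected. For a vertex $x$ of a graph $G=(V,E)$ with degree $\deg(x)$ and $p\in[0,1]$, let $\mu_x^p$ be the probability measure with $\mu_x^p(x)=p$, $\mu_x^p(y)=(1-p)/\deg(x)$ if $xy\in E$, and $0$ otherwise. For probability measures $\mu_1,\mu_2$ on $V$, the Wasserstein distance is $W_1(\mu_1,\mu_2)=\inf_\pi\sum_{x,y}d(x,y)\pi(x,y)$, infimum over couplings $\pi:V\times V\to[0,1]$ with marginals $\mu_1,\mu_2$, where $d$ is the graph distance. The Lin–Lu–Yau curvature of $x,y$ is $\kappa(x,y)=\lim_{p\to1}\kappa_p(x,y)/(1-p)$ where $\kappa_p(x,y)=1-W_1(\mu_x^p,\mu_y^p)/d(x,y)$. The normalized Laplacian is $L=I-D^{-1/2}AD^{-1/2}$ ($A$ adjacency matrix, $D$ diagonal degree matrix), and $\lambda_1$ denotes its smallest nonzero eigenvalue. It is known that $\lambda_1\ge\min_{xy\in E}\kappa(x,y)$; $G$ is called Lichnerowicz sharp if $\lambda_1=\min_{xy\in E}\kappa(x,y)$. A connected graph of diameter $D$ is distance-regular if there are constants $c_i,a_i,b_i$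 ($0\le i\le D$) such that for any vertices $x,y$ at distance $i$, $y$ has exactly $c_i$ neighbours at distance $i-1$ from $x$, $a_i$ at distance $i$, and $b_i$ at distance $i+1$. Graphs: $CP(n)$ is $K_{2n}$ minus a perfect matching; $H(d,n)$ has vertex set the words of length $d$ over an $n$-letter alphabet, adjacent when differing in exactly one coordinate; $J(n,k)$ has vertex set the $k$-subsets of an $n$-set, adjacent when they intersect in $k-1$ elements; $Q^n_{(2)}$ has vertex set the binary vectors of length $n$ of even weight, adjacent when at Hamming distance $2$; the Schläfli graph is the unique strongly regular graph with parameters $(27,16,10,8)$; the Gosset graph is the unique distance-regular graph with intersection array $\{27,10,1;1,10,27\}$ (the 1-skeleton of the $3_{21}$ polytope, 56 vertices). *)

theory Defs
  imports Complex_Main "Graph_Theory.Graph_Theory" "HOL-Combinatorics.Permutations"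
begin

text \<open>
  Finite simple graphs are modelled by the locale \<^locale>\<open>pair_graph\<close>: finite, loop-free digraphs with
  a symmetric arc relation, so that an undirected edge is a pair of opposite arcs.
\<close>

section \<open>Distance and distance-regularity\<close>

definition neighbours :: "'a pair_pre_digraph \<Rightarrow> 'a \<Rightarrow> 'a set" where
  "neighbours G x = {y. (x, y) \<in> parcs G}"

definition deg :: "'a pair_pre_digraph \<Rightarrow> 'a \<Rightarrow> nat" where
  "deg G x = card (neighbours G x)"

definition gdist :: "'a pair_pre_digraph \<Rightarrow> 'a \<Rightarrow> 'a \<Rightarrow> nat" where
  "gdist G x y = (LEAST n. \<exists>p. pre_digraph.awalk (with_proj G) x p y \<and> length p = n)"

definition gdiameter :: "'a pair_pre_digraph \<Rightarrow> nat" where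
  "gdiameter G = Max {gdist G x y | x y. x \<in> pverts G \<and> y \<in> pverts G}"

text \<open>
  The condition \<open>gdist G x z + 1 = i\<close> instead of \<open>gdist G x z = i - 1\<close> avoids truncated subtraction
  and gives \<open>c 0 = 0\<close>.
\<close>

definition intersection_numbers ::
  "'a pair_pre_digraph \<Rightarrow> (nat \<Rightarrow> nat) \<Rightarrow> (nat \<Rightarrow> nat) \<Rightarrow> (nat \<Rightarrow> nat) \<Rightarrow> bool" where
  "intersection_numbers G c a b \<longleftrightarrow>
     (\<forall>i\<le>gdiameter G. \<forall>x\<in>pverts G. \<forall>y\<in>pverts G. gdist G x y = i \<longrightarrow>
        card {z \<in> neighbours G y. gdist G x z + 1 = i} = c i \<and>
        card {z \<in> neighbours G y. gdist G x z = i} = a i \<and>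
        card {z \<in> neighbours G y. gdist G x z = i + 1} = b i)"

definition distance_regular :: "'a pair_pre_digraph \<Rightarrow> bool" where
  "distance_regular G \<longleftrightarrow>
     Digraph_Component.connected (with_proj G) \<and> (\<exists>c a b. intersection_numbers G c a b)"

section \<open>Lin--Lu--Yau curvature\<close>

definition lazy_walk_measure :: "'a pair_pre_digraph \<Rightarrow> real \<Rightarrow> 'a \<Rightarrow> 'a \<Rightarrow> real" where
  "lazy_walk_measure G p x y =
     (if y = x then p else if (x, y) \<in> parcs G then (1 - p) / real (deg G x) else 0)"

definition coupling ::
  "'a pair_pre_digraph \<Rightarrow> ('a \<Rightarrow> real) \<Rightarrow> ('a \<Rightarrow> real) \<Rightarrow> ('a \<Rightarrow> 'a \<Rightarrow> real) \<Rightarrow> bool" where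
  "coupling G \<mu>1 \<mu>2 \<pi> \<longleftrightarrow>
     (\<forall>x\<in>pverts G. \<forall>y\<in>pverts G. 0 \<le> \<pi> x y \<and> \<pi> x y \<le> 1) \<and>
     (\<forall>x\<in>pverts G. (\<Sum>y\<in>pverts G. \<pi> x y) = \<mu>1 x) \<and>
     (\<forall>y\<in>pverts G. (\<Sum>x\<in>pverts G. \<pi> x y) = \<mu>2 y)"

definition wasserstein :: "'a pair_pre_digraph \<Rightarrow> ('a \<Rightarrow> real) \<Rightarrow> ('a \<Rightarrow> real) \<Rightarrow> real" where
  "wasserstein G \<mu>1 \<mu>2 =
     (INF \<pi>\<in>{\<pi>. coupling G \<mu>1 \<mu>2 \<pi>}. \<Sum>x\<in>pverts G. \<Sum>y\<in>pverts G. real (gdist G x y) * \<pi> x y)"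

definition lazy_curvature :: "'a pair_pre_digraph \<Rightarrow> real \<Rightarrow> 'a \<Rightarrow> 'a \<Rightarrow> real" where
  "lazy_curvature G p x y =
     1 - wasserstein G (lazy_walk_measure G p x) (lazy_walk_measure G p y) / real (gdist G x y)"

text \<open>The idleness \<open>p\<close> ranges over \<open>[0,1]\<close>, so the limit at \<open>1\<close> is the left-hand limit.\<close>

definition lly_curvature :: "'a pair_pre_digraph \<Rightarrow> 'a \<Rightarrow> 'a \<Rightarrow> real" where
  "lly_curvature G x y = Lim (at_left 1) (\<lambda>p. lazy_curvature G p x y / (1 - p))"

section \<open>The normalized Laplacian and Lichnerowicz sharpness\<close>

definition adjacency :: "'a pair_pre_digraph \<Rightarrow> 'a \<Rightarrow> 'a \<Rightarrow> real" where
  "adjacency G x y = (if (x, y) \<in> parcs G then 1 else 0)"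

definition normalized_laplacian :: "'a pair_pre_digraph \<Rightarrow> 'a \<Rightarrow> 'a \<Rightarrow> real" where
  "normalized_laplacian G x y =
     (if x = y then 1 else 0) - real (deg G x) powr (-1/2) * adjacency G x y * real (deg G y) powr (-1/2)"

text \<open>Matrices are functions of two indices, of which only the values on \<open>V \<times> V\<close> matter.\<close>

definition matrix_eigenvalue_on :: "'a set \<Rightarrow> ('a \<Rightarrow> 'a \<Rightarrow> real) \<Rightarrow> real \<Rightarrow> bool" where
  "matrix_eigenvalue_on V M l \<longleftrightarrow>
     (\<exists>f. (\<exists>x\<in>V. f x \<noteq> 0) \<and> (\<forall>x\<in>V. (\<Sum>y\<in>V. M x y * f y) = l * f x))"

definition lambda1 :: "'a pair_pre_digraph \<Rightarrow> real" where
  "lambda1 G = Min {l. matrix_eigenvalue_on (pverts G) (normalized_laplacian G) l \<and> l \<noteq> 0}"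

text \<open>
  For the one-vertex graph neither side of the equation exists (there is no edge, and the degree
  matrix is not invertible); the guard \<open>parcs G \<noteq> {}\<close> makes it not sharp.
\<close>

definition lichnerowicz_sharp :: "'a pair_pre_digraph \<Rightarrow> bool" where
  "lichnerowicz_sharp G \<longleftrightarrow>
     parcs G \<noteq> {} \<and> lambda1 G = Min {lly_curvature G x y | x y. (x, y) \<in> parcs G}"

section \<open>The graphs of the classification\<close>

definition graph_on :: "'a set \<Rightarrow> ('a \<Rightarrow> 'a \<Rightarrow> bool) \<Rightarrow> 'a pair_pre_digraph" where
  "graph_on V adj = \<lparr>pverts = V, parcs = {(x, y). x \<in> V \<and> y \<in> V \<and> adj x y}\<rparr>"

text \<open>The perfect matching removed from the complete graph is \<open>{{2i, 2i+1} | i < n}\<close>.\<close>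

definition cocktail_party_graph :: "nat \<Rightarrow> nat pair_pre_digraph" where
  "cocktail_party_graph n = graph_on {..<2 * n} (\<lambda>x y. x \<noteq> y \<and> x div 2 \<noteq> y div 2)"

definition hamming_distance :: "'a list \<Rightarrow> 'a list \<Rightarrow> nat" where
  "hamming_distance v w = card {i. i < length v \<and> v ! i \<noteq> w ! i}"

definition hamming_graph :: "nat \<Rightarrow> nat \<Rightarrow> nat list pair_pre_digraph" where
  "hamming_graph d n =
     graph_on {w. length w = d \<and> set w \<subseteq> {..<n}} (\<lambda>v w. hamming_distance v w = 1)"

definition johnson_graph :: "nat \<Rightarrow> nat \<Rightarrow> nat set pair_pre_digraph" where
  "johnson_graph n k =
     graph_on {S. S \<subseteq> {..<n} \<and> card S = k} (\<lambda>S T. card (S \<inter> T) + 1 = k)"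

definition demicube_graph :: "nat \<Rightarrow> bool list pair_pre_digraph" where
  "demicube_graph n =
     graph_on {w. length w = n \<and> even (count_list w True)} (\<lambda>v w. hamming_distance v w = 2)"

text \<open>
  The vertices of the polytope \<open>3\<^sub>2\<^sub>1\<close> are the 56 vectors obtained from \<open>\<plusminus>(3,3,-1,-1,-1,-1,-1,-1)\<close> by
  permuting coordinates; two of them span an edge iff their inner product is 8. Below, \<open>(s, S)\<close> is the
  vector with sign \<open>s\<close> and entries \<open>\<plusminus>3\<close> at the two positions in \<open>S\<close>. That this graph has the intersection
  array \<open>{27,10,1; 1,10,27}\<close>, which determines it up to isomorphism, is proved below.
\<close>

definition gosset_graph :: "(bool \<times> nat set) pair_pre_digraph" where
  "gosset_graph = graph_on {(s, S). S \<subseteq> {..<8} \<and> card S = 2}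
     (\<lambda>(s, S) (t, T). if s = t then card (S \<inter> T) = 1 else S \<inter> T = {})"

text \<open>
  The 27 lines on a smooth cubic surface in the classical notation \<open>a\<^sub>i\<close>, \<open>b\<^sub>i\<close>, \<open>c\<^sub>i\<^sub>j\<close> (\<open>i \<noteq> j\<close>, six
  indices), adjacent when they are skew. That this graph is strongly regular with parameters
  \<open>(27,16,10,8)\<close>, which determine it up to isomorphism, is proved below.
\<close>

datatype cubic_line = LineA nat | LineB nat | LineC "nat set"

fun skew_lines :: "cubic_line \<Rightarrow> cubic_line \<Rightarrow> bool" where
  "skew_lines (LineA i) (LineA j) \<longleftrightarrow> i \<noteq> j"
| "skew_lines (LineB i) (LineB j) \<longleftrightarrow> i \<noteq> j"
| "skew_lines (LineA i) (LineB j) \<longleftrightarrow> i = j"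
| "skew_lines (LineB i) (LineA j) \<longleftrightarrow> i = j"
| "skew_lines (LineA i) (LineC S) \<longleftrightarrow> i \<notin> S"
| "skew_lines (LineB i) (LineC S) \<longleftrightarrow> i \<notin> S"
| "skew_lines (LineC S) (LineA i) \<longleftrightarrow> i \<notin> S"
| "skew_lines (LineC S) (LineB i) \<longleftrightarrow> i \<notin> S"
| "skew_lines (LineC S) (LineC T) \<longleftrightarrow> card (S \<inter> T) = 1"

definition schlaefli_graph :: "cubic_line pair_pre_digraph" where
  "schlaefli_graph =
     graph_on (LineA ` {..<6} \<union> LineB ` {..<6} \<union> LineC ` {S. S \<subseteq> {..<6} \<and> card S = 2}) skew_lines"

section \<open>Parameters of the two sporadic graphs\<close>

lemma gdist_eqI:
  assumes "pair_graph G"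
    and D0: "\<And>x. x \<in> pverts G \<Longrightarrow> D x x = 0"
      "\<And>x y. x \<in> pverts G \<Longrightarrow> y \<in> pverts G \<Longrightarrow> D x y = 0 \<Longrightarrow> x = y"
    and Dle: "\<And>x y z. x \<in> pverts G \<Longrightarrow> (y, z) \<in> parcs G \<Longrightarrow> D x z \<le> Suc (D x y)"
    and DSuc: "\<And>x y n. x \<in> pverts G \<Longrightarrow> y \<in> pverts G \<Longrightarrow> D x y = Suc n \<Longrightarrow>
                 \<exists>z. (z, y) \<in> parcs G \<and> D x z = n"
    and x: "x \<in> pverts G" and y: "y \<in> pverts G"
  shows "gdist G x y = D x y"
    and "\<exists>p. pre_digraph.awalk (with_proj G) x p y"
proof -
  interpret pair_graph G by fact
  have le: "D x y \<le> length p" if "awalk x p y" for p y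
    using that
  proof (induction p arbitrary: y rule: rev_induct)
    case Nil
    then show ?case using D0(1) by (auto simp: awalk_Nil_iff)
  next
    case (snoc e p)
    from snoc.prems obtain w where w: "awalk x p w" "awalk w [e] y"
      by (auto simp: awalk_append_iff)
    then have "(w, y) \<in> parcs G"
      by (cases e) (auto simp: awalk_def)
    with Dle[OF x] snoc.IH[OF w(1)] show ?case by fastforce
  qed
  have ex: "\<exists>p. awalk x p y \<and> length p = n" if "y \<in> pverts G" "D x y = n" for n y
    using that
  proof (induction n arbitrary: y)
    case 0
    then show ?case using D0(2)[OF x] x by (auto simp: awalk_Nil_iff)
  next
    case (Suc n)
    from DSuc[OF x Suc.prems] obtain z where z: "(z, y) \<in> parcs G" "D x z = n" by auto
    then have "z \<in> pverts G" using in_arcsD1 by blast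
    from Suc.IH[OF this z(2)] obtain p where p: "awalk x p z" "length p = n" by auto
    moreover have "awalk z [(z, y)] y"
      using z(1) in_arcsD1 by (auto simp: awalk_def)
    ultimately have "awalk x (p @ [(z, y)]) y" by (rule_tac awalk_appendI)
    then show ?case using p(2) by (intro exI[of _ "p @ [(z, y)]"]) auto
  qed
  show "gdist G x y = D x y"
    unfolding gdist_def using ex[OF y refl] le by (intro Least_equality) auto
  show "\<exists>p. awalk x p y" using ex[OF y refl] by auto
qed

lemma pair_graph_graph_on:
  assumes "finite V"
    and "\<And>x. x \<in> V \<Longrightarrow> \<not> adj x x"
    and "\<And>x y. x \<in> V \<Longrightarrow> y \<in> V \<Longrightarrow> adj x y \<Longrightarrow> adj y x"
  shows "pair_graph (graph_on V adj)"
proof -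
  have "finite {(x, y). x \<in> V \<and> y \<in> V \<and> adj x y}"
    by (rule finite_subset[of _ "V \<times> V"]) (use assms(1) in auto)
  moreover have "sym {(x, y). x \<in> V \<and> y \<in> V \<and> adj x y}"
    by (rule symI) (use assms(3) in blast)
  ultimately show ?thesis
    using assms(1,2) by unfold_locales (auto simp: graph_on_def Digraph.symmetric_def)
qed

lemma card_filter_list:
  assumes "V = f ` set xs" "inj_on f (set xs)" "distinct xs"
  shows "card {z \<in> V. P z} = length (filter (P \<circ> f) xs)"
proof -
  have "{z \<in> V. P z} = f ` {x \<in> set xs. P (f x)}" using assms(1) by auto
  also have "card \<dots> = card {x \<in> set xs. P (f x)}"
    by (rule card_image) (use assms(2) in \<open>auto simp: inj_on_def\<close>)
  also have "\<dots> = length (filter (P \<circ> f) xs)"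
    using assms(3) by (metis (mono_tags, lifting) Collect_cong comp_apply distinct_card distinct_filter set_filter)
  finally show ?thesis .
qed

definition pair_list :: "nat \<Rightarrow> (nat \<times> nat) list" where
  "pair_list n = concat (map (\<lambda>i. map (Pair i) [Suc i..<n]) [0..<n])"

lemma set_pair_list: "set (pair_list n) = {(i, j). i < j \<and> j < n}"
  by (auto simp: pair_list_def image_iff)

lemma two_subsets: "{S. S \<subseteq> {..<n} \<and> card S = 2} = (\<lambda>(i, j). {i, j}) ` set (pair_list n)"
proof
  show "{S. S \<subseteq> {..<n} \<and> card S = 2} \<subseteq> (\<lambda>(i, j). {i, j}) ` set (pair_list n)"
  proof
    fix S assume "S \<in> {S. S \<subseteq> {..<n} \<and> card S = 2}"
    then obtain i j where S: "S = {i, j}" "i \<noteq> j" "i < n" "j < n"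
      by (auto simp: card_2_iff)
    then have "S = {min i j, max i j}" "min i j < max i j" "max i j < n" by (auto simp: min_def max_def)
    then show "S \<in> (\<lambda>(i, j). {i, j}) ` set (pair_list n)"
      unfolding set_pair_list by blast
  qed
qed (auto simp: set_pair_list)

lemma inj_pair_list: "inj_on (\<lambda>(i, j). {i, j}) (set (pair_list n))"
  by (auto simp: inj_on_def set_pair_list doubleton_eq_iff)

subsection \<open>The Schlaefli graph is strongly regular with parameters (27,16,10,8)\<close>

definition schlaefli_list :: "cubic_line list" where
  "schlaefli_list = map LineA [0..<6] @ map LineB [0..<6] @ map (\<lambda>(i, j). LineC {i, j}) (pair_list 6)"

definition schlaefli_check :: "cubic_line \<Rightarrow> cubic_line list \<Rightarrow> cubic_line \<Rightarrow> bool" where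
  "schlaefli_check x zs y \<longleftrightarrow>
     length (filter (skew_lines y) zs) = (if x = y then 16 else if skew_lines x y then 10 else 8)"

definition schlaefli_checks :: "cubic_line \<Rightarrow> bool" where
  "schlaefli_checks x \<longleftrightarrow> list_all (schlaefli_check x (filter (skew_lines x) schlaefli_list)) schlaefli_list"

lemma schlaefli_checks: "list_all schlaefli_checks schlaefli_list"
  by code_simp

lemma pverts_schlaefli: "pverts schlaefli_graph = set schlaefli_list"
  unfolding schlaefli_graph_def schlaefli_list_def graph_on_def two_subsets
  by (auto simp: image_iff split: prod.splits)

lemma distinct_schlaefli_list: "distinct schlaefli_list"
  by code_simp

lemma skew_lines_sym: "skew_lines x y \<Longrightarrow> skew_lines y x"
  by (cases x; cases y) (auto simp: Int_commute)

lemma pair_graph_schlaefli: "pair_graph schlaefli_graph"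
  unfolding schlaefli_graph_def
  by (rule pair_graph_graph_on) (auto intro: skew_lines_sym)

lemma schlaefli_strongly_regular:
  shows "card (pverts schlaefli_graph) = 27"
    and "x \<in> pverts schlaefli_graph \<Longrightarrow> deg schlaefli_graph x = 16"
    and "x \<in> pverts schlaefli_graph \<Longrightarrow> y \<in> pverts schlaefli_graph \<Longrightarrow> x \<noteq> y \<Longrightarrow>
           card (neighbours schlaefli_graph x \<inter> neighbours schlaefli_graph y) =
             (if (x, y) \<in> parcs schlaefli_graph then 10 else 8)"
proof -
  have "length schlaefli_list = 27" by code_simp
  then show "card (pverts schlaefli_graph) = 27"
    by (simp add: pverts_schlaefli distinct_card[OF distinct_schlaefli_list])
  have arcs: "(x, y) \<in> parcs schlaefli_graph \<longleftrightarrow>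
      x \<in> set schlaefli_list \<and> y \<in> set schlaefli_list \<and> skew_lines x y" for x y
    unfolding pverts_schlaefli[symmetric] by (simp add: schlaefli_graph_def graph_on_def)
  define common where
    "common x y = length (filter (skew_lines y) (filter (skew_lines x) schlaefli_list))" for x y
  have common: "card (neighbours schlaefli_graph x \<inter> neighbours schlaefli_graph y) = common x y"
    if "x \<in> pverts schlaefli_graph" "y \<in> pverts schlaefli_graph" for x y
  proof -
    have "neighbours schlaefli_graph x \<inter> neighbours schlaefli_graph y =
        {z \<in> set schlaefli_list. skew_lines x z \<and> skew_lines y z}"
      using that by (auto simp: neighbours_def arcs pverts_schlaefli)
    also have "card \<dots> = common x y"
      using card_filter_list[of "set schlaefli_list" id schlaefli_list "\<lambda>z. skew_lines x z \<and> skew_lines y z"]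
        distinct_schlaefli_list
      by (simp add: common_def)
    finally show ?thesis .
  qed
  have check: "common x y = (if x = y then 16 else if skew_lines x y then 10 else 8)"
    if "x \<in> pverts schlaefli_graph" "y \<in> pverts schlaefli_graph" for x y
    using schlaefli_checks that
    by (auto simp: list_all_iff schlaefli_checks_def schlaefli_check_def pverts_schlaefli common_def)
  show "deg schlaefli_graph x = 16" if "x \<in> pverts schlaefli_graph"
    using common[OF that that] check[OF that that] by (simp add: deg_def)
  show "card (neighbours schlaefli_graph x \<inter> neighbours schlaefli_graph y) =
             (if (x, y) \<in> parcs schlaefli_graph then 10 else 8)"
    if "x \<in> pverts schlaefli_graph" "y \<in> pverts schlaefli_graph" "x \<noteq> y"
    using common[OF that(1,2)] check[OF that(1,2)] that arcs by (auto simp: pverts_schlaefli)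
qed

subsection \<open>The Gosset graph has intersection array {27,10,1; 1,10,27}\<close>

fun gosset_dist :: "bool \<times> nat set \<Rightarrow> bool \<times> nat set \<Rightarrow> nat" where
  "gosset_dist (s, S) (t, T) = (if s = t then 2 - card (S \<inter> T) else Suc (card (S \<inter> T)))"

abbreviation (input) gosset_verts :: "(bool \<times> nat set) set" where
  "gosset_verts \<equiv> pverts gosset_graph"

lemma pverts_gosset: "pverts gosset_graph = UNIV \<times> {S. S \<subseteq> {..<8} \<and> card S = 2}"
  by (auto simp: gosset_graph_def graph_on_def)

lemma mem_gosset: "(s, S) \<in> gosset_verts \<longleftrightarrow> S \<subseteq> {..<8} \<and> card S = 2"
  by (simp add: pverts_gosset)

lemma finite_gosset: "finite gosset_verts"
  unfolding pverts_gosset by (rule finite_subset[of _ "UNIV \<times> Pow {..<8}"]) auto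

lemma card_Int_two_subset:
  assumes "card S = 2" "card T = 2"
  shows "card (S \<inter> T) \<le> 2" "card (S \<inter> T) = 2 \<longleftrightarrow> S = T"
proof -
  have fin: "finite S" "finite T" using assms card.infinite by fastforce+
  show "card (S \<inter> T) \<le> 2" using card_mono[of S "S \<inter> T"] fin assms by auto
  show "card (S \<inter> T) = 2 \<longleftrightarrow> S = T"
    using card_subset_eq[of S "S \<inter> T"] card_subset_eq[of T "S \<inter> T"] fin assms by auto
qed

lemma parcs_gosset:
  "(x, y) \<in> parcs gosset_graph \<longleftrightarrow> x \<in> gosset_verts \<and> y \<in> gosset_verts \<and> gosset_dist x y = 1"
proof (cases x; cases y)
  fix s S t T assume xy: "x = (s, S)" "y = (t, T)"
  have "finite S" if "card S = 2" using that card.infinite by fastforce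
  then show ?thesis
    using xy by (auto simp: mem_gosset) (auto simp: gosset_graph_def graph_on_def split: if_splits)
qed

lemma gosset_dist_commute: "gosset_dist x y = gosset_dist y x"
  by (cases x; cases y) (auto simp: Int_commute)

lemma gosset_dist_le: "x \<in> gosset_verts \<Longrightarrow> y \<in> gosset_verts \<Longrightarrow> gosset_dist x y \<le> 3"
  using card_Int_two_subset(1)[of "snd x" "snd y"] by (cases x; cases y) (auto simp: mem_gosset)

lemma gosset_dist_eq_0: "x \<in> gosset_verts \<Longrightarrow> y \<in> gosset_verts \<Longrightarrow> gosset_dist x y = 0 \<longleftrightarrow> x = y"
  using card_Int_two_subset[of "snd x" "snd y"] by (cases x; cases y) (auto simp: mem_gosset)

lemma pair_graph_gosset: "pair_graph gosset_graph"
  unfolding gosset_graph_def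
proof (rule pair_graph_graph_on)
  show "finite {(s :: bool, S). S \<subseteq> {..<8::nat} \<and> card S = 2}"
    using finite_gosset by (simp add: gosset_graph_def graph_on_def)
qed (auto simp: Int_commute split: if_splits)

definition gosset_list :: "(bool \<times> nat \<times> nat) list" where
  "gosset_list = map (Pair True) (pair_list 8) @ map (Pair False) (pair_list 8)"

fun gosset_decode :: "bool \<times> nat \<times> nat \<Rightarrow> bool \<times> nat set" where
  "gosset_decode (s, i, j) = (s, {i, j})"

fun overlap :: "nat \<times> nat \<Rightarrow> nat \<times> nat \<Rightarrow> nat" where
  "overlap (i, j) (k, l) = (if i = k \<or> i = l then if j = k \<or> j = l then 2 else 1
                            else if j = k \<or> j = l then 1 else 0)"

fun gosset_list_dist :: "bool \<times> nat \<times> nat \<Rightarrow> bool \<times> nat \<times> nat \<Rightarrow> nat" where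
  "gosset_list_dist (s, p) (t, q) = (if s = t then 2 - overlap p q else Suc (overlap p q))"

lemma gosset_verts_list: "gosset_verts = gosset_decode ` set gosset_list"
proof -
  have dec: "gosset_decode = map_prod id (\<lambda>(i, j). {i, j})" by (auto simp: fun_eq_iff)
  have "set gosset_list = UNIV \<times> set (pair_list 8)"
    by (auto simp: gosset_list_def UNIV_bool)
  then show ?thesis
    unfolding pverts_gosset two_subsets dec by (simp add: map_prod_surj_on image_id)
qed

lemma inj_gosset_decode: "inj_on gosset_decode (set gosset_list)"
  by (auto simp: inj_on_def gosset_list_def set_pair_list doubleton_eq_iff)

lemma distinct_gosset_list: "distinct gosset_list"
  by code_simp

lemma gosset_dist_decode:
  assumes "x \<in> set gosset_list" "y \<in> set gosset_list"
  shows "gosset_dist (gosset_decode x) (gosset_decode y) = gosset_list_dist x y"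
  using assms by (auto simp: gosset_list_def set_pair_list Int_insert_left)

definition gosset_check :: "nat \<Rightarrow> nat list \<Rightarrow> bool" where
  "gosset_check i ds \<longleftrightarrow> list_all (\<lambda>d. d \<le> Suc i) ds \<and>
     count_list (map Suc ds) i = [0, 1, 10, 27] ! i \<and>
     count_list ds i = [0, 16, 16, 0] ! i \<and>
     count_list ds (Suc i) = [27, 10, 1, 0] ! i"

definition gosset_adj_list :: "bool \<times> nat \<times> nat \<Rightarrow> bool \<times> nat \<times> nat \<Rightarrow> bool" where
  "gosset_adj_list x y \<longleftrightarrow> gosset_list_dist x y = 1"

definition gosset_checks :: "bool \<times> nat \<times> nat \<Rightarrow> bool \<times> nat \<times> nat \<Rightarrow> bool" where
  "gosset_checks x y \<longleftrightarrow>
     gosset_check (gosset_list_dist x y) (map (gosset_list_dist x) (filter (gosset_adj_list y) gosset_list))"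

lemma gosset_checks: "list_all (gosset_checks (True, 0, 1)) gosset_list"
  by code_simp

definition gosset_counts :: "bool \<times> nat set \<Rightarrow> bool \<times> nat set \<Rightarrow> bool" where
  "gosset_counts x y \<longleftrightarrow>
     (\<forall>z\<in>gosset_verts. gosset_dist y z = 1 \<longrightarrow> gosset_dist x z \<le> Suc (gosset_dist x y)) \<and>
     card {z \<in> gosset_verts. gosset_dist y z = 1 \<and> Suc (gosset_dist x z) = gosset_dist x y} =
       [0, 1, 10, 27] ! gosset_dist x y \<and>
     card {z \<in> gosset_verts. gosset_dist y z = 1 \<and> gosset_dist x z = gosset_dist x y} =
       [0, 16, 16, 0] ! gosset_dist x y \<and>
     card {z \<in> gosset_verts. gosset_dist y z = 1 \<and> gosset_dist x z = Suc (gosset_dist x y)} =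
       [27, 10, 1, 0] ! gosset_dist x y"

lemma gosset_counts_base:
  assumes "y \<in> gosset_verts"
  shows "gosset_counts (True, {0, 1}) y"
proof -
  define x :: "bool \<times> nat \<times> nat" where "x = (True, 0, 1)"
  have x: "x \<in> set gosset_list" by (auto simp: x_def gosset_list_def set_pair_list)
  obtain y' where y': "y' \<in> set gosset_list" "y = gosset_decode y'"
    using assms gosset_verts_list by auto
  have count: "card {z \<in> gosset_verts. gosset_dist y z = 1 \<and> P (gosset_dist (gosset_decode x) z)} =
      length (filter P (map (gosset_list_dist x) (filter (gosset_adj_list y') gosset_list)))" for P
  proof -
    have "card {z \<in> gosset_verts. gosset_dist y z = 1 \<and> P (gosset_dist (gosset_decode x) z)} =
        length (filter ((\<lambda>z. gosset_dist y z = 1 \<and> P (gosset_dist (gosset_decode x) z)) \<circ> gosset_decode)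
          gosset_list)"
      by (rule card_filter_list[OF gosset_verts_list inj_gosset_decode distinct_gosset_list])
    also have "filter ((\<lambda>z. gosset_dist y z = 1 \<and> P (gosset_dist (gosset_decode x) z)) \<circ> gosset_decode)
          gosset_list = filter (\<lambda>z. gosset_adj_list y' z \<and> P (gosset_list_dist x z)) gosset_list"
      using x y' by (intro filter_cong) (auto simp: gosset_dist_decode gosset_adj_list_def)
    finally show ?thesis by (simp add: filter_map comp_def conj_commute)
  qed
  have cl: "count_list ds i = length (filter (\<lambda>d. d = i) ds)"
    "count_list (map Suc ds) i = length (filter (\<lambda>d. Suc d = i) ds)" for ds i
    by (induction ds) auto
  have chk: "gosset_checks x y'" using gosset_checks y' by (auto simp: list_all_iff x_def)
  have i: "gosset_dist (gosset_decode x) y = gosset_list_dist x y'"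
    using x y' by (simp add: gosset_dist_decode)
  have "gosset_dist (gosset_decode x) z \<le> Suc (gosset_dist (gosset_decode x) y)"
    if z: "z \<in> gosset_verts" "gosset_dist y z = 1" for z
  proof -
    obtain z' where z': "z' \<in> set gosset_list" "z = gosset_decode z'"
      using z gosset_verts_list by auto
    have "\<forall>z\<in>set gosset_list. gosset_list_dist y' z = 1 \<longrightarrow> gosset_list_dist x z \<le> Suc (gosset_list_dist x y')"
      using chk unfolding gosset_checks_def gosset_check_def list_all_iff gosset_adj_list_def by auto
    with z z' x y' show ?thesis
      by (simp add: gosset_dist_decode)
  qed
  then have "gosset_counts (gosset_decode x) y"
    using chk unfolding gosset_counts_def gosset_checks_def gosset_check_def cl i[symmetric]
    using count[of "\<lambda>d. Suc d = gosset_dist (gosset_decode x) y"]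
      count[of "\<lambda>d. d = gosset_dist (gosset_decode x) y"]
      count[of "\<lambda>d. d = Suc (gosset_dist (gosset_decode x) y)"] by simp
  then show ?thesis by (simp add: x_def)
qed

lemma gosset_counts_iso:
  assumes bij: "bij_betw h gosset_verts gosset_verts"
    and iso: "\<And>x y. x \<in> gosset_verts \<Longrightarrow> y \<in> gosset_verts \<Longrightarrow> gosset_dist (h x) (h y) = gosset_dist x y"
    and x: "x \<in> gosset_verts" and y: "y \<in> gosset_verts"
    and counts: "gosset_counts (h x) (h y)"
  shows "gosset_counts x y"
proof -
  have "card {z \<in> gosset_verts. gosset_dist (h y) z = 1 \<and> P (gosset_dist (h x) z)} =
      card {z \<in> gosset_verts. gosset_dist y z = 1 \<and> P (gosset_dist x z)}" for P
  proof -
    have "{z \<in> gosset_verts. gosset_dist (h y) z = 1 \<and> P (gosset_dist (h x) z)} =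
        {z \<in> h ` gosset_verts. gosset_dist (h y) z = 1 \<and> P (gosset_dist (h x) z)}"
      using bij_betw_imp_surj_on[OF bij] by simp
    also have "\<dots> = h ` {z \<in> gosset_verts. gosset_dist (h y) (h z) = 1 \<and> P (gosset_dist (h x) (h z))}"
      by blast
    also have "{z \<in> gosset_verts. gosset_dist (h y) (h z) = 1 \<and> P (gosset_dist (h x) (h z))} =
        {z \<in> gosset_verts. gosset_dist y z = 1 \<and> P (gosset_dist x z)}"
      using iso x y by (intro Collect_cong) (metis (no_types, lifting))
    also have "card (h ` \<dots>) = card \<dots>"
      by (rule card_image, rule inj_on_subset[OF bij_betw_imp_inj_on[OF bij]]) blast
    finally show ?thesis .
  qed
  note card = this
  have "gosset_dist x z \<le> Suc (gosset_dist x y)" if "z \<in> gosset_verts" "gosset_dist y z = 1" for z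
  proof -
    have "h z \<in> gosset_verts" using bij that(1) by (rule bij_betwE[THEN bspec])
    then show ?thesis using counts iso x y that unfolding gosset_counts_def by metis
  qed
  then show ?thesis
    using counts card[of "\<lambda>d. Suc d = gosset_dist x y"] card[of "\<lambda>d. d = gosset_dist x y"]
      card[of "\<lambda>d. d = Suc (gosset_dist x y)"] iso[OF x y]
    unfolding gosset_counts_def by simp
qed

lemma gosset_counts:
  assumes x: "x \<in> gosset_verts" and y: "y \<in> gosset_verts"
  shows "gosset_counts x y"
proof -
  obtain s i j where ij: "x = (s, {i, j})" "i \<noteq> j" "i < 8" "j < 8"
    using x by (cases x) (auto simp: mem_gosset card_2_iff)
  define f where "f = transpose (transpose i 0 j) 1 \<circ> transpose i (0 :: nat)"
  have f: "f permutes {..<8}"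
    unfolding f_def using ij
    by (intro permutes_compose permutes_swap_id) (auto simp: transpose_def)
  have fij: "f i = 0" "f j = 1"
    using ij by (auto simp: f_def transpose_def)
  define h where "h = (\<lambda>(t :: bool, T). (t = s, f ` T))"
  have inj: "inj f" using f permutes_inj by blast
  have hV: "h z \<in> gosset_verts" if "z \<in> gosset_verts" for z
    using that permutes_in_image[OF f] card_image[OF inj_on_subset[OF inj subset_UNIV]]
    by (cases z) (auto simp: h_def mem_gosset)
  have "inj_on h gosset_verts"
    using inj by (auto simp: inj_on_def h_def inj_image_eq_iff)
  then have "bij_betw h gosset_verts gosset_verts"
    using hV finite_gosset by (intro bij_betw_imageI endo_inj_surj) auto
  moreover have "gosset_dist (h z) (h w) = gosset_dist z w" for z w
    using inj by (cases z; cases w)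
      (auto simp: h_def image_Int[symmetric] card_image inj_on_subset[OF inj subset_UNIV])
  moreover have "gosset_counts (h x) (h y)"
    using gosset_counts_base[OF hV[OF y]] fij ij by (simp add: h_def)
  ultimately show ?thesis using x y gosset_counts_iso by blast
qed

lemma gosset_neighbours:
  "y \<in> gosset_verts \<Longrightarrow> {z \<in> neighbours gosset_graph y. P z} = {z \<in> gosset_verts. gosset_dist y z = 1 \<and> P z}"
  by (auto simp: neighbours_def parcs_gosset)

lemma gosset_walks:
  assumes "x \<in> gosset_verts" "y \<in> gosset_verts"
  shows "gdist gosset_graph x y = gosset_dist x y"
    and "\<exists>p. pre_digraph.awalk (with_proj gosset_graph) x p y"
proof -
  have le: "gosset_dist x z \<le> Suc (gosset_dist x y)"
    if "x \<in> pverts gosset_graph" "(y, z) \<in> parcs gosset_graph" for x y z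
    using that gosset_counts[of x y] unfolding gosset_counts_def parcs_gosset by blast
  have Suc: "\<exists>z. (z, y) \<in> parcs gosset_graph \<and> gosset_dist x z = n"
    if xy: "x \<in> pverts gosset_graph" "y \<in> pverts gosset_graph" "gosset_dist x y = Suc n" for x y n
  proof -
    have "Suc n \<le> 3" using gosset_dist_le[of x y] xy by simp
    then have "n \<in> {0, 1, 2}" by auto
    then have "[0, 1, 10, 27] ! Suc n \<noteq> (0 :: nat)" by auto
    then have "card {z \<in> gosset_verts. gosset_dist y z = 1 \<and> Suc (gosset_dist x z) = gosset_dist x y} \<noteq> 0"
      using gosset_counts[of x y] xy unfolding gosset_counts_def by metis
    then have "{z \<in> gosset_verts. gosset_dist y z = 1 \<and> Suc (gosset_dist x z) = gosset_dist x y} \<noteq> {}"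
      by (metis card.empty)
    then show ?thesis using xy by (auto simp: parcs_gosset gosset_dist_commute[of y])
  qed
  note * = gdist_eqI[of gosset_graph gosset_dist, OF pair_graph_gosset _ _ le Suc]
  show "gdist gosset_graph x y = gosset_dist x y" "\<exists>p. pre_digraph.awalk (with_proj gosset_graph) x p y"
    by (rule *; use assms in \<open>auto simp: gosset_dist_eq_0\<close>)+
qed

lemma connected_gosset: "Digraph_Component.connected (with_proj gosset_graph)"
proof -
  interpret pair_graph gosset_graph by (rule pair_graph_gosset)
  have "(True, {0, 1}) \<in> gosset_verts" by (simp add: mem_gosset)
  moreover have "reachable (with_proj (mk_symmetric (with_proj gosset_graph))) x y"
    if "x \<in> gosset_verts" "y \<in> gosset_verts" for x y
    by (rule reachable_mk_symmetricI) (use gosset_walks(2)[OF that] in \<open>simp add: reachable_awalk\<close>)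
  ultimately show ?thesis
    unfolding Digraph_Component.connected_def strongly_connected_def by auto
qed

lemma gosset_intersection_array:
  shows "gdiameter gosset_graph = 3"
    and "intersection_numbers gosset_graph
           (\<lambda>i. [0, 1, 10, 27] ! i) (\<lambda>i. [0, 16, 16, 0] ! i) (\<lambda>i. [27, 10, 1, 0] ! i)"
proof -
  have V: "(True, {0, 1}) \<in> gosset_verts" "(False, {0, 1}) \<in> gosset_verts" by (simp_all add: mem_gosset)
  have d3: "3 = gdist gosset_graph (True, {0, 1}) (False, {0, 1})"
    using gosset_walks(1)[OF V] by simp
  show "gdiameter gosset_graph = 3"
    unfolding gdiameter_def
  proof (intro Max_eqI)
    show "finite {gdist gosset_graph x y |x y. x \<in> gosset_verts \<and> y \<in> gosset_verts}"
      by (rule finite_image_set2) (simp_all add: finite_gosset)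
    show "n \<le> 3" if "n \<in> {gdist gosset_graph x y |x y. x \<in> gosset_verts \<and> y \<in> gosset_verts}" for n
      using that gosset_walks(1) gosset_dist_le by auto
    show "3 \<in> {gdist gosset_graph x y |x y. x \<in> gosset_verts \<and> y \<in> gosset_verts}"
      using V d3 by blast
  qed
  show "intersection_numbers gosset_graph
           (\<lambda>i. [0, 1, 10, 27] ! i) (\<lambda>i. [0, 16, 16, 0] ! i) (\<lambda>i. [27, 10, 1, 0] ! i)"
    unfolding intersection_numbers_def
  proof (intro allI impI ballI)
    fix i x y assume xy: "x \<in> gosset_verts" "y \<in> gosset_verts" and i: "gdist gosset_graph x y = i"
    have i': "gosset_dist x y = i" using gosset_walks(1)[OF xy] i by simp
    have eq: "{z \<in> neighbours gosset_graph y. P (gdist gosset_graph x z)} =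
        {z \<in> gosset_verts. gosset_dist y z = 1 \<and> P (gosset_dist x z)}" for P
      unfolding gosset_neighbours[OF xy(2)] using gosset_walks(1)[OF xy(1)] by (intro Collect_cong) metis
    show "card {z \<in> neighbours gosset_graph y. gdist gosset_graph x z + 1 = i} = [0, 1, 10, 27] ! i \<and>
        card {z \<in> neighbours gosset_graph y. gdist gosset_graph x z = i} = [0, 16, 16, 0] ! i \<and>
        card {z \<in> neighbours gosset_graph y. gdist gosset_graph x z = i + 1} = [27, 10, 1, 0] ! i"
      using gosset_counts[OF xy] eq[of "\<lambda>d. d + 1 = i"] eq[of "\<lambda>d. d = i"] eq[of "\<lambda>d. d = i + 1"]
      unfolding gosset_counts_def i' by simp
  qed
qed

corollary distance_regular_gosset: "distance_regular gosset_graph"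
  unfolding distance_regular_def using connected_gosset gosset_intersection_array(2) by blast

end

theory Submission
  imports Defs "Jordan_Normal_Form.Spectral_Radius"
begin

text \<open>
  Sharpness makes every vertex a weight of a minuscule representation. Let \<open>\<theta>\<close> be the second largest adjacency
  eigenvalue of a sharp distance-regular graph. The projections of the vertices to its eigenspace lie on a
  sphere, with inner products depending only on the distance. For an edge \<open>xy\<close> the eigenfunction given by the
  inner product with \<open>x - y\<close> has its steepest edge at \<open>xy\<close>, so it is an optimal Kantorovich potential, and the
  transport from \<open>x\<close> to \<open>y\<close> moves mass only along edges that are translates of \<open>xy\<close> (two consecutive such edges
  would put three collinear points on the sphere). Hence every neighbour \<open>z\<close> of \<open>x\<close> outside the closed
  neighbourhood of \<open>y\<close> has a neighbour \<open>z + (y - x)\<close>. It follows that the edge vectors form a simply laced root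
  system, and that the vertex set is invariant under its reflections and has inner products \<open>-1, 0, 1\<close> with it.

  Such a graph is determined by the neighbourhood of one vertex, and this neighbourhood is again of the same
  type, with \<open>c\<^sub>2\<close> lowered by two. Descending along \<open>c\<^sub>2\<close> leads from disjoint cliques (Hamming graphs) through
  grids (Johnson graphs) to demicubes, the Schlaefli graph, the Gosset graph, and cocktail party graphs.
  Conversely, on a graph of this type the roots are eigenfunctions, and the translations are transport plans,
  that realise the common value \<open>(2 + a\<^sub>1) / k\<close> of the curvature and of the first eigenvalue.
\<close>

subsection \<open>Isomorphism, neighbourhoods and distance for binary relations\<close>

definition iso_on :: "'a set \<Rightarrow> ('a \<Rightarrow> 'a \<Rightarrow> bool) \<Rightarrow> 'b set \<Rightarrow> ('b \<Rightarrow> 'b \<Rightarrow> bool) \<Rightarrow> bool" where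
  "iso_on V A W B \<longleftrightarrow> (\<exists>f. bij_betw f V W \<and> (\<forall>x\<in>V. \<forall>y\<in>V. A x y \<longleftrightarrow> B (f x) (f y)))"

lemma iso_onI:
  "bij_betw f V W \<Longrightarrow> (\<And>x y. x \<in> V \<Longrightarrow> y \<in> V \<Longrightarrow> A x y \<longleftrightarrow> B (f x) (f y)) \<Longrightarrow> iso_on V A W B"
  unfolding iso_on_def by blast

lemma iso_onE:
  assumes "iso_on V A W B"
  obtains f where "bij_betw f V W" "\<And>x y. x \<in> V \<Longrightarrow> y \<in> V \<Longrightarrow> A x y \<longleftrightarrow> B (f x) (f y)"
  using assms unfolding iso_on_def by blast

lemma iso_on_sym:
  assumes "iso_on V A W B" shows "iso_on W B V A"
proof -
  obtain f where f: "bij_betw f V W" "\<And>x y. x \<in> V \<Longrightarrow> y \<in> V \<Longrightarrow> A x y \<longleftrightarrow> B (f x) (f y)"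
    by (rule iso_onE[OF assms]) blast
  let ?g = "inv_into V f"
  show ?thesis
  proof (rule iso_onI)
    show "bij_betw ?g W V" using f(1) by (rule bij_betw_inv_into)
    fix x y assume "x \<in> W" "y \<in> W"
    then have "?g x \<in> V" "?g y \<in> V" "f (?g x) = x" "f (?g y) = y"
      using bij_betwE[OF bij_betw_inv_into[OF f(1)]] bij_betw_inv_into_right[OF f(1)] by auto
    then show "B x y \<longleftrightarrow> A (?g x) (?g y)" using f(2)[of "?g x" "?g y"] by simp
  qed
qed

lemma iso_on_trans [trans]:
  assumes "iso_on V A W B" "iso_on W B U C" shows "iso_on V A U C"
proof -
  obtain f where f: "bij_betw f V W" "\<And>x y. x \<in> V \<Longrightarrow> y \<in> V \<Longrightarrow> A x y \<longleftrightarrow> B (f x) (f y)"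
    by (rule iso_onE[OF assms(1)]) blast
  obtain g where g: "bij_betw g W U" "\<And>x y. x \<in> W \<Longrightarrow> y \<in> W \<Longrightarrow> B x y \<longleftrightarrow> C (g x) (g y)"
    by (rule iso_onE[OF assms(2)]) blast
  show ?thesis
  proof (rule iso_onI)
    show "bij_betw (g \<circ> f) V U" using f(1) g(1) by (rule bij_betw_trans)
    fix x y assume "x \<in> V" "y \<in> V"
    then show "A x y \<longleftrightarrow> C ((g \<circ> f) x) ((g \<circ> f) y)" using f(2) g(2) bij_betwE[OF f(1)] by simp
  qed
qed

lemma iso_on_cong:
  assumes "\<And>x y. x \<in> V \<Longrightarrow> y \<in> V \<Longrightarrow> A x y \<longleftrightarrow> A' x y" "\<And>x y. x \<in> W \<Longrightarrow> y \<in> W \<Longrightarrow> B x y \<longleftrightarrow> B' x y"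
  shows "iso_on V A W B \<longleftrightarrow> iso_on V A' W B'"
proof -
  have "(\<forall>x\<in>V. \<forall>y\<in>V. A x y \<longleftrightarrow> B (f x) (f y)) \<longleftrightarrow> (\<forall>x\<in>V. \<forall>y\<in>V. A' x y \<longleftrightarrow> B' (f x) (f y))"
    if "bij_betw f V W" for f
    using assms bij_betwE[OF that] by simp
  then show ?thesis unfolding iso_on_def by blast
qed

lemma iso_on_if_bisimulation:
  assumes carriers: "\<And>x y. S x y \<Longrightarrow> x \<in> V \<and> y \<in> W"
    and total: "\<And>x. x \<in> V \<Longrightarrow> \<exists>y. S x y" "\<And>y. y \<in> W \<Longrightarrow> \<exists>x. S x y"
    and unique: "\<And>x y y'. S x y \<Longrightarrow> S x y' \<Longrightarrow> y = y'" "\<And>x x' y. S x y \<Longrightarrow> S x' y \<Longrightarrow> x = x'"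
    and forward: "\<And>x x' y. S x y \<Longrightarrow> A x x' \<Longrightarrow> \<exists>y'. B y y' \<and> S x' y'"
    and backward: "\<And>x y y'. S x y \<Longrightarrow> B y y' \<Longrightarrow> \<exists>x'. A x x' \<and> S x' y'"
  shows "iso_on V A W B"
proof -
  define f where "f x = (THE y. S x y)" for x
  have f: "S x y \<longleftrightarrow> x \<in> V \<and> f x = y" for x y
    unfolding f_def using carriers total(1) unique(1) by (metis the_equality)
  show ?thesis
  proof (rule iso_onI)
    show "bij_betw f V W"
    proof (rule bij_betwI')
      show "f x = f y \<longleftrightarrow> x = y" if "x \<in> V" "y \<in> V" for x y
        using that f[of x "f x"] f[of y "f x"] unique(2)[of x "f x" y] by auto
      show "f x \<in> W" if "x \<in> V" for x using that f carriers by blast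
      show "\<exists>x\<in>V. y = f x" if "y \<in> W" for y using total(2)[OF that] f by auto
    qed
    fix x y assume "x \<in> V" "y \<in> V"
    then have S: "S x (f x)" "S y (f y)" using f by auto
    then show "A x y \<longleftrightarrow> B (f x) (f y)"
      using forward[OF S(1)] backward[OF S(1)] unique(1)[OF S(2)] unique(2)[OF _ S(2)] by blast
  qed
qed

definition nbhd :: "('a \<Rightarrow> 'a \<Rightarrow> bool) \<Rightarrow> 'a \<Rightarrow> 'a set" where "nbhd A x = {y. A x y}"

definition closed_nbhd :: "('a \<Rightarrow> 'a \<Rightarrow> bool) \<Rightarrow> 'a \<Rightarrow> 'a set" where
  "closed_nbhd A x = insert x (nbhd A x)"

definition local_adj :: "('a \<Rightarrow> 'a \<Rightarrow> bool) \<Rightarrow> 'a \<Rightarrow> 'a \<Rightarrow> 'a \<Rightarrow> bool" where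
  "local_adj A x y z \<longleftrightarrow> A x y \<and> A x z \<and> A y z"

lemma mem_nbhd [simp]: "y \<in> nbhd A x \<longleftrightarrow> A x y" by (simp add: nbhd_def)

lemma mem_closed_nbhd: "y \<in> closed_nbhd A x \<longleftrightarrow> y = x \<or> A x y" by (simp add: closed_nbhd_def)

lemma iso_on_local_adj: "iso_on (nbhd A x) (local_adj A x) W B \<longleftrightarrow> iso_on (nbhd A x) A W B"
  by (rule iso_on_cong) (auto simp: local_adj_def)

definition walk_dist :: "('a \<Rightarrow> 'a \<Rightarrow> bool) \<Rightarrow> 'a \<Rightarrow> 'a \<Rightarrow> nat" where
  "walk_dist A x y = (LEAST n. (A ^^ n) x y)"

lemma walk_dist_le: "(A ^^ n) x y \<Longrightarrow> walk_dist A x y \<le> n"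
  unfolding walk_dist_def by (rule Least_le)

lemma walk_dist_self [simp]: "walk_dist A x x = 0" using walk_dist_le[of 0 A x x] by simp

lemma relpowp_symp:
  assumes "symp A" "(A ^^ n) x y" shows "(A ^^ n) y x"
  using assms(2)
proof (induction n arbitrary: y)
  case (Suc n)
  then obtain z where "(A ^^ n) x z" "A z y" by (auto elim: relpowp_Suc_E)
  then show ?case using Suc.IH sympD[OF assms(1)] relpowp_Suc_I2 by metis
qed simp

lemma walk_dist_commute: "symp A \<Longrightarrow> walk_dist A x y = walk_dist A y x"
  unfolding walk_dist_def using relpowp_symp by metis

locale connected_simple_graph =
  fixes V :: "'a set" and A :: "'a \<Rightarrow> 'a \<Rightarrow> bool"
  assumes finite_V: "finite V"
    and A_V: "A x y \<Longrightarrow> x \<in> V"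
    and A_sym: "A x y \<Longrightarrow> A y x"
    and A_irrefl: "\<not> A x x"
    and A_conn: "x \<in> V \<Longrightarrow> y \<in> V \<Longrightarrow> A\<^sup>*\<^sup>* x y"
begin

lemma A_V2: "A x y \<Longrightarrow> y \<in> V" using A_sym A_V by blast

lemma nbhd_subset: "nbhd A x \<subseteq> V" using A_V2 by auto

lemma closed_nbhd_subset: "x \<in> V \<Longrightarrow> closed_nbhd A x \<subseteq> V"
  using nbhd_subset by (simp add: closed_nbhd_def)

lemma finite_nbhd: "finite (nbhd A x)" using nbhd_subset finite_V by (rule finite_subset)

lemma V_induct [consumes 2, case_names base step]:
  assumes "x \<in> V" "y \<in> V" "P x" "\<And>y z. y \<in> V \<Longrightarrow> P y \<Longrightarrow> A y z \<Longrightarrow> P z"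
  shows "P y"
proof -
  have "A\<^sup>*\<^sup>* x y" using A_conn assms by blast
  then have "P y \<and> y \<in> V"
    by (induction rule: rtranclp_induct) (use assms A_V2 in blast)+
  then show ?thesis by blast
qed

lemma walk_dist_sym: "walk_dist A x y = walk_dist A y x"
  using A_sym by (intro walk_dist_commute sympI)

lemma walk_dist_attained: "x \<in> V \<Longrightarrow> y \<in> V \<Longrightarrow> (A ^^ walk_dist A x y) x y"
  unfolding walk_dist_def using A_conn[of x y] by (metis LeastI rtranclp_imp_relpowp)

lemma walk_dist_eq_0_iff: "x \<in> V \<Longrightarrow> y \<in> V \<Longrightarrow> walk_dist A x y = 0 \<longleftrightarrow> x = y"
  using walk_dist_attained[of x y] by auto

lemma walk_dist_eq_1_iff:
  assumes "x \<in> V" "y \<in> V" shows "walk_dist A x y = 1 \<longleftrightarrow> A x y"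
proof
  assume "walk_dist A x y = 1"
  then show "A x y" using walk_dist_attained[OF assms] by (simp add: eq_OO)
next
  assume "A x y"
  then have "walk_dist A x y \<le> 1" "x \<noteq> y" using walk_dist_le[of 1 A x y] A_irrefl by auto
  then show "walk_dist A x y = 1" using walk_dist_eq_0_iff[OF assms] by simp
qed

lemma walk_dist_adj: "A x y \<Longrightarrow> walk_dist A x y = 1"
  using walk_dist_eq_1_iff A_V A_V2 by blast

lemma walk_dist_triangle:
  assumes "x \<in> V" "y \<in> V" "z \<in> V" shows "walk_dist A x z \<le> walk_dist A x y + walk_dist A y z"
  using assms walk_dist_attained by (blast intro: walk_dist_le relpowp_trans)

lemma walk_dist_step_left: "A x y \<Longrightarrow> z \<in> V \<Longrightarrow> walk_dist A x z \<le> Suc (walk_dist A y z)"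
  using walk_dist_triangle[of x y z] walk_dist_adj[of x y] A_V A_V2 by simp

lemma walk_dist_step_right: "A y z \<Longrightarrow> x \<in> V \<Longrightarrow> walk_dist A x z \<le> Suc (walk_dist A x y)"
  using walk_dist_triangle[of x y z] walk_dist_adj[of y z] A_V A_V2 by simp

lemma walk_dist_Suc_left:
  assumes "x \<in> V" "z \<in> V" "walk_dist A x z = Suc m"
  obtains y where "A x y" "walk_dist A y z = m"
proof -
  obtain y where y: "A x y" "(A ^^ m) y z"
    using walk_dist_attained[OF assms(1,2)] assms(3) relpowp_Suc_D2 by metis
  have "walk_dist A y z = m"
    using walk_dist_le[OF y(2)] walk_dist_step_left[OF y(1) assms(2)] assms(3) by simp
  with y(1) that show ?thesis by blast
qed

lemma walk_dist_Suc_right: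
  assumes "x \<in> V" "z \<in> V" "walk_dist A x z = Suc m"
  obtains y where "A y z" "walk_dist A x y = m"
  using walk_dist_Suc_left[of z x m] assms walk_dist_sym A_sym by metis

lemma walk_dist_eq_2:
  assumes "A x y" "A y z" "x \<noteq> z" "\<not> A x z" shows "walk_dist A x z = 2"
proof -
  have V: "x \<in> V" "z \<in> V" using assms A_V A_V2 by auto
  have "walk_dist A x z \<le> 2"
    using walk_dist_step_right[OF assms(2) V(1)] walk_dist_adj[OF assms(1)] by simp
  moreover have "walk_dist A x z \<noteq> 0" "walk_dist A x z \<noteq> 1"
    using walk_dist_eq_0_iff[OF V] walk_dist_eq_1_iff[OF V] assms by auto
  ultimately show ?thesis by simp
qed

lemma diff_le_walk_dist:
  fixes f :: "'a \<Rightarrow> real"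
  assumes L: "\<And>x y. A x y \<Longrightarrow> f x - f y \<le> L" and "x \<in> V" "y \<in> V"
  shows "f x - f y \<le> L * walk_dist A x y"
  using assms(2,3)
proof (induction "walk_dist A x y" arbitrary: x)
  case 0
  then have "x = y" using walk_dist_eq_0_iff[of x y] by simp
  then show ?case by simp
next
  case (Suc n)
  obtain z where z: "A x z" "walk_dist A z y = n"
    by (rule walk_dist_Suc_left[OF Suc.prems Suc.hyps(2)[symmetric]])
  have "f z - f y \<le> L * walk_dist A z y" using Suc.hyps(1)[of z] z A_V2[OF z(1)] Suc.prems(2) by simp
  moreover have "real (walk_dist A x y) = real n + 1" using Suc.hyps(2) by simp
  ultimately show ?case using L[OF z(1)] z(2) by (simp add: algebra_simps)
qed

end

lemma connected_simple_graph_pullback: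
  assumes "connected_simple_graph V A" and f: "bij_betw f W V"
    and B: "\<And>x y. B x y \<longleftrightarrow> x \<in> W \<and> y \<in> W \<and> A (f x) (f y)"
  shows "connected_simple_graph W B"
proof -
  interpret connected_simple_graph V A by fact
  let ?g = "inv_into W f"
  have g: "?g v \<in> W" "f (?g v) = v" if "v \<in> V" for v
    using that bij_betwE[OF bij_betw_inv_into[OF f]] bij_betw_inv_into_right[OF f] by auto
  show ?thesis
  proof
    fix x y assume xy: "x \<in> W" "y \<in> W"
    have "B\<^sup>*\<^sup>* (?g u) (?g v)" if "A\<^sup>*\<^sup>* u v" for u v
      using that
    proof (induction rule: rtranclp_induct)
      case (step v w)
      then have "B (?g v) (?g w)" using B g A_V A_V2 by simp
      with step.IH show ?case by simp
    qed simp
    moreover have "A\<^sup>*\<^sup>* (f x) (f y)" using A_conn bij_betwE[OF f] xy by blast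
    ultimately have "B\<^sup>*\<^sup>* (?g (f x)) (?g (f y))" by blast
    then show "B\<^sup>*\<^sup>* x y" using bij_betw_inv_into_left[OF f] xy by simp
  qed (use B A_sym A_irrefl bij_betw_finite[OF f] finite_V in auto)
qed

subsection \<open>Minuscule graphs\<close>

text \<open>
  \<open>D x y\<close> is half the squared Euclidean distance of two weights in a minuscule Weyl orbit, so
  \<open>parallel x y z w\<close> says that the vectors \<open>w - z\<close> and \<open>y - x\<close> agree.
\<close>

definition parallel_on :: "'a set \<Rightarrow> ('a \<Rightarrow> 'a \<Rightarrow> real) \<Rightarrow> 'a \<Rightarrow> 'a \<Rightarrow> 'a \<Rightarrow> 'a \<Rightarrow> bool" where
  "parallel_on V D x y z w \<longleftrightarrow> (\<forall>s\<in>V. D s w - D s z = D s y - D s x)"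

locale minuscule = connected_simple_graph V A for V :: "'a set" and A :: "'a \<Rightarrow> 'a \<Rightarrow> bool" +
  fixes D :: "'a \<Rightarrow> 'a \<Rightarrow> real"
  assumes D_self: "x \<in> V \<Longrightarrow> D x x = 0"
    and D_sym: "x \<in> V \<Longrightarrow> y \<in> V \<Longrightarrow> D x y = D y x"
    and D_adj: "A x y \<Longrightarrow> D x y = 1"
    and D_two: "A x y \<Longrightarrow> A y z \<Longrightarrow> x \<noteq> z \<Longrightarrow> \<not> A x z \<Longrightarrow> D x z = 2"
    and parallelogram: "A x y \<Longrightarrow> A x z \<Longrightarrow> z \<noteq> y \<Longrightarrow> \<not> A y z \<Longrightarrow>
      \<exists>w. A y w \<and> A z w \<and> parallel_on V D x y z w"
begin

abbreviation parallel :: "'a \<Rightarrow> 'a \<Rightarrow> 'a \<Rightarrow> 'a \<Rightarrow> bool" where "parallel \<equiv> parallel_on V D"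

lemma parallelD: "parallel x y z w \<Longrightarrow> s \<in> V \<Longrightarrow> D s w - D s z = D s y - D s x"
  unfolding parallel_on_def by blast

lemma parallel_refl: "parallel x y x y" unfolding parallel_on_def by simp

lemma parallel_sym: "parallel x y z w \<Longrightarrow> parallel z w x y" unfolding parallel_on_def by simp

lemma parallel_trans: "parallel x y z w \<Longrightarrow> parallel z w u v \<Longrightarrow> parallel x y u v"
  unfolding parallel_on_def by simp

lemma parallel_reverse: "parallel x y z w \<Longrightarrow> parallel y x w z"
  unfolding parallel_on_def by (simp add: algebra_simps)

lemma parallel_transpose: "parallel x y z w \<Longrightarrow> parallel x z y w"
  unfolding parallel_on_def by (simp add: algebra_simps)

lemma D_common_neighbour:
  assumes "A t x" "A t y"
  shows "D x y = (if x = y then 0 else if A x y then 1 else 2)"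
  using assms D_self D_adj D_two A_sym A_V by metis

lemma D_common_neighbour_iff:
  assumes "A t x" "A t y"
  shows "D x y = 0 \<longleftrightarrow> x = y" "D x y = 1 \<longleftrightarrow> A x y" "D x y = 2 \<longleftrightarrow> x \<noteq> y \<and> \<not> A x y"
  using D_common_neighbour[OF assms] A_irrefl by auto

lemma ex_translate:
  assumes "A x y" "A x z" "z \<noteq> y" "\<not> A y z"
  obtains w where "A y w" "A z w" "parallel x y z w" "w \<noteq> x" "\<not> A x w"
proof -
  obtain w where w: "A y w" "A z w" "parallel x y z w"
    using parallelogram[OF assms] by blast
  have "D x w - D x z = D x y - D x x" using parallelD[OF w(3)] assms A_V by blast
  then have "D x w = 2" using assms D_adj D_self A_V by simp
  then have "w \<noteq> x" "\<not> A x w" using D_self[of x] assms A_V D_adj[of x w] by auto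
  with w that show ?thesis by blast
qed

text \<open>
  The three cases are \<open>\<langle>t, y - x\<rangle> = -1\<close>, \<open>1\<close> and \<open>0\<close>: in the first two the reflection in the root
  \<open>y - x\<close> moves \<open>t\<close> to a neighbour.
\<close>

definition root_trichotomy :: "'a \<Rightarrow> 'a \<Rightarrow> 'a \<Rightarrow> bool" where
  "root_trichotomy x y t \<longleftrightarrow>
     D t x - D t y = -1 \<and> (\<exists>t'. A t t' \<and> parallel x y t t') \<or>
     D t x - D t y = 1 \<and> (\<exists>t'. A t t' \<and> parallel x y t' t) \<or>
     D t x - D t y = 0 \<and> (\<exists>u u'. A t u \<and> A t u' \<and> A u u' \<and> parallel x y u u')"

lemma root_trichotomy_cases [consumes 1, case_names minus plus zero]:
  assumes "root_trichotomy x y t"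
  obtains t' where "D t x - D t y = -1" "A t t'" "parallel x y t t'"
    | t' where "D t x - D t y = 1" "A t t'" "parallel x y t' t"
    | u u' where "D t x - D t y = 0" "A t u" "A t u'" "A u u'" "parallel x y u u'"
  using assms unfolding root_trichotomy_def by blast

lemma root_trichotomy_parallel:
  assumes "parallel x y z w" "t \<in> V" "root_trichotomy z w t" shows "root_trichotomy x y t"
proof -
  have "D t x - D t y = D t z - D t w" using parallelD[OF assms(1,2)] by simp
  with assms(3) show ?thesis
    unfolding root_trichotomy_def using parallel_trans[OF assms(1)] by metis
qed

lemma root_trichotomy_reverse:
  assumes "root_trichotomy x y t" shows "root_trichotomy y x t"
  using assms
proof (cases rule: root_trichotomy_cases)
  case (minus t')
  then show ?thesis using parallel_reverse unfolding root_trichotomy_def by auto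
next
  case (plus t')
  then show ?thesis using parallel_reverse unfolding root_trichotomy_def by auto
next
  case (zero u u')
  then have "D t y - D t x = 0" "A u' u" "parallel y x u' u" using parallel_reverse A_sym by auto
  with zero show ?thesis unfolding root_trichotomy_def by blast
qed

lemma root_trichotomy_adj:
  assumes "A x y" "A x t" shows "root_trichotomy x y t"
proof -
  consider (same) "t = y" | (adjacent) "t \<noteq> y" "A y t" | (apart) "t \<noteq> y" "\<not> A y t" by blast
  then show ?thesis
  proof cases
    case same
    then have "D t x - D t y = 1" using assms A_V D_adj A_sym D_self by (metis diff_zero)
    then show ?thesis using same assms(1) A_sym parallel_refl unfolding root_trichotomy_def by blast
  next
    case adjacent
    then have "D t x - D t y = 0" using assms D_adj A_sym by (metis diff_self)
    then show ?thesis using adjacent assms A_sym parallel_refl unfolding root_trichotomy_def by blast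
  next
    case apart
    then obtain t' where "A t t'" "parallel x y t t'" using ex_translate[OF assms] by metis
    moreover have "D t x = 1" "D t y = 2" using apart assms D_adj D_two A_sym by blast+
    ultimately show ?thesis unfolding root_trichotomy_def by auto
  qed
qed

lemma root_trichotomy_near:
  assumes "A x y" "t \<in> closed_nbhd A x \<union> closed_nbhd A y" shows "root_trichotomy x y t"
proof -
  have "root_trichotomy x y t" if "A x t" using root_trichotomy_adj[OF assms(1) that] .
  moreover have "root_trichotomy x y t" if "A y t"
    using root_trichotomy_reverse[OF root_trichotomy_adj[OF A_sym[OF assms(1)] that]] .
  ultimately show ?thesis using assms A_sym by (auto simp: mem_closed_nbhd)
qed

lemma translate_edge:
  assumes "A t u" "A t u'" "A u u'" "A t w" and far: "w \<notin> closed_nbhd A u \<union> closed_nbhd A u'"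
  obtains v v' where "A w v" "A w v'" "A v v'" "parallel u u' v v'"
proof -
  obtain v where v: "A w v" "A u v" "parallel t w u v"
    using ex_translate[OF assms(4,1)] far A_sym by (metis Un_iff mem_closed_nbhd)
  obtain v' where v': "A w v'" "A u' v'" "parallel t w u' v'"
    using ex_translate[OF assms(4,2)] far A_sym by (metis Un_iff mem_closed_nbhd)
  have p: "parallel u u' v v'"
    using parallel_transpose[OF parallel_trans[OF parallel_sym[OF v(3)] v'(3)]] .
  have V: "u' \<in> V" "v \<in> V" "v' \<in> V" using v v' A_V A_V2 by blast+
  have "D u' v - D u' u = D u' w - D u' t" using parallelD[OF v(3)] V by blast
  moreover have "D u' u = 1" "D u' t = 1" using assms A_sym D_adj by blast+
  moreover have "D u' w = 2" using D_two[of u' t w] assms A_sym by (auto simp: mem_closed_nbhd)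
  ultimately have "D u' v = 2" by simp
  moreover have "D v v' - D v v = D v u' - D v u" using parallelD[OF p] V by blast
  moreover have "D v u = 1" using v A_sym D_adj by blast
  ultimately have "D v v' = 1" using D_self D_sym V by simp
  then have "A v v'" using D_common_neighbour_iff(2)[OF v(1) v'(1)] by simp
  with v v' p that show ?thesis by blast
qed

lemma root_trichotomy_step:
  assumes xy: "A x y" and t: "t \<in> V" and tri: "root_trichotomy x y t" and tw: "A t w"
  shows "root_trichotomy x y w"
proof -
  have w: "w \<in> V" using tw A_V2 by blast
  have near: "root_trichotomy x y w"
    if "A p q" "parallel x y p q" "w \<in> closed_nbhd A p \<union> closed_nbhd A q" for p q
    using root_trichotomy_parallel[OF that(2) w root_trichotomy_near[OF that(1,3)]] .
  from tri show ?thesis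
  proof (cases rule: root_trichotomy_cases)
    case (minus t')
    then show ?thesis using near[of t t'] tw by (simp add: mem_closed_nbhd)
  next
    case (plus t')
    then show ?thesis using near[of t' t] tw A_sym by (simp add: mem_closed_nbhd)
  next
    case (zero u u')
    show ?thesis
    proof (cases "w \<in> closed_nbhd A u \<union> closed_nbhd A u'")
      case True
      then show ?thesis using near zero by blast
    next
      case False
      obtain v v' where v: "A w v" "A w v'" "A v v'" "parallel u u' v v'"
        by (rule translate_edge[OF zero(2-4) tw False])
      have p: "parallel x y v v'" using parallel_trans[OF zero(5) v(4)] .
      then have "D w x - D w y = 0" using parallelD[OF p w] v D_adj by simp
      with v p show ?thesis unfolding root_trichotomy_def by blast
    qed
  qed
qed

theorem root_trichotomy:
  assumes "A x y" "t \<in> V" shows "root_trichotomy x y t"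
  using A_V[OF assms(1)] assms(2)
proof (induction rule: V_induct)
  case base
  show ?case using root_trichotomy_near[OF assms(1)] by (simp add: mem_closed_nbhd)
next
  case (step t w)
  then show ?case using root_trichotomy_step[OF assms(1)] by blast
qed

lemma root_values:
  assumes "A x y" "t \<in> V" shows "D t x - D t y \<in> {-1, 0, 1}"
  using root_trichotomy[OF assms] unfolding root_trichotomy_def by auto

lemma ex_parallel_edge:
  assumes "A x y" "t \<in> V" "D t x - D t y = -1"
  obtains w where "A t w" "parallel x y t w"
  using root_trichotomy[OF assms(1,2)] assms(3) by (cases rule: root_trichotomy_cases) auto

lemma ex_parallel_edge_in_closed_nbhd:
  assumes "A z w" "x \<in> V"
  obtains p q where "p \<in> closed_nbhd A x" "q \<in> closed_nbhd A x" "A p q" "parallel p q z w"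
  using root_trichotomy[OF assms]
proof (cases rule: root_trichotomy_cases)
  case (minus t)
  then show ?thesis using that[of x t] parallel_sym by (simp add: mem_closed_nbhd)
next
  case (plus t)
  then show ?thesis using that[of t x] parallel_sym A_sym by (simp add: mem_closed_nbhd)
next
  case (zero u u')
  then show ?thesis using that[of u u'] parallel_sym by (simp add: mem_closed_nbhd)
qed

lemma walk_dist_translate_le:
  assumes D_small: "\<And>p q. p \<in> V \<Longrightarrow> q \<in> V \<Longrightarrow> walk_dist A p q < n \<Longrightarrow> D p q = walk_dist A p q"
    and cz: "A c z"
  shows "t \<in> V \<Longrightarrow> walk_dist A t c = m \<Longrightarrow> walk_dist A t z = Suc m \<Longrightarrow> Suc m < n \<Longrightarrow>
    A t t' \<Longrightarrow> parallel c z t t' \<Longrightarrow> walk_dist A t' z \<le> m"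
proof (induction m arbitrary: t t')
  case 0
  have V: "c \<in> V" "z \<in> V" using cz A_V A_V2 by auto
  have tc: "t = c" using 0 walk_dist_eq_0_iff V by blast
  have "D z t' - D z t = D z z - D z c" using parallelD[OF 0(6)] V by blast
  then have "D z t' = 0" using tc D_self V by simp
  then have "t' = z" using D_common_neighbour_iff(1)[of c z t'] cz 0(5) tc by simp
  then show ?case by simp
next
  case (Suc m)
  have V: "c \<in> V" "z \<in> V" "t' \<in> V" using cz A_V A_V2 Suc.prems by auto
  obtain t1 where t1: "A t t1" "walk_dist A t1 c = m"
    by (rule walk_dist_Suc_left[OF Suc.prems(1) V(1) Suc.prems(2)])
  have t1V: "t1 \<in> V" using t1 A_V2 by blast
  have t1z: "walk_dist A t1 z = Suc m"
    using walk_dist_step_left[OF t1(1) V(2)] walk_dist_step_right[OF cz t1V] t1 Suc.prems by simp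
  have d: "D t1 c = m" "D t1 z = Suc m" using D_small t1V V t1 t1z Suc.prems by simp_all
  have "D t' t' - D t' t = D t' z - D t' c" using parallelD[OF Suc.prems(6)] V by blast
  then have "D t' c - D t' z = 1" using D_self V Suc.prems D_adj A_sym by simp
  then have "t1 \<noteq> t'" using d by auto
  moreover have "\<not> A t' t1"
  proof -
    have "D t1 t' - D t1 t = D t1 z - D t1 c" using parallelD[OF Suc.prems(6)] t1V by blast
    then have "D t1 t' = 2" using d D_adj t1 A_sym by simp
    then show ?thesis using D_adj A_sym by fastforce
  qed
  ultimately obtain w where w: "A t' w" "A t1 w" "parallel t t' t1 w"
    using ex_translate[OF Suc.prems(5) t1(1)] by metis
  have "walk_dist A w z \<le> m"
    using Suc.IH[OF t1V t1(2) t1z _ w(2)] parallel_trans[OF Suc.prems(6) w(3)] Suc.prems by simp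
  then show ?case using walk_dist_step_left[OF w(1) V(2)] by simp
qed

theorem D_eq_walk_dist: "x \<in> V \<Longrightarrow> y \<in> V \<Longrightarrow> D x y = walk_dist A x y"
proof (induction "walk_dist A x y" arbitrary: x y rule: less_induct)
  case less
  consider (zero) "walk_dist A x y = 0" | (one) "walk_dist A x y = 1"
    | (far) m where "walk_dist A x y = Suc (Suc m)"
    by (metis One_nat_def nat.exhaust)
  then show ?case
  proof cases
    case zero
    then show ?thesis using walk_dist_eq_0_iff less.prems D_self by simp
  next
    case one
    then show ?thesis using walk_dist_eq_1_iff less.prems D_adj by simp
  next
    case (far m)
    have IH: "D p q = walk_dist A p q" if "p \<in> V" "q \<in> V" "walk_dist A p q < Suc (Suc m)" for p q
      using less.hyps[of p q] that far by simp
    obtain b where b: "A x b" "walk_dist A b y = Suc m" by (rule walk_dist_Suc_left[OF less.prems far])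
    have bV: "b \<in> V" using b A_V2 by blast
    obtain c where c: "A c y" "walk_dist A b c = m"
      by (rule walk_dist_Suc_right[OF bV less.prems(2) b(2)])
    have cV: "c \<in> V" using c A_V by blast
    have "walk_dist A x c = Suc m"
      using walk_dist_step_left[OF b(1) cV] walk_dist_step_right[OF c(1) less.prems(1)] c(2) far by simp
    then have d: "D b c = m" "D b y = Suc m" "D x c = Suc m"
      using IH bV cV less.prems b c by simp_all
    then obtain b' where b': "A b b'" "parallel c y b b'" using ex_parallel_edge[OF c(1) bV] by auto
    have b'y: "walk_dist A b' y \<le> m"
      using walk_dist_translate_le[OF IH c(1) bV c(2) b(2) _ b'] by simp
    then have "x \<noteq> b'" "\<not> A b' x"
      using far walk_dist_step_left[of x b' y] A_sym less.prems by fastforce+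
    then have "D x b' = 2" using D_common_neighbour_iff(3)[of b x b'] b b' A_sym by blast
    moreover have "D x b' - D x b = D x y - D x c" using parallelD[OF b'(2)] less.prems by blast
    moreover have "D x b = 1" using b D_adj by blast
    ultimately show ?thesis using d far by simp
  qed
qed

lemma D_eq_0_iff: "x \<in> V \<Longrightarrow> y \<in> V \<Longrightarrow> D x y = 0 \<longleftrightarrow> x = y"
  using D_eq_walk_dist walk_dist_eq_0_iff by simp

lemma D_eq_1_iff: "x \<in> V \<Longrightarrow> y \<in> V \<Longrightarrow> D x y = 1 \<longleftrightarrow> A x y"
  using D_eq_walk_dist walk_dist_eq_1_iff by simp

lemma parallel_unique:
  assumes "parallel x y z w" "parallel x y z w'" "w \<in> V" "w' \<in> V" shows "w = w'"
proof -
  have "D w w = D w w'" using parallelD[OF assms(1,3)] parallelD[OF assms(2,3)] by simp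
  then show ?thesis using D_eq_0_iff[of w w'] assms D_self by simp
qed

lemma determined_by_closed_nbhd:
  assumes "x \<in> V" "z \<in> V" "z' \<in> V"
    and eq: "\<And>p q. p \<in> closed_nbhd A x \<Longrightarrow> q \<in> closed_nbhd A x \<Longrightarrow> D z p - D z q = D z' p - D z' q"
  shows "z = z'"
proof -
  have const: "D z s - D z' s = D z x - D z' x" if "s \<in> V" for s
    using assms(1) that
  proof (induction rule: V_induct)
    case (step s t)
    obtain p q where "p \<in> closed_nbhd A x" "q \<in> closed_nbhd A x" "parallel p q s t"
      by (rule ex_parallel_edge_in_closed_nbhd[OF step.hyps(2) assms(1)])
    then show ?case using eq[of p q] parallelD[of p q s t z] parallelD[of p q s t z'] assms step by simp
  qed simp
  have "D z z - D z' z = D z z' - D z' z'" using const[OF assms(2)] const[OF assms(3)] by simp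
  then have "D z z' = 0" using assms D_self D_sym by simp
  then show ?thesis using D_eq_0_iff assms by blast
qed

end

lemma minuscule_pullback:
  assumes "minuscule V A D" and f: "bij_betw f W V"
    and B: "\<And>x y. B x y \<longleftrightarrow> x \<in> W \<and> y \<in> W \<and> A (f x) (f y)"
  shows "minuscule W B (\<lambda>x y. D (f x) (f y))"
proof -
  interpret minuscule V A D by fact
  have inj: "f x = f y \<longleftrightarrow> x = y" if "x \<in> W" "y \<in> W" for x y
    using f that by (auto simp: bij_betw_def inj_on_def)
  have fV: "f x \<in> V" if "x \<in> W" for x using bij_betwE[OF f] that by blast
  interpret W: connected_simple_graph W B
    using connected_simple_graph_axioms f B by (rule connected_simple_graph_pullback)
  show ?thesis
  proof
    fix x y z assume xyz: "B x y" "B x z" "z \<noteq> y" "\<not> B y z"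
    then have "A (f x) (f y)" "A (f x) (f z)" "f z \<noteq> f y" "\<not> A (f y) (f z)" using B inj by auto
    then obtain v where v: "A (f y) v" "A (f z) v" "parallel (f x) (f y) (f z) v"
      using parallelogram by blast
    obtain w where "w \<in> W" "f w = v" using bij_betw_imp_surj_on[OF f] A_V2[OF v(1)] by blast
    then show "\<exists>w. B y w \<and> B z w \<and> parallel_on W (\<lambda>x y. D (f x) (f y)) x y z w"
      using v xyz B fV unfolding parallel_on_def by blast
  qed (use B D_self D_sym D_adj D_two fV inj in auto)
qed

lemma minuscule_iso_D:
  assumes "minuscule V A D" "minuscule W B E" and f: "bij_betw f W V"
    and BA: "\<And>x y. x \<in> W \<Longrightarrow> y \<in> W \<Longrightarrow> B x y \<longleftrightarrow> A (f x) (f y)" and xy: "x \<in> W" "y \<in> W"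
  shows "D (f x) (f y) = E x y"
proof -
  interpret W: minuscule W B E by fact
  interpret pullback: minuscule W B "\<lambda>x y. D (f x) (f y)"
    by (rule minuscule_pullback[OF assms(1) f]) (use BA W.A_V W.A_V2 in blast)
  show ?thesis using W.D_eq_walk_dist[OF xy] pullback.D_eq_walk_dist[OF xy] by simp
qed

subsection \<open>A minuscule graph is determined by its local graph at one vertex\<close>

text \<open>
  Every root is a difference of two elements of the closed neighbourhood, whose Gram matrix is encoded in
  the local graph. A vertex is located by its inner products with these roots.
\<close>

locale local_matching = M: minuscule V A D + N: minuscule W B E
  for V :: "'a set" and A and D and W :: "'b set" and B and E +
  fixes x :: 'a and x' :: 'b and R :: "'a \<Rightarrow> 'b \<Rightarrow> bool"
  assumes centre: "x \<in> V" "x' \<in> W" "R x x'"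
    and R_closed_nbhd: "R p p' \<Longrightarrow> p \<in> closed_nbhd A x \<and> p' \<in> closed_nbhd B x'"
    and R_total: "p \<in> closed_nbhd A x \<Longrightarrow> \<exists>p'. R p p'" "p' \<in> closed_nbhd B x' \<Longrightarrow> \<exists>p. R p p'"
    and R_isometry: "R p p' \<Longrightarrow> R q q' \<Longrightarrow> E p' q' = D p q"
begin

lemma R_V: "R p p' \<Longrightarrow> p \<in> V" "R p p' \<Longrightarrow> p' \<in> W"
  using R_closed_nbhd M.closed_nbhd_subset N.closed_nbhd_subset centre by blast+

definition same_position :: "'a \<Rightarrow> 'b \<Rightarrow> bool" where
  "same_position z z' \<longleftrightarrow> z \<in> V \<and> z' \<in> W \<and>
     (\<forall>p p' q q'. R p p' \<longrightarrow> R q q' \<longrightarrow> E z' p' - E z' q' = D z p - D z q)"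

lemma same_position_centre: "same_position x x'"
  unfolding same_position_def using centre R_isometry by simp

lemma same_position_step:
  assumes z: "same_position z z'" and zw: "A z w"
  shows "\<exists>w'. B z' w' \<and> same_position w w'"
proof -
  have V: "z \<in> V" "z' \<in> W" "w \<in> V" using z zw M.A_V2 by (auto simp: same_position_def)
  obtain p q where pq: "p \<in> closed_nbhd A x" "q \<in> closed_nbhd A x" "A p q" "M.parallel p q z w"
    by (rule M.ex_parallel_edge_in_closed_nbhd[OF zw centre(1)])
  obtain p' q' where R: "R p p'" "R q q'" using R_total(1)[OF pq(1)] R_total(1)[OF pq(2)] by blast
  have "D z w - D z z = D z q - D z p" using M.parallelD[OF pq(4) V(1)] .
  then have "D z p - D z q = -1" using M.D_self[OF V(1)] M.D_adj[OF zw] by simp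
  then have "E z' p' - E z' q' = -1" using z R unfolding same_position_def by metis
  moreover have "B p' q'" using R_isometry[OF R] M.D_adj[OF pq(3)] N.D_eq_1_iff R_V R by simp
  ultimately obtain w' where w': "B z' w'" "N.parallel p' q' z' w'"
    using N.ex_parallel_edge V by metis
  have w'W: "w' \<in> W" using w' N.A_V2 by blast
  have shift: "E w' r' - E z' r' = D w r - D z r" if r: "R r r'" for r r'
    using M.parallelD[OF pq(4) R_V(1)[OF r]] N.parallelD[OF w'(2) R_V(2)[OF r]] R_isometry r R
      M.D_sym N.D_sym V w'W R_V[OF r] by simp
  have "E w' r' - E w' s' = D w r - D w s" if rs: "R r r'" "R s s'" for r r' s s'
  proof -
    have "E z' r' - E z' s' = D z r - D z s" using z rs unfolding same_position_def by blast
    then show ?thesis using shift[OF rs(1)] shift[OF rs(2)] by simp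
  qed
  with V w' w'W show ?thesis unfolding same_position_def by blast
qed

lemma ex_same_position:
  assumes "z \<in> V" shows "\<exists>z'. same_position z z'"
  using centre(1) assms
  by (induction rule: M.V_induct) (use same_position_centre same_position_step in blast)+

lemma same_position_unique:
  assumes "same_position z z'" "same_position z w'" shows "z' = w'"
proof (rule N.determined_by_closed_nbhd[OF centre(2)])
  show "z' \<in> W" "w' \<in> W" using assms by (simp_all add: same_position_def)
  fix p' q' assume p'q': "p' \<in> closed_nbhd B x'" "q' \<in> closed_nbhd B x'"
  obtain p q where "R p p'" "R q q'" using R_total(2)[OF p'q'(1)] R_total(2)[OF p'q'(2)] by blast
  then show "E z' p' - E z' q' = E w' p' - E w' q'" using assms unfolding same_position_def by metis
qed

lemma local_matching_swap: "local_matching W B E V A D x' x R\<inverse>\<inverse>"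
  by unfold_locales (use centre R_closed_nbhd R_total R_isometry in auto)

theorem iso_on_if_local_matching: "iso_on V A W B"
proof -
  interpret swap: local_matching W B E V A D x' x "R\<inverse>\<inverse>" by (rule local_matching_swap)
  have swap: "swap.same_position z' z \<longleftrightarrow> same_position z z'" for z z'
    unfolding same_position_def swap.same_position_def by (auto simp: eq_commute)
  show ?thesis
  proof (rule iso_on_if_bisimulation)
    show "z \<in> V \<and> z' \<in> W" if "same_position z z'" for z z' using that by (simp add: same_position_def)
    show "\<exists>z. same_position z z'" if "z' \<in> W" for z' using swap.ex_same_position[OF that] by (simp add: swap)
    show "z = w" if "same_position z z'" "same_position w z'" for z w z'
      using swap.same_position_unique[of z' z w] that by (simp add: swap)
    show "\<exists>w. A z w \<and> same_position w w'" if "same_position z z'" "B z' w'" for z z' w'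
      using swap.same_position_step[of z' z w'] that by (simp add: swap)
  qed (fact ex_same_position same_position_unique same_position_step)+
qed

end

theorem minuscule_unique:
  assumes "minuscule V A D" "minuscule W B E" and x: "x \<in> V" "x' \<in> W"
    and iso: "iso_on (nbhd A x) A (nbhd B x') B"
  shows "iso_on V A W B"
proof -
  interpret M: minuscule V A D by fact
  interpret N: minuscule W B E by fact
  obtain h where h: "bij_betw h (nbhd A x) (nbhd B x')"
    "\<And>y z. y \<in> nbhd A x \<Longrightarrow> z \<in> nbhd A x \<Longrightarrow> A y z \<longleftrightarrow> B (h y) (h z)"
    by (rule iso_onE[OF iso]) blast
  have hB: "B x' (h p)" if "A x p" for p using bij_betwE[OF h(1)] that by simp
  have h_D: "E (h p) (h q) = D p q" if pq: "A x p" "A x q" for p q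
  proof -
    have "h p = h q \<longleftrightarrow> p = q" using h(1) pq by (auto simp: bij_betw_def inj_on_def)
    then show ?thesis
      using M.D_common_neighbour[OF pq] N.D_common_neighbour[OF hB[OF pq(1)] hB[OF pq(2)]] h(2) pq
      by simp
  qed
  define R where "R p p' \<longleftrightarrow> p = x \<and> p' = x' \<or> A x p \<and> p' = h p" for p p'
  interpret local_matching V A D W B E x x' R
  proof
    show "x \<in> V" "x' \<in> W" "R x x'" using x by (simp_all add: R_def)
    show "p \<in> closed_nbhd A x \<and> p' \<in> closed_nbhd B x'" if "R p p'" for p p'
      using that hB by (auto simp: R_def mem_closed_nbhd)
    show "\<exists>p'. R p p'" if "p \<in> closed_nbhd A x" for p using that by (auto simp: R_def mem_closed_nbhd)
    show "\<exists>p. R p p'" if "p' \<in> closed_nbhd B x'" for p'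
      using that bij_betw_imp_surj_on[OF h(1)] unfolding R_def mem_closed_nbhd by (auto simp: nbhd_def)
    show "E p' q' = D p q" if "R p p'" "R q q'" for p p' q q'
      using that h_D hB x M.D_self N.D_self M.D_adj N.D_adj M.A_sym N.A_sym
      unfolding R_def by metis
  qed
  show ?thesis by (rule iso_on_if_local_matching)
qed

subsection \<open>Local graphs of minuscule graphs\<close>

definition complete_on :: "'a set \<Rightarrow> ('a \<Rightarrow> 'a \<Rightarrow> bool) \<Rightarrow> bool" where
  "complete_on V A \<longleftrightarrow> (\<forall>x\<in>V. \<forall>y\<in>V. x \<noteq> y \<longrightarrow> A x y)"

definition constant_mu :: "('a \<Rightarrow> 'a \<Rightarrow> bool) \<Rightarrow> nat \<Rightarrow> bool" where
  "constant_mu A m \<longleftrightarrow>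
     (\<forall>x y z. A x y \<longrightarrow> A x z \<longrightarrow> y \<noteq> z \<longrightarrow> \<not> A y z \<longrightarrow> card (nbhd A y \<inter> nbhd A z) = m)"

lemma constant_muD:
  "constant_mu A m \<Longrightarrow> A x y \<Longrightarrow> A x z \<Longrightarrow> y \<noteq> z \<Longrightarrow> \<not> A y z \<Longrightarrow> card (nbhd A y \<inter> nbhd A z) = m"
  unfolding constant_mu_def by blast

context minuscule
begin

lemma minuscule_local_adj:
  assumes x: "x \<in> V" and conn: "\<And>y z. A x y \<Longrightarrow> A x z \<Longrightarrow> (local_adj A x)\<^sup>*\<^sup>* y z"
  shows "minuscule (nbhd A x) (local_adj A x) D"
proof unfold_locales
  show "finite (nbhd A x)" by (rule finite_nbhd)
  show "\<exists>w. local_adj A x z w \<and> local_adj A x u w \<and> parallel_on (nbhd A x) D y z u w"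
    if yzu: "local_adj A x y z" "local_adj A x y u" "u \<noteq> z" "\<not> local_adj A x z u" for y z u
  proof -
    have adj: "A y z" "A y u" "\<not> A z u" "A x y" "A x z" "A x u"
      using yzu unfolding local_adj_def by auto
    obtain w where w: "A z w" "A u w" "parallel y z u w"
      using ex_translate[OF adj(1,2) yzu(3) adj(3)] by metis
    have "D x w - D x u = D x z - D x y" using parallelD[OF w(3) x] .
    then have "D x w = 1" using D_adj adj by simp
    then have "A x w" using D_eq_1_iff x A_V2[OF w(1)] by blast
    moreover have "parallel_on (nbhd A x) D y z u w"
      using w(3) A_V2 unfolding parallel_on_def by simp
    ultimately show ?thesis using w adj unfolding local_adj_def by blast
  qed
qed (use conn A_V A_V2 A_sym A_irrefl D_self D_sym D_adj D_two in \<open>auto simp: local_adj_def\<close>)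

lemma card_common_neighbours:
  assumes xyz: "A x y" "A x z" "y \<noteq> z" "\<not> A y z"
  shows "card (nbhd A y \<inter> nbhd A z) = card (nbhd A x \<inter> (nbhd A y \<inter> nbhd A z)) + 2"
proof -
  obtain w where w: "A y w" "A z w" "parallel x y z w" "w \<noteq> x" "\<not> A x w"
    using ex_translate[OF xyz(1,2)] xyz by metis
  have "nbhd A y \<inter> nbhd A z \<subseteq> {x, w} \<union> nbhd A x"
  proof
    fix t assume "t \<in> nbhd A y \<inter> nbhd A z"
    then have t: "A y t" "A z t" by auto
    have V: "t \<in> V" "x \<in> V" "w \<in> V" using t xyz w A_V A_V2 by blast+
    have "D t w - D t z = D t y - D t x" using parallelD[OF w(3) V(1)] .
    moreover have "D t z = 1" "D t y = 1" using t A_sym D_adj by blast+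
    ultimately have "D t w + D t x = 2" by simp
    moreover have "D t x \<in> {0, 1, 2}" using D_common_neighbour[of y t x] t xyz A_sym by auto
    ultimately consider "D t x = 0" | "D t x = 1" | "D t w = 0" by auto
    then show "t \<in> {x, w} \<union> nbhd A x" by cases (use V D_eq_0_iff D_eq_1_iff A_sym in auto)
  qed
  then have "nbhd A y \<inter> nbhd A z = insert x (insert w (nbhd A x \<inter> (nbhd A y \<inter> nbhd A z)))"
    using w A_sym[OF xyz(1)] A_sym[OF xyz(2)] by auto
  then have "card (nbhd A y \<inter> nbhd A z) = card (insert x (insert w (nbhd A x \<inter> (nbhd A y \<inter> nbhd A z))))"
    by (rule arg_cong)
  also have "\<dots> = card (nbhd A x \<inter> (nbhd A y \<inter> nbhd A z)) + 2"
    using w A_irrefl finite_nbhd by simp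
  finally show ?thesis .
qed

lemma complete_on_if_local_complete:
  assumes "x \<in> V" and local: "complete_on (nbhd A x) A" shows "complete_on V A"
proof -
  have all: "y \<in> closed_nbhd A x" if "y \<in> V" for y
    using assms(1) that
  proof (induction rule: V_induct)
    case (step y z)
    show ?case
    proof (rule ccontr)
      assume far: "z \<notin> closed_nbhd A x"
      then have xy: "A x y" using step by (auto simp: mem_closed_nbhd)
      then obtain w where "A x w" "w \<noteq> y" "\<not> A y w"
        using ex_translate[OF A_sym[OF xy] step.hyps(2)] far A_sym unfolding mem_closed_nbhd by metis
      then show False using local xy unfolding complete_on_def by (metis mem_nbhd)
    qed
  qed (simp add: mem_closed_nbhd)
  show ?thesis
    unfolding complete_on_def
  proof (intro ballI impI)
    fix p q assume pq: "p \<in> V" "q \<in> V" "p \<noteq> q"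
    show "A p q"
      using all[OF pq(1)] all[OF pq(2)] pq(3) local A_sym[of x p]
      by (auto simp: complete_on_def mem_closed_nbhd)
  qed
qed

lemma ex_nonadjacent_neighbours:
  assumes "\<not> complete_on V A" "x \<in> V"
  obtains y z where "A x y" "A x z" "y \<noteq> z" "\<not> A y z"
proof -
  have "\<not> complete_on (nbhd A x) A" using assms complete_on_if_local_complete by blast
  then obtain y z where "y \<in> nbhd A x" "z \<in> nbhd A x" "y \<noteq> z" "\<not> A y z"
    unfolding complete_on_def by blast
  with that show ?thesis by simp
qed

lemma constant_mu_ge_2:
  assumes "\<not> complete_on V A" "constant_mu A m" shows "m \<ge> 2"
proof -
  obtain x where "x \<in> V" using assms(1) unfolding complete_on_def by blast
  then obtain y z where yz: "A x y" "A x z" "y \<noteq> z" "\<not> A y z"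
    by (rule ex_nonadjacent_neighbours[OF assms(1)])
  show ?thesis using card_common_neighbours[OF yz] constant_muD[OF assms(2) yz] by simp
qed

lemma local_not_complete:
  assumes "\<not> complete_on V A" "x \<in> V" shows "\<not> complete_on (nbhd A x) (local_adj A x)"
  using ex_nonadjacent_neighbours[OF assms] unfolding complete_on_def local_adj_def
  by (metis mem_nbhd)

lemma local_constant_mu:
  assumes "constant_mu A m" shows "constant_mu (local_adj A x) (m - 2)"
  unfolding constant_mu_def
proof (intro allI impI)
  fix u y z
  assume yz: "local_adj A x u y" "local_adj A x u z" "y \<noteq> z" "\<not> local_adj A x y z"
  then have adj: "A x y" "A x z" "\<not> A y z" by (auto simp: local_adj_def)
  have "nbhd (local_adj A x) y \<inter> nbhd (local_adj A x) z = nbhd A x \<inter> (nbhd A y \<inter> nbhd A z)"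
    using adj by (auto simp: local_adj_def)
  then show "card (nbhd (local_adj A x) y \<inter> nbhd (local_adj A x) z) = m - 2"
    using card_common_neighbours[OF adj(1,2) yz(3) adj(3)] constant_muD[OF assms adj(1,2) yz(3) adj(3)]
    by simp
qed

lemma minuscule_local:
  assumes mu: "constant_mu A m" "m \<ge> 3" and x: "x \<in> V"
  shows "minuscule (nbhd A x) (local_adj A x) D"
proof (rule minuscule_local_adj[OF x])
  fix y z assume yz: "A x y" "A x z"
  consider (same) "y = z" | (adjacent) "A y z" | (apart) "y \<noteq> z" "\<not> A y z" by blast
  then show "(local_adj A x)\<^sup>*\<^sup>* y z"
  proof cases
    case adjacent
    then have "local_adj A x y z" using yz by (simp add: local_adj_def)
    then show ?thesis by blast
  next
    case apart
    have "card (nbhd A x \<inter> (nbhd A y \<inter> nbhd A z)) > 0"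
      using card_common_neighbours[OF yz apart] constant_muD[OF mu(1) yz apart] mu(2) by simp
    then obtain t where "A x t" "A y t" "A z t" unfolding card_gt_0_iff by auto
    then have "local_adj A x y t" "local_adj A x t z" using yz A_sym by (auto simp: local_adj_def)
    then show ?thesis by (meson r_into_rtranclp rtranclp_trans)
  qed simp
qed

lemma local_adj_transitive:
  assumes "complete_on V A \<or> constant_mu A 2" and abc: "A x a" "A x b" "A x c" "A a b" "A b c" "a \<noteq> c"
  shows "A a c"
proof (rule ccontr)
  assume nac: "\<not> A a c"
  then have "constant_mu A 2" using assms(1) abc A_V2 unfolding complete_on_def by blast
  then have "card (nbhd A x \<inter> (nbhd A a \<inter> nbhd A c)) = 0"
    using card_common_neighbours[OF abc(1,3,6) nac] constant_muD[OF _ abc(1,3,6) nac] by simp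
  moreover have "finite (nbhd A x \<inter> (nbhd A a \<inter> nbhd A c))" using finite_nbhd by blast
  ultimately show False using abc A_sym by auto
qed

end

lemma D_le_2_if_iso_local:
  assumes "minuscule V A D" "minuscule (nbhd A x) (local_adj A x) D" "minuscule W B E"
    and iso: "iso_on (nbhd A x) (local_adj A x) W B" and uv: "u \<in> W" "v \<in> W"
  shows "E u v \<le> 2"
proof -
  interpret minuscule V A D by fact
  obtain f where f: "bij_betw f W (nbhd A x)"
    "\<And>u v. u \<in> W \<Longrightarrow> v \<in> W \<Longrightarrow> B u v \<longleftrightarrow> local_adj A x (f u) (f v)"
    by (rule iso_onE[OF iso_on_sym[OF iso]]) blast
  have "A x (f u)" "A x (f v)" using bij_betwE[OF f(1)] uv by auto
  then have "D (f u) (f v) \<le> 2" using D_common_neighbour by simp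
  then show ?thesis using minuscule_iso_D[OF assms(2,3) f uv] by simp
qed

lemma iso_on_if_local_iso:
  assumes "minuscule V A D" "minuscule W B E" "x \<in> V" "y \<in> W"
    and "iso_on (nbhd A x) (local_adj A x) U C" "iso_on U C (nbhd B y) B"
  shows "iso_on V A W B"
  using minuscule_unique[OF assms(1-4)] iso_on_trans[OF assms(5,6)] unfolding iso_on_local_adj by blast

subsection \<open>Minuscule graphs from coordinates\<close>

lemma rtranclp_if_descent:
  fixes d :: "'a \<Rightarrow> nat"
  assumes "\<And>x. x \<in> V \<Longrightarrow> x \<noteq> y \<Longrightarrow> \<exists>z\<in>V. A x z \<and> d z < d x" and "x \<in> V"
  shows "A\<^sup>*\<^sup>* x y"
  using assms(2)
proof (induction "d x" arbitrary: x rule: less_induct)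
  case less
  show ?case
  proof (cases "x = y")
    case False
    then obtain z where "z \<in> V" "A x z" "d z < d x" using assms(1) less.prems by blast
    then show ?thesis using less.hyps by (meson converse_rtranclp_into_rtranclp)
  qed simp
qed

lemma minusculeI:
  fixes d :: "'a \<Rightarrow> 'a \<Rightarrow> nat"
  assumes fin: "finite V"
    and A: "\<And>x y. A x y \<longleftrightarrow> x \<in> V \<and> y \<in> V \<and> d x y = 1"
    and d_0: "\<And>x y. x \<in> V \<Longrightarrow> y \<in> V \<Longrightarrow> d x y = 0 \<longleftrightarrow> x = y"
    and d_sym: "\<And>x y. x \<in> V \<Longrightarrow> y \<in> V \<Longrightarrow> d x y = d y x"
    and d_2: "\<And>x y z. A x y \<Longrightarrow> A y z \<Longrightarrow> d x z \<le> 2"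
    and descent: "\<And>x y. x \<in> V \<Longrightarrow> y \<in> V \<Longrightarrow> 1 < d x y \<Longrightarrow> \<exists>z. A x z \<and> d z y < d x y"
    and completion: "\<And>x y z. A x y \<Longrightarrow> A x z \<Longrightarrow> d y z = 2 \<Longrightarrow>
      \<exists>w\<in>V. \<forall>s\<in>V. d s w + d s x = d s y + d s z"
  shows "minuscule V A (\<lambda>x y. real (d x y))"
proof unfold_locales
  show "A\<^sup>*\<^sup>* x y" if xy: "x \<in> V" "y \<in> V" for x y
  proof (rule rtranclp_if_descent[OF _ xy(1)])
    fix x assume x: "x \<in> V" "x \<noteq> y"
    show "\<exists>z\<in>V. A x z \<and> d z y < d x y"
    proof (cases "d x y = 1")
      case True
      then show ?thesis using A d_0[OF xy(2,2)] x xy(2) by (intro bexI[of _ y]) auto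
    next
      case False
      then have "1 < d x y" using d_0[OF x(1) xy(2)] x(2) by linarith
      then show ?thesis using descent[OF x(1) xy(2)] A by blast
    qed
  qed
  show two: "real (d x z) = 2" if xyz: "A x y" "A y z" "x \<noteq> z" "\<not> A x z" for x y z
  proof -
    have "d x z \<noteq> 0" "d x z \<noteq> 1" "d x z \<le> 2" using xyz A d_0 d_2 by auto
    then show ?thesis by simp
  qed
  show "\<exists>w. A y w \<and> A z w \<and> parallel_on V (\<lambda>x y. real (d x y)) x y z w"
    if xyz: "A x y" "A x z" "z \<noteq> y" "\<not> A y z" for x y z
  proof -
    have V: "x \<in> V" "y \<in> V" "z \<in> V" using that A by auto
    have yx: "A y x" using xyz A V d_sym by metis
    have yz: "d y z = 2" using two[OF yx xyz(2)] xyz by simp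
    then obtain w where w: "w \<in> V" "\<And>s. s \<in> V \<Longrightarrow> d s w + d s x = d s y + d s z"
      using completion[OF xyz(1,2)] by blast
    have "d y y = 0" "d z z = 0" "d y x = 1" "d z x = 1" "d z y = 2"
      using d_0 V xyz A d_sym yz by auto
    then have "A y w" "A z w" using w V yz A w(2)[of y] w(2)[of z] by auto
    moreover have "real (d s w) - real (d s z) = real (d s y) - real (d s x)" if "s \<in> V" for s
      using w(2)[OF that] by linarith
    ultimately show ?thesis unfolding parallel_on_def by blast
  qed
  show "\<not> A x x" for x using A[of x x] d_0[of x x] by auto
qed (use fin A d_0 d_sym in auto)

definition disagreements :: "nat \<Rightarrow> (nat \<Rightarrow> 'b) \<Rightarrow> (nat \<Rightarrow> 'b) \<Rightarrow> nat" where
  "disagreements n x y = (\<Sum>i<n. of_bool (x i \<noteq> y i))"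

lemma disagreements_eq_card: "disagreements n x y = card {i. i < n \<and> x i \<noteq> y i}"
  unfolding disagreements_def by (simp add: sum.If_cases of_bool_def) (simp add: Int_def conj_commute)

lemma hamming_distance_eq: "hamming_distance v w = disagreements (length v) ((!) v) ((!) w)"
  unfolding hamming_distance_def disagreements_eq_card ..

lemma disagreements_commute: "disagreements n x y = disagreements n y x"
  unfolding disagreements_def by (intro sum.cong) auto

lemma disagreements_cong:
  "(\<And>i. i < n \<Longrightarrow> x i = x' i) \<Longrightarrow> (\<And>i. i < n \<Longrightarrow> y i = y' i) \<Longrightarrow> disagreements n x y = disagreements n x' y'"
  unfolding disagreements_def by (intro sum.cong) auto

lemma disagreements_eq_0_iff: "disagreements n x y = 0 \<longleftrightarrow> (\<forall>i<n. x i = y i)"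
  unfolding disagreements_def by auto

lemma disagreements_self [simp]: "disagreements n x x = 0" by (simp add: disagreements_eq_0_iff)

lemma disagreements_triangle: "disagreements n x z \<le> disagreements n x y + disagreements n y z"
  unfolding disagreements_def sum.distrib[symmetric] by (intro sum_mono) auto

lemma disagreements_between:
  assumes "disagreements n y z = disagreements n x y + disagreements n x z" "i < n"
  shows "x i = y i \<or> x i = z i"
proof (rule ccontr)
  assume "\<not> (x i = y i \<or> x i = z i)"
  then have "disagreements n y z < disagreements n x y + disagreements n x z"
    unfolding disagreements_def sum.distrib[symmetric]
    by (intro sum_strict_mono_ex1) (use assms(2) in \<open>auto intro!: bexI[of _ i]\<close>)
  with assms(1) show False by simp
qed

lemma disagreements_parallelogram:
  assumes "\<And>i. i < n \<Longrightarrow> x i = y i \<or> x i = z i" "\<And>i. i < n \<Longrightarrow> w i = (if x i = y i then z i else y i)"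
  shows "disagreements n s w + disagreements n s x = disagreements n s y + disagreements n s z"
proof -
  have "of_bool (s i \<noteq> w i) + of_bool (s i \<noteq> x i) = (of_bool (s i \<noteq> y i) + of_bool (s i \<noteq> z i) :: nat)"
    if "i < n" for i
    using assms(1)[OF that] assms(2)[OF that] by (cases "x i = y i") auto
  then show ?thesis unfolding disagreements_def sum.distrib[symmetric] by (intro sum.cong) auto
qed

lemma disagreements_fun_upd:
  assumes "i < n" "x i \<noteq> y i"
  shows "disagreements n (x(i := y i)) y + 1 = disagreements n x y"
    and "disagreements n x (x(i := y i)) = 1"
proof -
  have split: "(\<Sum>j<n. f j) = f i + (\<Sum>j\<in>{..<n} - {i}. f j)" for f :: "nat \<Rightarrow> nat"
    using assms(1) by (intro sum.remove) auto
  show "disagreements n (x(i := y i)) y + 1 = disagreements n x y"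
    and "disagreements n x (x(i := y i)) = 1"
    unfolding disagreements_def using assms by (simp_all add: split)
qed

lemma disagreements_fun_upd2:
  assumes i: "i < n" "x i \<noteq> y i" and j: "j < n" "x j \<noteq> y j" and "i \<noteq> j"
  defines "z \<equiv> x(i := y i, j := y j)"
  shows "disagreements n z y + 2 = disagreements n x y" "disagreements n x z = 2"
proof -
  let ?x = "x(i := y i)"
  have "?x j \<noteq> y j" using assms by simp
  note upd = disagreements_fun_upd[of i n x y, OF i] disagreements_fun_upd[of j n ?x y, OF j(1) this]
  show zy: "disagreements n z y + 2 = disagreements n x y" using upd by (simp add: z_def)
  have "disagreements n x z \<le> 2" using disagreements_triangle[of n x z ?x] upd by (simp add: z_def)
  then show "disagreements n x z = 2" using disagreements_triangle[of n x y z] zy by simp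
qed

lemma minuscule_div:
  fixes h :: "'a \<Rightarrow> 'a \<Rightarrow> nat"
  assumes fin: "finite V" and r: "r > 0"
    and A: "\<And>x y. A x y \<longleftrightarrow> x \<in> V \<and> y \<in> V \<and> h x y = r"
    and h_0: "\<And>x y. x \<in> V \<Longrightarrow> y \<in> V \<Longrightarrow> h x y = 0 \<longleftrightarrow> x = y"
    and h_sym: "\<And>x y. x \<in> V \<Longrightarrow> y \<in> V \<Longrightarrow> h x y = h y x"
    and h_triangle: "\<And>x y z. x \<in> V \<Longrightarrow> y \<in> V \<Longrightarrow> z \<in> V \<Longrightarrow> h x z \<le> h x y + h y z"
    and r_dvd: "\<And>x y. x \<in> V \<Longrightarrow> y \<in> V \<Longrightarrow> r dvd h x y"
    and descent: "\<And>x y. x \<in> V \<Longrightarrow> y \<in> V \<Longrightarrow> r < h x y \<Longrightarrow> \<exists>z\<in>V. h x z = r \<and> h z y < h x y"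
    and completion: "\<And>x y z. x \<in> V \<Longrightarrow> y \<in> V \<Longrightarrow> z \<in> V \<Longrightarrow> h y z = h x y + h x z \<Longrightarrow>
      \<exists>w\<in>V. \<forall>s\<in>V. h s w + h s x = h s y + h s z"
  shows "minuscule V A (\<lambda>x y. real (h x y div r))"
proof (rule minusculeI)
  have mult: "h x y = h x y div r * r" if "x \<in> V" "y \<in> V" for x y using r_dvd[OF that] by simp
  show "A x y \<longleftrightarrow> x \<in> V \<and> y \<in> V \<and> h x y div r = 1" for x y
    using A mult[of x y] r by (metis div_self mult_1 not_gr_zero)
  show "h x y div r = 0 \<longleftrightarrow> x = y" if "x \<in> V" "y \<in> V" for x y
    using h_0[OF that] mult[OF that] by (metis div_0 mult_zero_left)
  show "h x y div r = h y x div r" if "x \<in> V" "y \<in> V" for x y using h_sym[OF that] by simp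
  show "h x z div r \<le> 2" if "A x y" "A y z" for x y z
  proof -
    have "h x z \<le> 2 * r" using that A h_triangle[of x y z] by simp
    then show ?thesis using r div_le_mono[of "h x z" "2 * r" r] by simp
  qed
  show "\<exists>z. A x z \<and> h z y div r < h x y div r" if xy: "x \<in> V" "y \<in> V" "1 < h x y div r" for x y
  proof -
    have "r < h x y" using xy(3) mult[OF xy(1,2)] r by (metis mult_less_cancel2 nat_mult_1)
    then obtain z where z: "z \<in> V" "h x z = r" "h z y < h x y" using descent xy by blast
    then have "h z y div r * r < h x y div r * r" using mult xy by metis
    then show ?thesis using A z xy by auto
  qed
  show "\<exists>w\<in>V. \<forall>s\<in>V. h s w div r + h s x div r = h s y div r + h s z div r"
    if xyz: "A x y" "A x z" "h y z div r = 2" for x y z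
  proof -
    have V: "x \<in> V" "y \<in> V" "z \<in> V" using xyz A by auto
    have "h y z = h x y + h x z" using mult[OF V(2,3)] xyz A by simp
    then obtain w where w: "w \<in> V" "\<And>s. s \<in> V \<Longrightarrow> h s w + h s x = h s y + h s z"
      using completion[OF V] by blast
    have "(h s w div r + h s x div r) * r = (h s y div r + h s z div r) * r" if "s \<in> V" for s
      using w mult that V by (metis add_mult_distrib)
    then show ?thesis using r w(1) by auto
  qed
qed (rule fin)

lemma minuscule_coordinates:
  fixes c :: "'a \<Rightarrow> nat \<Rightarrow> 'b" and n :: nat
  defines "h \<equiv> \<lambda>x y. disagreements n (c x) (c y)"
  assumes fin: "finite V" and r: "r > 0"
    and A: "\<And>x y. A x y \<longleftrightarrow> x \<in> V \<and> y \<in> V \<and> h x y = r"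
    and inj: "\<And>x y. x \<in> V \<Longrightarrow> y \<in> V \<Longrightarrow> (\<And>i. i < n \<Longrightarrow> c x i = c y i) \<Longrightarrow> x = y"
    and r_dvd: "\<And>x y. x \<in> V \<Longrightarrow> y \<in> V \<Longrightarrow> r dvd h x y"
    and descent: "\<And>x y. x \<in> V \<Longrightarrow> y \<in> V \<Longrightarrow> r < h x y \<Longrightarrow> \<exists>z\<in>V. h x z = r \<and> h z y < h x y"
    and completion: "\<And>x y z. x \<in> V \<Longrightarrow> y \<in> V \<Longrightarrow> z \<in> V \<Longrightarrow>
      (\<And>i. i < n \<Longrightarrow> c x i = c y i \<or> c x i = c z i) \<Longrightarrow>
      \<exists>w\<in>V. \<forall>i<n. c w i = (if c x i = c y i then c z i else c y i)"
  shows "minuscule V A (\<lambda>x y. real (h x y div r))"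
proof (rule minuscule_div[OF fin r A])
  show "h x y = 0 \<longleftrightarrow> x = y" if "x \<in> V" "y \<in> V" for x y
    using inj[OF that] by (auto simp: h_def disagreements_eq_0_iff)
  show "h x y = h y x" for x y by (simp add: h_def disagreements_commute)
  show "h x z \<le> h x y + h y z" for x y z unfolding h_def by (rule disagreements_triangle)
  show "\<exists>w\<in>V. \<forall>s\<in>V. h s w + h s x = h s y + h s z"
    if V: "x \<in> V" "y \<in> V" "z \<in> V" and eq: "h y z = h x y + h x z" for x y z
  proof -
    have between: "c x i = c y i \<or> c x i = c z i" if "i < n" for i
      using disagreements_between[OF eq[unfolded h_def] that] .
    obtain w where w: "w \<in> V" "\<And>i. i < n \<Longrightarrow> c w i = (if c x i = c y i then c z i else c y i)"
      using completion[OF V between] by blast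
    have "h s w + h s x = h s y + h s z" for s
      unfolding h_def by (rule disagreements_parallelogram[OF between w(2)])
    with w(1) show ?thesis by blast
  qed
qed (use r_dvd descent in auto)

subsection \<open>Box graphs and Hamming graphs\<close>

abbreviation adj :: "'a pair_pre_digraph \<Rightarrow> 'a \<Rightarrow> 'a \<Rightarrow> bool" where
  "adj G \<equiv> (\<lambda>x y. (x, y) \<in> parcs G)"

lemma pverts_graph_on: "pverts (graph_on V R) = V" by (simp add: graph_on_def)

lemma adj_graph_on: "adj (graph_on V R) x y \<longleftrightarrow> x \<in> V \<and> y \<in> V \<and> R x y" by (simp add: graph_on_def)

definition box_graph :: "nat list \<Rightarrow> nat list pair_pre_digraph" where
  "box_graph qs = graph_on {w. length w = length qs \<and> (\<forall>i<length qs. w ! i < qs ! i)}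
     (\<lambda>v w. hamming_distance v w = 1)"

lemma hamming_graph_eq_box_graph: "hamming_graph d n = box_graph (replicate d n)"
proof -
  have "{w. length w = d \<and> set w \<subseteq> {..<n}} =
      {w. length w = length (replicate d n) \<and> (\<forall>i<length (replicate d n). w ! i < replicate d n ! i)}"
    by (auto simp: subset_iff in_set_conv_nth)
  then show ?thesis by (simp add: hamming_graph_def box_graph_def)
qed

lemma pverts_box_graph:
  "w \<in> pverts (box_graph qs) \<longleftrightarrow> length w = length qs \<and> (\<forall>i<length qs. w ! i < qs ! i)"
  by (simp add: box_graph_def pverts_graph_on)

lemma adj_box_graph:
  "adj (box_graph qs) v w \<longleftrightarrow> v \<in> pverts (box_graph qs) \<and> w \<in> pverts (box_graph qs) \<and>
     disagreements (length qs) ((!) v) ((!) w) = 1"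
  by (auto simp: box_graph_def pverts_graph_on adj_graph_on hamming_distance_eq)

lemma minuscule_box_graph:
  "minuscule (pverts (box_graph qs)) (adj (box_graph qs))
     (\<lambda>v w. real (disagreements (length qs) ((!) v) ((!) w)))"
proof -
  let ?V = "pverts (box_graph qs)" and ?n = "length qs"
  have "w ! i < sum_list qs" if "w \<in> ?V" "i < ?n" for w i
    using that elem_le_sum_list[of i qs] by (fastforce simp: pverts_box_graph)
  then have "?V \<subseteq> {w. set w \<subseteq> {..<sum_list qs} \<and> length w = ?n}"
    by (auto simp: in_set_conv_nth) (auto simp: pverts_box_graph)
  then have fin: "finite ?V" by (rule finite_subset) (simp add: finite_lists_length_eq)
  have "minuscule ?V (adj (box_graph qs)) (\<lambda>v w. real (disagreements ?n ((!) v) ((!) w) div 1))"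
  proof (rule minuscule_coordinates[OF fin])
    show "v = w" if "v \<in> ?V" "w \<in> ?V" "\<And>i. i < ?n \<Longrightarrow> v ! i = w ! i" for v w
      using that by (simp add: pverts_box_graph list_eq_iff_nth_eq)
    show "\<exists>z\<in>?V. disagreements ?n ((!) v) ((!) z) = 1 \<and>
        disagreements ?n ((!) z) ((!) w) < disagreements ?n ((!) v) ((!) w)"
      if vw: "v \<in> ?V" "w \<in> ?V" "1 < disagreements ?n ((!) v) ((!) w)" for v w
    proof -
      obtain i where i: "i < ?n" "v ! i \<noteq> w ! i"
        using vw(3) disagreements_eq_0_iff[of ?n "(!) v" "(!) w"] by auto
      define z where "z = v[i := w ! i]"
      have z: "(!) z = ((!) v)(i := w ! i)"
        using i vw by (auto simp: z_def pverts_box_graph fun_eq_iff nth_list_update)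
      have "z \<in> ?V" using i vw by (auto simp: z_def pverts_box_graph nth_list_update)
      then show ?thesis
        using disagreements_fun_upd[of i ?n "(!) v" "(!) w"] i unfolding z
        by (intro bexI[of _ z]) (auto simp: z)
    qed
    show "\<exists>w\<in>?V. \<forall>i<?n. w ! i = (if x ! i = y ! i then z ! i else y ! i)"
      if "x \<in> ?V" "y \<in> ?V" "z \<in> ?V" for x y z
      using that
      by (intro bexI[of _ "map (\<lambda>i. if x ! i = y ! i then z ! i else y ! i) [0..<?n]"])
        (auto simp: pverts_box_graph)
  qed (auto simp: adj_box_graph)
  then show ?thesis by simp
qed

definition clique_points :: "nat list \<Rightarrow> (nat \<times> nat) set" where
  "clique_points qs = (SIGMA i:{..<length qs}. {1..<qs ! i})"

definition same_clique :: "nat \<times> nat \<Rightarrow> nat \<times> nat \<Rightarrow> bool" where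
  "same_clique p q \<longleftrightarrow> fst p = fst q \<and> p \<noteq> q"

lemma disagreements_replicate_update:
  assumes "i < n" "c \<noteq> z"
  shows "disagreements n ((!) (replicate n z)) ((!) ((replicate n z)[i := c])) = 1"
proof -
  have "{j. j < n \<and> replicate n z ! j \<noteq> (replicate n z)[i := c] ! j} = {i}"
    using assms by (auto simp: nth_list_update)
  then show ?thesis by (simp add: disagreements_eq_card)
qed

lemma disagreements_replicate_update_update:
  assumes "i < n" "j < n" "c \<noteq> z" "e \<noteq> z"
  shows "disagreements n ((!) ((replicate n z)[i := c])) ((!) ((replicate n z)[j := e])) =
    (if i = j then of_bool (c \<noteq> e) else 2)"
proof -
  have "{m. m < n \<and> (replicate n z)[i := c] ! m \<noteq> (replicate n z)[j := e] ! m} =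
      (if i = j then if c = e then {} else {i} else {i, j})"
    using assms by (auto simp: nth_list_update split: if_splits)
  then show ?thesis by (simp add: disagreements_eq_card)
qed

lemma disagreements_replicate_eq_1E:
  assumes "disagreements n ((!) (replicate n z)) ((!) w) = 1" "length w = n"
  obtains i where "i < n" "w ! i \<noteq> z" "w = (replicate n z)[i := w ! i]"
proof -
  obtain i where "{j. j < n \<and> replicate n z ! j \<noteq> w ! j} = {i}"
    using assms(1) card_1_singletonE unfolding disagreements_eq_card by blast
  then have i: "j < n \<and> replicate n z ! j \<noteq> w ! j \<longleftrightarrow> j = i" for j
    by (metis (mono_tags) mem_Collect_eq singleton_iff)
  have "i < n" "w ! i \<noteq> z" using i[of i] by auto
  moreover have "w ! j = z" if "j < n" "j \<noteq> i" for j using i[of j] that by simp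
  ultimately have "w = (replicate n z)[i := w ! i]"
    using assms(2) by (intro nth_equalityI) (auto simp: nth_list_update)
  then show ?thesis using \<open>i < n\<close> \<open>w ! i \<noteq> z\<close> that by blast
qed

lemma box_graph_local_iso:
  assumes pos: "\<And>q. q \<in> set qs \<Longrightarrow> 0 < q"
  defines "origin \<equiv> replicate (length qs) 0"
  shows "origin \<in> pverts (box_graph qs)"
    and "iso_on (clique_points qs) same_clique (nbhd (adj (box_graph qs)) origin) (adj (box_graph qs))"
proof -
  let ?n = "length qs" and ?N = "nbhd (adj (box_graph qs)) origin"
  define f where "f = (\<lambda>(i, c). origin[i := c])"
  show origin: "origin \<in> pverts (box_graph qs)" using pos by (simp add: origin_def pverts_box_graph)
  have f_V: "f p \<in> pverts (box_graph qs)" if "p \<in> clique_points qs" for p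
    using that origin by (auto simp: f_def clique_points_def pverts_box_graph nth_list_update)
  have f_N: "f p \<in> ?N" if p: "p \<in> clique_points qs" for p
    using p f_V[OF p] origin disagreements_replicate_update[of "fst p" ?n "snd p" 0]
    by (auto simp: f_def adj_box_graph clique_points_def origin_def)
  have f_f: "disagreements ?n ((!) (f p)) ((!) (f q)) = (if fst p = fst q then of_bool (p \<noteq> q) else 2)"
    if "p \<in> clique_points qs" "q \<in> clique_points qs" for p q
    using that disagreements_replicate_update_update[of "fst p" ?n "fst q" "snd p" 0 "snd q"]
    by (cases p; cases q) (auto simp: f_def clique_points_def origin_def of_bool_def)
  show "iso_on (clique_points qs) same_clique ?N (adj (box_graph qs))"
  proof (rule iso_onI)
    show "bij_betw f (clique_points qs) ?N"
    proof (rule bij_betwI')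
      show "f p = f q \<longleftrightarrow> p = q" if "p \<in> clique_points qs" "q \<in> clique_points qs" for p q
        using f_f[OF that] by (auto split: if_splits)
      show "\<exists>p\<in>clique_points qs. w = f p" if "w \<in> ?N" for w
      proof -
        have w: "w \<in> pverts (box_graph qs)" "disagreements ?n ((!) origin) ((!) w) = 1"
          using that by (auto simp: adj_box_graph)
        then obtain i where "i < ?n" "w ! i \<noteq> 0" "w = origin[i := w ! i]"
          unfolding origin_def using disagreements_replicate_eq_1E pverts_box_graph by metis
        then show ?thesis
          using w(1) by (intro bexI[of _ "(i, w ! i)"]) (auto simp: f_def clique_points_def pverts_box_graph)
      qed
    qed (rule f_N)
    show "same_clique p q \<longleftrightarrow> adj (box_graph qs) (f p) (f q)"
      if "p \<in> clique_points qs" "q \<in> clique_points qs" for p q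
      using f_f[OF that] f_V that by (simp add: adj_box_graph same_clique_def)
  qed
qed

lemma ex_bij_betw_clique_points:
  fixes C :: "'a \<Rightarrow> 'c"
  assumes fin: "finite N"
  obtains qs f where "bij_betw f N (clique_points qs)"
    "\<And>y z. y \<in> N \<Longrightarrow> z \<in> N \<Longrightarrow> fst (f y) = fst (f z) \<longleftrightarrow> C y = C z"
    "\<And>q. q \<in> set qs \<Longrightarrow> \<exists>y\<in>N. q = card {z \<in> N. C z = C y} + 1"
proof -
  obtain cs where cs: "set cs = C ` N" "distinct cs"
    using finite_distinct_list[OF finite_imageI[OF fin]] by metis
  define F where "F X = {z \<in> N. C z = X}" for X
  have "\<exists>g. bij_betw g (F X) {1..<card (F X) + 1}" for X
    using fin by (intro finite_same_card_bij) (auto simp: F_def)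
  then obtain g where g: "\<And>X. bij_betw (g X) (F X) {1..<card (F X) + 1}" by metis
  have "\<exists>i<length cs. cs ! i = C y" if "y \<in> N" for y
    using that cs(1) by (metis imageI in_set_conv_nth)
  then obtain ix where ix: "\<And>y. y \<in> N \<Longrightarrow> ix y < length cs \<and> cs ! ix y = C y" by metis
  have ix_eq_iff: "ix y = ix z \<longleftrightarrow> C y = C z" if "y \<in> N" "z \<in> N" for y z
    using ix[OF that(1)] ix[OF that(2)] cs(2) by (metis nth_eq_iff_index_eq)
  have g_eq_iff: "g (C y) y = g (C z) z \<longleftrightarrow> y = z" if "y \<in> N" "z \<in> N" "C y = C z" for y z
    using g[of "C y"] that unfolding bij_betw_def inj_on_def F_def by auto
  define qs where "qs = map (\<lambda>X. card (F X) + 1) cs"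
  define f where "f y = (ix y, g (C y) y)" for y
  show ?thesis
  proof (rule that)
    show "bij_betw f N (clique_points qs)"
    proof (rule bij_betwI')
      show "f y = f z \<longleftrightarrow> y = z" if "y \<in> N" "z \<in> N" for y z
        using ix_eq_iff[OF that] g_eq_iff[OF that] by (auto simp: f_def)
      show "f y \<in> clique_points qs" if "y \<in> N" for y
        using bij_betwE[OF g[of "C y"]] ix[OF that] that by (simp add: f_def F_def clique_points_def qs_def)
      show "\<exists>y\<in>N. p = f y" if p_in: "p \<in> clique_points qs" for p
      proof -
        obtain i c where p: "p = (i, c)" "i < length cs" "c \<in> {1..<card (F (cs ! i)) + 1}"
          using p_in by (auto simp: clique_points_def qs_def)
        then obtain y where "y \<in> F (cs ! i)" "g (cs ! i) y = c"
          using bij_betw_imp_surj_on[OF g[of "cs ! i"]] by (metis imageE)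
        then have y: "y \<in> N" "C y = cs ! i" "g (cs ! i) y = c" by (simp_all add: F_def)
        then have "ix y = i" using ix[OF y(1)] p(2) cs(2) by (metis nth_eq_iff_index_eq)
        then show ?thesis using y p(1) by (auto simp: f_def)
      qed
    qed
    show "fst (f y) = fst (f z) \<longleftrightarrow> C y = C z" if "y \<in> N" "z \<in> N" for y z
      using ix_eq_iff[OF that] by (simp add: f_def)
    show "\<exists>y\<in>N. q = card {z \<in> N. C z = C y} + 1" if "q \<in> set qs" for q
      using that cs(1) by (auto simp: qs_def F_def)
  qed
qed

lemma iso_on_clique_points:
  fixes A :: "'a \<Rightarrow> 'a \<Rightarrow> bool"
  assumes fin: "finite N" and sym: "\<And>x y. A x y \<Longrightarrow> A y x" and irrefl: "\<And>x. \<not> A x x"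
    and trans: "\<And>x y z. x \<in> N \<Longrightarrow> y \<in> N \<Longrightarrow> z \<in> N \<Longrightarrow> A x y \<Longrightarrow> A y z \<Longrightarrow> x \<noteq> z \<Longrightarrow> A x z"
  shows "\<exists>qs. (\<forall>q\<in>set qs. \<exists>y\<in>N. q = card (N \<inter> nbhd A y) + 2) \<and>
    iso_on N A (clique_points qs) same_clique"
proof -
  define C where "C y = {z \<in> N. z = y \<or> A y z}" for y
  have C_mono: "C z \<subseteq> C y" if "y \<in> N" "z \<in> N" "A y z" for y z
  proof
    fix w assume "w \<in> C z"
    then show "w \<in> C y" using that trans[of y z w] by (auto simp: C_def)
  qed
  have C_eq_iff: "C y = C z \<longleftrightarrow> y = z \<or> A y z" if "y \<in> N" "z \<in> N" for y z
  proof
    assume "C y = C z"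
    then have "z \<in> C y" using that(2) by (simp add: C_def)
    then show "y = z \<or> A y z" by (auto simp: C_def)
  qed (use C_mono that sym in blast)
  obtain qs f where f: "bij_betw f N (clique_points qs)"
      "\<And>y z. y \<in> N \<Longrightarrow> z \<in> N \<Longrightarrow> fst (f y) = fst (f z) \<longleftrightarrow> C y = C z"
    and qs: "\<And>q. q \<in> set qs \<Longrightarrow> \<exists>y\<in>N. q = card {z \<in> N. C z = C y} + 1"
    by (rule ex_bij_betw_clique_points[OF fin, where C = C]) blast
  have "f y = f z \<longleftrightarrow> y = z" if "y \<in> N" "z \<in> N" for y z
    using f(1) that by (auto simp: bij_betw_def inj_on_def)
  then have "iso_on N A (clique_points qs) same_clique"
    using f(2) C_eq_iff irrefl by (intro iso_onI[OF f(1)]) (auto simp: same_clique_def)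
  moreover have "card {z \<in> N. C z = C y} = card (N \<inter> nbhd A y) + 1" if "y \<in> N" for y
  proof -
    have "C z = C y \<longleftrightarrow> z = y \<or> A y z" if "z \<in> N" for z
      using C_eq_iff[OF \<open>y \<in> N\<close> that] by (auto simp: eq_commute)
    then have "{z \<in> N. C z = C y} = {z \<in> N. z = y \<or> A y z}" by (intro Collect_cong) blast
    also have "\<dots> = insert y (N \<inter> nbhd A y)" using that by auto
    finally show ?thesis using fin irrefl by simp
  qed
  ultimately show ?thesis using qs by (intro exI[of _ qs]) fastforce
qed

lemma box_graph_recognition:
  assumes "minuscule V A D" and x: "x \<in> V"
    and trans: "\<And>a b c. A x a \<Longrightarrow> A x b \<Longrightarrow> A x c \<Longrightarrow> A a b \<Longrightarrow> A b c \<Longrightarrow> a \<noteq> c \<Longrightarrow> A a c"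
  shows "\<exists>qs. (\<forall>q\<in>set qs. \<exists>y\<in>nbhd A x. q = card (nbhd A x \<inter> nbhd A y) + 2) \<and>
    iso_on V A (pverts (box_graph qs)) (adj (box_graph qs))"
proof -
  interpret minuscule V A D by fact
  have "\<exists>qs. (\<forall>q\<in>set qs. \<exists>y\<in>nbhd A x. q = card (nbhd A x \<inter> nbhd A y) + 2) \<and>
      iso_on (nbhd A x) A (clique_points qs) same_clique"
  proof (rule iso_on_clique_points[OF finite_nbhd A_sym A_irrefl])
    fix a b c assume "a \<in> nbhd A x" "b \<in> nbhd A x" "c \<in> nbhd A x" "A a b" "A b c" "a \<noteq> c"
    then show "A a c" using trans[of a b c] by simp
  qed
  then obtain qs where qs: "\<forall>q\<in>set qs. \<exists>y\<in>nbhd A x. q = card (nbhd A x \<inter> nbhd A y) + 2"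
    and iso: "iso_on (nbhd A x) A (clique_points qs) same_clique" by blast
  have pos: "0 < q" if "q \<in> set qs" for q using qs that by auto
  have "iso_on V A (pverts (box_graph qs)) (adj (box_graph qs))"
    using assms(1) minuscule_box_graph x box_graph_local_iso(1)[OF pos]
      iso_on_trans[OF iso box_graph_local_iso(2)[OF pos]] by (rule minuscule_unique)
  with qs show ?thesis by blast
qed

subsection \<open>Johnson graphs and demicubes\<close>

definition weight :: "nat \<Rightarrow> (nat \<Rightarrow> bool) \<Rightarrow> nat" where "weight n x = (\<Sum>i<n. of_bool (x i))"

lemma disagreements_weight: "disagreements n x y + 2 * weight n (\<lambda>i. x i \<and> y i) = weight n x + weight n y"
  unfolding disagreements_def weight_def sum_distrib_left sum.distrib[symmetric] by (intro sum.cong) auto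

lemma even_disagreements_iff: "even (disagreements n x y) \<longleftrightarrow> (even (weight n x) \<longleftrightarrow> even (weight n y))"
  using arg_cong[OF disagreements_weight[of n x y], of even] by auto

lemma weight_cong: "(\<And>i. i < n \<Longrightarrow> x i = y i) \<Longrightarrow> weight n x = weight n y"
  unfolding weight_def by (intro sum.cong) auto

lemma weight_parallelogram:
  assumes "\<And>i. i < n \<Longrightarrow> x i = y i \<or> x i = z i" "\<And>i. i < n \<Longrightarrow> w i = (if x i = y i then z i else y i)"
  shows "weight n w + weight n x = weight n y + weight n z"
  unfolding weight_def sum.distrib[symmetric] using assms by (intro sum.cong) fastforce+

lemma card_eq_weight: "S \<subseteq> {..<n} \<Longrightarrow> card S = weight n (\<lambda>i. i \<in> S)"
  unfolding weight_def by (simp add: sum.If_cases of_bool_def Int_absorb1 Collect_mem_eq)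

lemma count_list_eq_weight: "count_list w True = weight (length w) ((!) w)"
proof (induction w)
  case (Cons a w)
  then show ?case by (simp add: weight_def sum.lessThan_Suc_shift del: sum.lessThan_Suc)
qed (simp add: weight_def)

lemma pverts_demicube_graph: "w \<in> pverts (demicube_graph n) \<longleftrightarrow> length w = n \<and> even (weight n ((!) w))"
  using count_list_eq_weight[of w] by (auto simp: demicube_graph_def pverts_graph_on)

lemma adj_demicube_graph:
  "adj (demicube_graph n) x y \<longleftrightarrow> x \<in> pverts (demicube_graph n) \<and> y \<in> pverts (demicube_graph n) \<and>
     disagreements n ((!) x) ((!) y) = 2"
  by (auto simp: demicube_graph_def pverts_graph_on adj_graph_on hamming_distance_eq)

lemma demicube_graph_descent:
  assumes V: "x \<in> pverts (demicube_graph n)" "y \<in> pverts (demicube_graph n)"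
    and far: "2 < disagreements n ((!) x) ((!) y)"
  shows "\<exists>z\<in>pverts (demicube_graph n). disagreements n ((!) x) ((!) z) = 2 \<and>
    disagreements n ((!) z) ((!) y) < disagreements n ((!) x) ((!) y)"
proof -
  obtain P where "P \<subseteq> {i. i < n \<and> x ! i \<noteq> y ! i}" "card P = 2"
    using obtain_subset_with_card_n[of 2 "{i. i < n \<and> x ! i \<noteq> y ! i}"] far
    by (auto simp: disagreements_eq_card)
  then obtain i j where ij: "i < n" "x ! i \<noteq> y ! i" "j < n" "x ! j \<noteq> y ! j" "i \<noteq> j"
    by (auto simp: card_2_iff)
  define z where "z = x[i := y ! i, j := y ! j]"
  have z: "(!) z = ((!) x)(i := y ! i, j := y ! j)"
    using ij V(1) by (auto simp: z_def pverts_demicube_graph fun_eq_iff nth_list_update)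
  have upd: "disagreements n ((!) z) ((!) y) + 2 = disagreements n ((!) x) ((!) y)"
    "disagreements n ((!) x) ((!) z) = 2"
    using disagreements_fun_upd2[of i n "(!) x" "(!) y" j] ij by (simp_all add: z)
  have "z \<in> pverts (demicube_graph n)" using V(1) even_disagreements_iff[of n "(!) x" "(!) z"] upd(2)
    by (simp add: pverts_demicube_graph) (simp add: z_def)
  with upd show ?thesis by (intro bexI[of _ z]) auto
qed

lemma minuscule_demicube_graph:
  "minuscule (pverts (demicube_graph n)) (adj (demicube_graph n))
     (\<lambda>x y. real (disagreements n ((!) x) ((!) y) div 2))"
proof (rule minuscule_coordinates)
  let ?V = "pverts (demicube_graph n)"
  have "?V \<subseteq> {w. set w \<subseteq> UNIV \<and> length w = n}" by (auto simp: pverts_demicube_graph)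
  then show "finite ?V" by (rule finite_subset) (rule finite_lists_length_eq, simp)
  show "v = w" if "v \<in> ?V" "w \<in> ?V" "\<And>i. i < n \<Longrightarrow> v ! i = w ! i" for v w
    using that by (simp add: pverts_demicube_graph list_eq_iff_nth_eq)
  show "\<exists>w\<in>?V. \<forall>i<n. w ! i = (if x ! i = y ! i then z ! i else y ! i)"
    if V: "x \<in> ?V" "y \<in> ?V" "z \<in> ?V" and between: "\<And>i. i < n \<Longrightarrow> x ! i = y ! i \<or> x ! i = z ! i"
    for x y z
  proof -
    define w where "w = map (\<lambda>i. if x ! i = y ! i then z ! i else y ! i) [0..<n]"
    have w: "w ! i = (if x ! i = y ! i then z ! i else y ! i)" if "i < n" for i
      using that by (simp add: w_def)
    have "weight n ((!) w) + weight n ((!) x) = weight n ((!) y) + weight n ((!) z)"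
      using between w by (rule weight_parallelogram)
    then have "even (weight n ((!) w))" using V unfolding pverts_demicube_graph by (metis even_add)
    then have "w \<in> ?V" by (simp add: pverts_demicube_graph w_def)
    with w show ?thesis by blast
  qed
qed (use demicube_graph_descent in \<open>auto simp: adj_demicube_graph pverts_demicube_graph even_disagreements_iff\<close>)

lemma pverts_johnson_graph: "S \<in> pverts (johnson_graph n k) \<longleftrightarrow> S \<subseteq> {..<n} \<and> card S = k"
  by (simp add: johnson_graph_def pverts_graph_on)

lemma adj_johnson_graph:
  "adj (johnson_graph n k) S T \<longleftrightarrow>
     S \<in> pverts (johnson_graph n k) \<and> T \<in> pverts (johnson_graph n k) \<and> card (S \<inter> T) + 1 = k"
  by (auto simp: johnson_graph_def pverts_graph_on adj_graph_on)

lemma johnson_graph_disagreements: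
  assumes "S \<in> pverts (johnson_graph n k)" "T \<in> pverts (johnson_graph n k)"
  shows "disagreements n (\<lambda>i. i \<in> S) (\<lambda>i. i \<in> T) + 2 * card (S \<inter> T) = 2 * k"
proof -
  have "S \<inter> T \<subseteq> {..<n}" using assms pverts_johnson_graph by blast
  then show ?thesis
    using disagreements_weight[of n "\<lambda>i. i \<in> S" "\<lambda>i. i \<in> T"] assms
      card_eq_weight[of S n] card_eq_weight[of T n] card_eq_weight[of "S \<inter> T" n]
    by (simp add: pverts_johnson_graph)
qed

lemma johnson_graph_descent:
  assumes V: "S \<in> pverts (johnson_graph n k)" "T \<in> pverts (johnson_graph n k)" and neq: "S \<noteq> T"
  shows "\<exists>U\<in>pverts (johnson_graph n k). disagreements n (\<lambda>i. i \<in> S) (\<lambda>i. i \<in> U) = 2 \<and>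
    disagreements n (\<lambda>i. i \<in> U) (\<lambda>i. i \<in> T) < disagreements n (\<lambda>i. i \<in> S) (\<lambda>i. i \<in> T)"
proof -
  have fin: "finite S" "finite T" using V finite_subset[of _ "{..<n}"] by (auto simp: pverts_johnson_graph)
  have card: "card S = k" "card T = k" using V by (simp_all add: pverts_johnson_graph)
  have "\<not> S \<subseteq> T" "\<not> T \<subseteq> S"
    using card_subset_eq[OF fin(2)] card_subset_eq[OF fin(1)] card neq by auto
  then obtain i j where i: "i \<in> S" "i \<notin> T" and j: "j \<in> T" "j \<notin> S" by blast
  define U where "U = insert j (S - {i})"
  have ij: "i < n" "j < n" "i \<noteq> j" using i j V pverts_johnson_graph by auto
  have U: "(\<lambda>l. l \<in> U) = (\<lambda>l. l \<in> S)(i := i \<in> T, j := j \<in> T)"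
    using i j by (auto simp: U_def fun_eq_iff)
  have "card U = k" using i j fin card card_Suc_Diff1[OF fin(1) i(1)] by (simp add: U_def)
  then have "U \<in> pverts (johnson_graph n k)" using V ij by (auto simp: pverts_johnson_graph U_def)
  moreover have "disagreements n (\<lambda>i. i \<in> U) (\<lambda>i. i \<in> T) + 2 = disagreements n (\<lambda>i. i \<in> S) (\<lambda>i. i \<in> T)"
    "disagreements n (\<lambda>i. i \<in> S) (\<lambda>i. i \<in> U) = 2"
    using disagreements_fun_upd2[of i n "\<lambda>l. l \<in> S" "\<lambda>l. l \<in> T" j] ij i j unfolding U by auto
  ultimately show ?thesis by (intro bexI[of _ U]) auto
qed

lemma minuscule_johnson_graph:
  "minuscule (pverts (johnson_graph n k)) (adj (johnson_graph n k))
     (\<lambda>S T. real (disagreements n (\<lambda>i. i \<in> S) (\<lambda>i. i \<in> T) div 2))"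
proof (rule minuscule_coordinates)
  let ?V = "pverts (johnson_graph n k)" and ?h = "\<lambda>S T. disagreements n (\<lambda>i. i \<in> S) (\<lambda>i. i \<in> T)"
  show "finite ?V" by (rule finite_subset[of _ "Pow {..<n}"]) (auto simp: pverts_johnson_graph)
  show "adj (johnson_graph n k) S T \<longleftrightarrow> S \<in> ?V \<and> T \<in> ?V \<and> ?h S T = 2" for S T
    using johnson_graph_disagreements[of S n k T] by (auto simp: adj_johnson_graph)
  show "S = T" if "S \<in> ?V" "T \<in> ?V" "\<And>i. i < n \<Longrightarrow> (i \<in> S) = (i \<in> T)" for S T
    using that by (auto simp: pverts_johnson_graph)
  show "2 dvd ?h S T" if "S \<in> ?V" "T \<in> ?V" for S T
    using johnson_graph_disagreements[OF that] by presburger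
  show "\<exists>U\<in>?V. ?h S U = 2 \<and> ?h U T < ?h S T" if "S \<in> ?V" "T \<in> ?V" "2 < ?h S T" for S T
    by (rule johnson_graph_descent[OF that(1,2)]) (use that(3) in auto)
  show "\<exists>U\<in>?V. \<forall>i<n. (i \<in> U) = (if (i \<in> R) = (i \<in> S) then i \<in> T else i \<in> S)"
    if V: "R \<in> ?V" "S \<in> ?V" "T \<in> ?V"
      and between: "\<And>i. i < n \<Longrightarrow> (i \<in> R) = (i \<in> S) \<or> (i \<in> R) = (i \<in> T)" for R S T
  proof -
    define U where "U = {i. i < n \<and> (if (i \<in> R) = (i \<in> S) then i \<in> T else i \<in> S)}"
    have U: "(i \<in> U) = (if (i \<in> R) = (i \<in> S) then i \<in> T else i \<in> S)" if "i < n" for i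
      using that by (simp add: U_def)
    have "U \<subseteq> {..<n}" by (auto simp: U_def)
    moreover from this have "card U + card R = card S + card T"
      using weight_parallelogram[of n "\<lambda>i. i \<in> R" "\<lambda>i. i \<in> S" "\<lambda>i. i \<in> T" "\<lambda>i. i \<in> U", OF between U] V
        card_eq_weight[of R n] card_eq_weight[of S n] card_eq_weight[of T n] card_eq_weight[of U n]
      by (simp add: pverts_johnson_graph)
    ultimately have "U \<in> ?V" using V by (simp add: pverts_johnson_graph)
    with U show ?thesis by blast
  qed
qed simp

lemma card_Int_exchange:
  fixes k :: nat
  assumes "a < k" "a' < k"
  shows "card (insert (k + b) ({..<k} - {a}) \<inter> insert (k + b') ({..<k} - {a'})) +
    of_bool (a \<noteq> a') + of_bool (b \<noteq> b') = k"
proof -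
  have "insert (k + b) ({..<k} - {a}) \<inter> insert (k + b') ({..<k} - {a'}) =
      (if b = b' then {k + b} else {}) \<union> ({..<k} - {a, a'})" using assms by auto
  also have "card \<dots> = of_bool (b = b') + (k - card {a, a'})"
    using assms by (subst card_Un_disjoint) (auto simp: card_Diff_subset)
  finally show ?thesis using assms card_mono[of "{..<k}" "{a, a'}"] by (auto simp: card_insert_if)
qed

lemma adj_johnson_graph_initial_iff:
  assumes "k \<le> n"
  shows "adj (johnson_graph n k) {..<k} T \<longleftrightarrow>
    (\<exists>a b. a < k \<and> b < n - k \<and> T = insert (k + b) ({..<k} - {a}))"
proof
  assume "adj (johnson_graph n k) {..<k} T"
  then have T: "T \<subseteq> {..<n}" "card T = k" "card ({..<k} \<inter> T) + 1 = k"
    by (auto simp: adj_johnson_graph pverts_johnson_graph)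
  have fin: "finite T" by (rule finite_subset[OF T(1)]) simp
  have "card ({..<k} - {..<k} \<inter> T) = 1" using T by (subst card_Diff_subset) auto
  then obtain a where a: "{..<k} - {..<k} \<inter> T = {a}" by (auto simp: card_1_singleton_iff)
  have "card (T - {..<k} \<inter> T) = 1" using T by (subst card_Diff_subset) auto
  then obtain c where c: "T - {..<k} \<inter> T = {c}" by (auto simp: card_1_singleton_iff)
  have "c \<in> T" "k \<le> c" using c by auto
  then have "c - k < n - k" "k + (c - k) = c" using T(1) by auto
  moreover have "T = insert c ({..<k} - {a})" "a < k" using a c by blast+
  ultimately show "\<exists>a b. a < k \<and> b < n - k \<and> T = insert (k + b) ({..<k} - {a})" by metis
next
  assume "\<exists>a b. a < k \<and> b < n - k \<and> T = insert (k + b) ({..<k} - {a})"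
  then obtain a b where ab: "a < k" "b < n - k" and T: "T = insert (k + b) ({..<k} - {a})" by blast
  have "{..<k} \<inter> T = {..<k} - {a}" "T \<subseteq> {..<n}" using ab assms by (auto simp: T)
  moreover have "card T = k" using card_Int_exchange[OF ab(1,1), of b b] by (simp add: T)
  ultimately show "adj (johnson_graph n k) {..<k} T"
    using ab assms by (auto simp: adj_johnson_graph pverts_johnson_graph)
qed

lemma pverts_box_graph_pair: "w \<in> pverts (box_graph [p, q]) \<longleftrightarrow> (\<exists>a b. w = [a, b] \<and> a < p \<and> b < q)"
  by (auto simp: pverts_box_graph length_Suc_conv less_Suc_eq)

lemma adj_box_graph_pair:
  "adj (box_graph [p, q]) v w \<longleftrightarrow> v \<in> pverts (box_graph [p, q]) \<and> w \<in> pverts (box_graph [p, q]) \<and>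
     of_bool (v ! 0 \<noteq> w ! 0) + of_bool (v ! 1 \<noteq> w ! 1) = (1 :: nat)"
  by (simp add: adj_box_graph disagreements_def)

lemma johnson_graph_local_iso:
  assumes "k \<le> n"
  shows "iso_on (pverts (box_graph [k, n - k])) (adj (box_graph [k, n - k]))
    (nbhd (adj (johnson_graph n k)) {..<k}) (adj (johnson_graph n k))"
proof (rule iso_onI)
  let ?B = "pverts (box_graph [k, n - k])" and ?N = "nbhd (adj (johnson_graph n k)) {..<k}"
  define f where "f w = insert (k + w ! 1) ({..<k} - {w ! 0})" for w
  have card_f: "card (f v \<inter> f w) + of_bool (v ! 0 \<noteq> w ! 0) + of_bool (v ! 1 \<noteq> w ! 1) = k"
    if "v \<in> ?B" "w \<in> ?B" for v w
    unfolding f_def by (rule card_Int_exchange) (use that pverts_box_graph_pair in auto)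
  have f_N: "f w \<in> ?N" if w: "w \<in> ?B" for w
  proof -
    obtain a b where "w = [a, b]" "a < k" "b < n - k" using w pverts_box_graph_pair by blast
    then show ?thesis unfolding mem_nbhd adj_johnson_graph_initial_iff[OF assms] by (auto simp: f_def)
  qed
  show "bij_betw f ?B ?N"
  proof (rule bij_betwI')
    fix v w assume vw: "v \<in> ?B" "w \<in> ?B"
    show "f v = f w \<longleftrightarrow> v = w"
    proof
      assume "f v = f w"
      then have "v ! 0 = w ! 0 \<and> v ! 1 = w ! 1"
        using card_f[OF vw] card_f[OF vw(1,1)] by (auto split: if_splits)
      then show "v = w" using vw by (auto simp: pverts_box_graph_pair)
    qed simp
  next
    fix T assume "T \<in> ?N"
    then obtain a b where "a < k" "b < n - k" "T = insert (k + b) ({..<k} - {a})"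
      by (auto simp: adj_johnson_graph_initial_iff[OF assms])
    then show "\<exists>w\<in>?B. T = f w" by (intro bexI[of _ "[a, b]"]) (auto simp: f_def pverts_box_graph_pair)
  qed (rule f_N)
  show "adj (box_graph [k, n - k]) v w \<longleftrightarrow> adj (johnson_graph n k) (f v) (f w)"
    if vw: "v \<in> ?B" "w \<in> ?B" for v w
  proof -
    have "f v \<in> pverts (johnson_graph n k)" "f w \<in> pverts (johnson_graph n k)"
      using f_N vw by (auto simp: adj_johnson_graph)
    then have "adj (johnson_graph n k) (f v) (f w) \<longleftrightarrow> card (f v \<inter> f w) + 1 = k"
      by (simp add: adj_johnson_graph)
    moreover have "adj (box_graph [k, n - k]) v w \<longleftrightarrow>
        of_bool (v ! 0 \<noteq> w ! 0) + of_bool (v ! 1 \<noteq> w ! 1) = (1 :: nat)"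
      using vw by (simp only: adj_box_graph_pair simp_thms)
    ultimately show ?thesis using card_f[OF vw] by linarith
  qed
qed

lemma box_graph_swap_iso:
  "iso_on (pverts (box_graph [p, q])) (adj (box_graph [p, q]))
    (pverts (box_graph [q, p])) (adj (box_graph [q, p]))"
proof (rule iso_onI)
  show "bij_betw rev (pverts (box_graph [p, q])) (pverts (box_graph [q, p]))"
    by (rule bij_betwI[where g = rev]) (auto simp: pverts_box_graph_pair)
  fix v w assume "v \<in> pverts (box_graph [p, q])" "w \<in> pverts (box_graph [p, q])"
  then show "adj (box_graph [p, q]) v w \<longleftrightarrow> adj (box_graph [q, p]) (rev v) (rev w)"
    by (auto simp: adj_box_graph_pair pverts_box_graph_pair)
qed

lemma nbhd_demicube_graph_origin:
  "w \<in> nbhd (adj (demicube_graph n)) (replicate n False) \<longleftrightarrow> length w = n \<and> weight n ((!) w) = 2"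
proof -
  have "disagreements n ((!) (replicate n False)) x = weight n x" for x
    unfolding disagreements_def weight_def by (intro sum.cong) auto
  moreover have "weight n ((!) (replicate n False)) = 0" by (simp add: weight_def)
  ultimately show ?thesis by (auto simp: adj_demicube_graph pverts_demicube_graph)
qed

lemma demicube_graph_local_iso:
  shows "replicate n False \<in> pverts (demicube_graph n)"
    and "iso_on (pverts (johnson_graph n 2)) (adj (johnson_graph n 2))
      (nbhd (adj (demicube_graph n)) (replicate n False)) (adj (demicube_graph n))"
proof -
  let ?J = "pverts (johnson_graph n 2)" and ?N = "nbhd (adj (demicube_graph n)) (replicate n False)"
  show "replicate n False \<in> pverts (demicube_graph n)" by (simp add: pverts_demicube_graph weight_def)
  define f where "f S = map (\<lambda>i. i \<in> S) [0..<n]" for S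
  have f_nth: "f S ! i \<longleftrightarrow> i \<in> S" if "i < n" for S i using that by (simp add: f_def)
  have f_N: "f S \<in> ?N" if "S \<in> ?J" for S
  proof -
    have "weight n ((!) (f S)) = weight n (\<lambda>i. i \<in> S)" using f_nth by (rule weight_cong)
    then show ?thesis using that card_eq_weight[of S n]
      unfolding nbhd_demicube_graph_origin by (simp add: pverts_johnson_graph) (simp add: f_def)
  qed
  show "iso_on ?J (adj (johnson_graph n 2)) ?N (adj (demicube_graph n))"
  proof (rule iso_onI)
    show "bij_betw f ?J ?N"
    proof (rule bij_betwI[where g = "\<lambda>w. {i. i < n \<and> w ! i}"])
      show "(\<lambda>w. {i. i < n \<and> w ! i}) \<in> ?N \<rightarrow> ?J"
      proof
        fix w assume w: "w \<in> ?N"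
        have "weight n (\<lambda>i. i \<in> {i. i < n \<and> w ! i}) = weight n ((!) w)" by (rule weight_cong) simp
        then have "card {i. i < n \<and> w ! i} = 2" using w card_eq_weight[of "{i. i < n \<and> w ! i}" n]
          unfolding nbhd_demicube_graph_origin by auto
        then show "{i. i < n \<and> w ! i} \<in> ?J" by (auto simp: pverts_johnson_graph)
      qed
      show "{i. i < n \<and> f S ! i} = S" if "S \<in> ?J" for S using that by (auto simp: f_nth pverts_johnson_graph)
      show "f {i. i < n \<and> w ! i} = w" if "w \<in> ?N" for w
        using that unfolding nbhd_demicube_graph_origin by (auto simp: f_def intro!: nth_equalityI)
    qed (use f_N in blast)
    fix S T assume ST: "S \<in> ?J" "T \<in> ?J"
    have "disagreements n ((!) (f S)) ((!) (f T)) = disagreements n (\<lambda>i. i \<in> S) (\<lambda>i. i \<in> T)"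
      using f_nth by (intro disagreements_cong)
    moreover have "f S \<in> pverts (demicube_graph n)" "f T \<in> pverts (demicube_graph n)"
      using f_N ST by (auto simp: adj_demicube_graph)
    ultimately show "adj (johnson_graph n 2) S T \<longleftrightarrow> adj (demicube_graph n) (f S) (f T)"
      using ST johnson_graph_disagreements[OF ST] by (auto simp: adj_johnson_graph adj_demicube_graph)
  qed
qed

subsection \<open>Cocktail party graphs\<close>

lemma pverts_cocktail_party_graph [simp]: "pverts (cocktail_party_graph n) = {..<2 * n}"
  by (simp add: cocktail_party_graph_def pverts_graph_on)

lemma adj_cocktail_party_graph:
  "adj (cocktail_party_graph n) x y \<longleftrightarrow> x < 2 * n \<and> y < 2 * n \<and> x div 2 \<noteq> y div 2"
  by (auto simp: cocktail_party_graph_def adj_graph_on)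

lemma div_2_eq_cases:
  fixes s x y :: nat
  assumes "x \<noteq> y" "x div 2 = y div 2" "s div 2 = x div 2" shows "s = x \<or> s = y"
proof -
  have "even s = even x \<or> even s = even y" using assms by (metis bit_eq_rec)
  then show ?thesis using assms by (metis bit_eq_rec)
qed

lemma minuscule_cocktail_party_graph:
  assumes "n \<ge> 2"
  shows "minuscule (pverts (cocktail_party_graph n)) (adj (cocktail_party_graph n))
    (\<lambda>x y. real (if x = y then 0 else if x div 2 = y div 2 then 2 else 1))"
proof (rule minusculeI)
  let ?V = "pverts (cocktail_party_graph n)" and ?A = "adj (cocktail_party_graph n)"
  define d where "d = (\<lambda>x y :: nat. if x = y then 0 else if x div 2 = y div 2 then 2 else 1 :: nat)"
  show "?A x y \<longleftrightarrow> x \<in> ?V \<and> y \<in> ?V \<and> d x y = 1" for x y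
    by (auto simp: adj_cocktail_party_graph d_def)
  show "d x y = 0 \<longleftrightarrow> x = y" "d x y = d y x" "d x y \<le> 2" for x y by (auto simp: d_def)
  show "\<exists>z. ?A x z \<and> d z y < d x y" if xy: "x \<in> ?V" "y \<in> ?V" "1 < d x y" for x y
  proof -
    have "x div 2 = y div 2" "d x y = 2" using xy by (auto simp: d_def split: if_splits)
    moreover define z :: nat where "z = (if x div 2 = 0 then 2 else 0)"
    ultimately have "d z y < d x y" "?A x z"
      using xy assms by (auto simp: d_def z_def adj_cocktail_party_graph)
    then show ?thesis by blast
  qed
  have antipodes: "d s x + d s y = 2" if "x \<noteq> y" "x div 2 = y div 2" for s x y
    using div_2_eq_cases[OF that, of s] that by (auto simp: d_def)
  show "\<exists>w\<in>?V. \<forall>s\<in>?V. d s w + d s x = d s y + d s z"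
    if xyz: "?A x y" "?A x z" "d y z = 2" for x y z
  proof
    define w where "w = (if even x then x + 1 else x - 1)"
    have w: "w \<noteq> x" "w div 2 = x div 2" "w < 2 * n"
      using xyz(1) unfolding w_def adj_cocktail_party_graph by (auto elim!: evenE oddE)
    then show "w \<in> ?V" by simp
    have "y \<noteq> z" "y div 2 = z div 2" using xyz by (auto simp: d_def split: if_splits)
    then show "\<forall>s\<in>?V. d s w + d s x = d s y + d s z" using antipodes w by auto
  qed
qed simp

lemma cocktail_party_graph_local_iso:
  "iso_on (pverts (cocktail_party_graph n)) (adj (cocktail_party_graph n))
    (nbhd (adj (cocktail_party_graph (Suc n))) 0) (adj (cocktail_party_graph (Suc n)))"
proof (rule iso_onI)
  show "bij_betw (\<lambda>i. i + 2) (pverts (cocktail_party_graph n)) (nbhd (adj (cocktail_party_graph (Suc n))) 0)"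
    by (rule bij_betwI[where g = "\<lambda>i. i - 2"]) (auto simp: adj_cocktail_party_graph div_eq_0_iff)
qed (auto simp: adj_cocktail_party_graph)

subsection \<open>The Gosset and Schlaefli graphs\<close>

lemma two_sets_meet:
  assumes "card S = 2" "card T = 2" "card (S \<inter> T) = 1"
  obtains a b c where "S = {a, b}" "T = {a, c}" "a \<noteq> b" "a \<noteq> c" "b \<noteq> c"
proof -
  obtain a where a: "S \<inter> T = {a}" using assms(3) by (auto simp: card_1_singleton_iff)
  have split: "\<exists>b. X = {a, b} \<and> a \<noteq> b" if "card X = 2" "a \<in> X" for X
    using that by (auto simp: card_2_iff)
  obtain b where b: "S = {a, b}" "a \<noteq> b" using split[OF assms(1)] a by blast
  obtain c where c: "T = {a, c}" "a \<noteq> c" using split[OF assms(2)] a by blast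
  have "b \<noteq> c" using a b c by auto
  then show ?thesis using that b c by blast
qed

lemma card_Int_doubleton: "a \<noteq> b \<Longrightarrow> card (P \<inter> {a, b}) = of_bool (a \<in> P) + of_bool (b \<in> P)"
  by (auto simp: Int_insert_right)

definition gosset_parallelogram :: "bool \<times> nat set \<Rightarrow> bool \<times> nat set \<Rightarrow> bool \<times> nat set \<Rightarrow> bool" where
  "gosset_parallelogram x y z \<longleftrightarrow> (\<exists>w\<in>gosset_verts. \<forall>p\<in>gosset_verts.
     gosset_dist p w + gosset_dist p x = gosset_dist p y + gosset_dist p z)"

lemma gosset_parallelogram_same_sign:
  assumes V: "(s, S) \<in> gosset_verts" "(s, T) \<in> gosset_verts" "(s, U) \<in> gosset_verts"
    and meet: "card (S \<inter> T) = 1" "card (S \<inter> U) = 1" "T \<inter> U = {}"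
  shows "gosset_parallelogram (s, S) (s, T) (s, U)"
proof -
  have card: "card S = 2" "card T = 2" "card U = 2" using V by (simp_all add: mem_gosset)
  obtain a b c where abc: "S = {a, b}" "T = {a, c}" "a \<noteq> b" "a \<noteq> c" "b \<noteq> c"
    using two_sets_meet[OF card(1,2) meet(1)] .
  obtain d where d: "U = {b, d}" "d \<noteq> a" "d \<noteq> b" "d \<noteq> c"
    using two_sets_meet[OF card(1,3) meet(2)] meet(3) unfolding abc
    by (smt (verit) disjoint_iff doubleton_eq_iff insert_iff)
  have "(s, {c, d}) \<in> gosset_verts" using V abc d by (auto simp: mem_gosset)
  moreover have "gosset_dist p (s, {c, d}) + gosset_dist p (s, S) =
      gosset_dist p (s, T) + gosset_dist p (s, U)" for p
    using abc d by (cases p) (auto simp: card_Int_doubleton)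
  ultimately show ?thesis unfolding gosset_parallelogram_def by blast
qed

lemma gosset_parallelogram_mixed_sign:
  assumes V: "(s, S) \<in> gosset_verts" "(s, T) \<in> gosset_verts" "(\<not> s, U) \<in> gosset_verts"
    and meet: "card (S \<inter> T) = 1" "S \<inter> U = {}" "card (T \<inter> U) = 1"
  shows "gosset_parallelogram (s, S) (s, T) (\<not> s, U)"
proof -
  have card: "card S = 2" "card T = 2" "card U = 2" using V by (simp_all add: mem_gosset)
  obtain a b c where abc: "S = {a, b}" "T = {a, c}" "a \<noteq> b" "a \<noteq> c" "b \<noteq> c"
    using two_sets_meet[OF card(1,2) meet(1)] .
  obtain d where d: "U = {c, d}" "d \<noteq> a" "d \<noteq> b" "d \<noteq> c"
    using two_sets_meet[OF card(2,3) meet(3)] meet(2) unfolding abc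
    by (smt (verit) disjoint_iff doubleton_eq_iff insert_iff)
  have "(\<not> s, {b, d}) \<in> gosset_verts" using V abc d by (auto simp: mem_gosset)
  moreover have "gosset_dist p (\<not> s, {b, d}) + gosset_dist p (s, S) =
      gosset_dist p (s, T) + gosset_dist p (\<not> s, U)" for p
    using abc d by (cases p) (auto simp: card_Int_doubleton)
  ultimately show ?thesis unfolding gosset_parallelogram_def by blast
qed

lemma gosset_parallelogram_opposite_sign:
  assumes V: "(s, S) \<in> gosset_verts" "(\<not> s, T) \<in> gosset_verts" "(\<not> s, U) \<in> gosset_verts"
    and disj: "S \<inter> T = {}" "S \<inter> U = {}" "T \<inter> U = {}"
  shows "gosset_parallelogram (s, S) (\<not> s, T) (\<not> s, U)"
proof -
  have c: "S \<subseteq> {..<8}" "T \<subseteq> {..<8}" "U \<subseteq> {..<8}" "card S = 2" "card T = 2" "card U = 2"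
    using V by (simp_all add: mem_gosset)
  have fin: "finite S" "finite T" "finite U" using c finite_subset by blast+
  define R where "R = {..<8} - (S \<union> T \<union> U)"
  have "card (S \<union> T \<union> U) = 6" using disj c fin by (simp add: card_Un_disjoint Int_Un_distrib2)
  then have "card R = 2" unfolding R_def using c fin by (subst card_Diff_subset) auto
  then have "(s, R) \<in> gosset_verts" by (auto simp: mem_gosset R_def)
  moreover have "gosset_dist p (s, R) + gosset_dist p (s, S) =
      gosset_dist p (\<not> s, T) + gosset_dist p (\<not> s, U)" if p: "p \<in> gosset_verts" for p
  proof -
    obtain q P where q: "p = (q, P)" by (cases p)
    have P: "P \<subseteq> {..<8}" "card P = 2" using p by (auto simp: q mem_gosset)
    have finP: "finite P" using P finite_subset by blast
    have "P = (P \<inter> R) \<union> (P \<inter> S) \<union> (P \<inter> T) \<union> (P \<inter> U)" using P by (auto simp: R_def)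
    moreover have "card ((P \<inter> R) \<union> (P \<inter> S) \<union> (P \<inter> T) \<union> (P \<inter> U)) =
        card (P \<inter> R) + card (P \<inter> S) + card (P \<inter> T) + card (P \<inter> U)"
      using disj finP by (subst card_Un_disjoint, auto simp: R_def)+
    ultimately have "card (P \<inter> R) + card (P \<inter> S) + card (P \<inter> T) + card (P \<inter> U) = 2" using P by simp
    then show ?thesis by (auto simp: q)
  qed
  ultimately show ?thesis unfolding gosset_parallelogram_def by blast
qed

lemma gosset_parallelogram:
  assumes V: "x \<in> gosset_verts" "y \<in> gosset_verts" "z \<in> gosset_verts"
    and d: "gosset_dist x y = 1" "gosset_dist x z = 1" "gosset_dist y z = 2"
  shows "gosset_parallelogram x y z"
proof -
  obtain s S t T u U where xyz: "x = (s, S)" "y = (t, T)" "z = (u, U)" by (cases x; cases y; cases z)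
  have fin: "finite S" "finite T"
    using V finite_subset[of _ "{..<8 :: nat}"] unfolding xyz mem_gosset by blast+
  have swap: "gosset_parallelogram x z y \<Longrightarrow> gosset_parallelogram x y z"
    unfolding gosset_parallelogram_def by (simp add: add.commute)
  consider (same) "t = s" "u = s" | (second) "t = s" "u = (\<not> s)" | (first) "t = (\<not> s)" "u = s"
    | (opposite) "t = (\<not> s)" "u = (\<not> s)" by blast
  then show ?thesis
  proof cases
    case same
    then have "card (S \<inter> T) = 1" "card (S \<inter> U) = 1" "card (T \<inter> U) = 0" using d by (auto simp: xyz)
    then show ?thesis
      using gosset_parallelogram_same_sign[of s S T U] V same fin by (auto simp: xyz)
  next
    case second
    then show ?thesis
      using gosset_parallelogram_mixed_sign[of s S T U] V d fin by (auto simp: xyz)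
  next
    case first
    then show ?thesis
      using swap gosset_parallelogram_mixed_sign[of s S U T] V d fin by (auto simp: xyz Int_commute)
  next
    case opposite
    then have "card (T \<inter> U) = 0" using d by (auto simp: xyz)
    then show ?thesis
      using gosset_parallelogram_opposite_sign[of s S T U] V d opposite fin by (auto simp: xyz)
  qed
qed

lemma minuscule_gosset_graph: "minuscule gosset_verts (adj gosset_graph) (\<lambda>x y. real (gosset_dist x y))"
proof (rule minusculeI)
  show A: "adj gosset_graph x y \<longleftrightarrow> x \<in> gosset_verts \<and> y \<in> gosset_verts \<and> gosset_dist x y = 1" for x y
    by (rule parcs_gosset)
  show "gosset_dist x z \<le> 2" if "adj gosset_graph x y" "adj gosset_graph y z" for x y z
    using gosset_counts[of x y] that unfolding gosset_counts_def A by force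
  show "\<exists>z. adj gosset_graph x z \<and> gosset_dist z y < gosset_dist x y"
    if xy: "x \<in> gosset_verts" "y \<in> gosset_verts" "1 < gosset_dist x y" for x y
  proof -
    have "gosset_dist y x \<in> {2, 3}" using gosset_dist_le[OF xy(1,2)] xy(3) by (auto simp: gosset_dist_commute)
    then have "[0, 1, 10, 27] ! gosset_dist y x \<noteq> (0 :: nat)" by auto
    then have "card {z \<in> gosset_verts. gosset_dist x z = 1 \<and> Suc (gosset_dist y z) = gosset_dist y x} \<noteq> 0"
      using gosset_counts[OF xy(2,1)] unfolding gosset_counts_def by metis
    then have "{z \<in> gosset_verts. gosset_dist x z = 1 \<and> Suc (gosset_dist y z) = gosset_dist y x} \<noteq> {}"
      by (metis card.empty)
    then obtain z where "z \<in> gosset_verts" "gosset_dist x z = 1" "Suc (gosset_dist y z) = gosset_dist y x"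
      by blast
    then show ?thesis using xy A by (metis gosset_dist_commute lessI)
  qed
  show "\<exists>w\<in>gosset_verts. \<forall>s\<in>gosset_verts. gosset_dist s w + gosset_dist s x = gosset_dist s y + gosset_dist s z"
    if "adj gosset_graph x y" "adj gosset_graph x z" "gosset_dist y z = 2" for x y z
    using gosset_parallelogram[of x y z] that unfolding A gosset_parallelogram_def by blast
qed (auto simp: finite_gosset gosset_dist_eq_0 gosset_dist_commute simp del: gosset_dist.simps)

lemma constant_mu_gosset_graph: "constant_mu (adj gosset_graph) 10"
  unfolding constant_mu_def
proof (intro allI impI)
  interpret minuscule gosset_verts "adj gosset_graph" "\<lambda>x y. real (gosset_dist x y)"
    by (rule minuscule_gosset_graph)
  fix x y z
  assume xyz: "adj gosset_graph x y" "adj gosset_graph x z" "y \<noteq> z" "\<not> adj gosset_graph y z"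
  have V: "y \<in> gosset_verts" "z \<in> gosset_verts" using xyz A_V2 by blast+
  have "gosset_dist y z = 2" using D_common_neighbour_iff(3)[OF xyz(1,2)] xyz by simp
  moreover have "nbhd (adj gosset_graph) y \<inter> nbhd (adj gosset_graph) z =
      {t \<in> gosset_verts. gosset_dist z t = 1 \<and> gosset_dist y t = 1}"
    using V by (auto simp: parcs_gosset)
  ultimately show "card (nbhd (adj gosset_graph) y \<inter> nbhd (adj gosset_graph) z) = 10"
    using gosset_counts[OF V] unfolding gosset_counts_def by simp
qed

lemma pverts_schlaefli_graph:
  "x \<in> pverts schlaefli_graph \<longleftrightarrow>
    (case x of LineA i \<Rightarrow> i < 6 | LineB i \<Rightarrow> i < 6 | LineC S \<Rightarrow> S \<subseteq> {..<6} \<and> card S = 2)"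
  by (auto simp: schlaefli_graph_def pverts_graph_on split: cubic_line.splits)

lemma adj_schlaefli_graph:
  "adj schlaefli_graph x y \<longleftrightarrow> x \<in> pverts schlaefli_graph \<and> y \<in> pverts schlaefli_graph \<and> skew_lines x y"
  by (simp add: schlaefli_graph_def pverts_graph_on adj_graph_on)

fun schlaefli_to_gosset :: "cubic_line \<Rightarrow> bool \<times> nat set" where
  "schlaefli_to_gosset (LineA i) = (True, {6, i})"
| "schlaefli_to_gosset (LineB i) = (True, {7, i})"
| "schlaefli_to_gosset (LineC S) = (False, S)"

lemma gosset_base_in_verts: "(True, {6, 7}) \<in> gosset_verts" by (simp add: mem_gosset)

lemma adj_gosset_graph:
  "adj gosset_graph (s, S) (t, T) \<longleftrightarrow> S \<subseteq> {..<8} \<and> card S = 2 \<and> T \<subseteq> {..<8} \<and> card T = 2 \<and>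
    (if s = t then card (S \<inter> T) = 1 else S \<inter> T = {})"
  by (auto simp: gosset_graph_def adj_graph_on)

lemma card_nbhd_gosset_graph: "x \<in> gosset_verts \<Longrightarrow> card (nbhd (adj gosset_graph) x) = 27"
proof -
  assume x: "x \<in> gosset_verts"
  then have "nbhd (adj gosset_graph) x =
      {z \<in> gosset_verts. gosset_dist x z = 1 \<and> gosset_dist x z = Suc (gosset_dist x x)}"
    using gosset_dist_eq_0[OF x x] by (auto simp: parcs_gosset)
  then show ?thesis
    using gosset_counts[OF x x] gosset_dist_eq_0[OF x x] unfolding gosset_counts_def by simp
qed

lemma bij_betw_schlaefli_to_gosset:
  "bij_betw schlaefli_to_gosset (pverts schlaefli_graph) (nbhd (adj gosset_graph) (True, {6, 7}))"
  (is "bij_betw ?f ?S ?N")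
proof (rule bij_betw_imageI)
  show inj: "inj_on ?f ?S"
  proof (rule inj_onI)
    fix x y assume "x \<in> ?S" "y \<in> ?S" "?f x = ?f y"
    then show "x = y" by (cases x; cases y) (auto simp: pverts_schlaefli_graph doubleton_eq_iff)
  qed
  show "?f ` ?S = ?N"
  proof (rule card_subset_eq)
    have "card ?N = 27" by (rule card_nbhd_gosset_graph[OF gosset_base_in_verts])
    then show "finite ?N" "card (?f ` ?S) = card ?N"
      using schlaefli_strongly_regular(1) card_image[OF inj] by (auto intro: card_ge_0_finite)
    show "?f ` ?S \<subseteq> ?N"
    proof
      fix p assume "p \<in> ?f ` ?S"
      then obtain x where "x \<in> ?S" "p = ?f x" by blast
      then show "p \<in> ?N" by (cases x) (auto simp: pverts_schlaefli_graph adj_gosset_graph Int_insert_left)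
    qed
  qed
qed

lemma adj_schlaefli_to_gosset_iff:
  assumes "x \<in> pverts schlaefli_graph" "y \<in> pverts schlaefli_graph"
  shows "adj schlaefli_graph x y \<longleftrightarrow> adj gosset_graph (schlaefli_to_gosset x) (schlaefli_to_gosset y)"
  using assms
  by (cases x; cases y) (auto simp: adj_schlaefli_graph pverts_schlaefli_graph adj_gosset_graph Int_insert_left)

lemma gosset_graph_local_iso:
  "iso_on (pverts schlaefli_graph) (adj schlaefli_graph)
    (nbhd (adj gosset_graph) (True, {6, 7})) (adj gosset_graph)"
  using bij_betw_schlaefli_to_gosset adj_schlaefli_to_gosset_iff by (rule iso_onI)

lemma minuscule_schlaefli_graph:
  "minuscule (pverts schlaefli_graph) (adj schlaefli_graph)
    (\<lambda>x y. real (gosset_dist (schlaefli_to_gosset x) (schlaefli_to_gosset y)))"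
proof -
  have "minuscule (nbhd (adj gosset_graph) (True, {6, 7})) (local_adj (adj gosset_graph) (True, {6, 7}))
      (\<lambda>x y. real (gosset_dist x y))"
    using minuscule.minuscule_local[OF minuscule_gosset_graph constant_mu_gosset_graph _ gosset_base_in_verts]
    by simp
  then show ?thesis
  proof (rule minuscule_pullback[OF _ bij_betw_schlaefli_to_gosset])
    fix x y
    show "adj schlaefli_graph x y \<longleftrightarrow> x \<in> pverts schlaefli_graph \<and> y \<in> pverts schlaefli_graph \<and>
        local_adj (adj gosset_graph) (True, {6, 7}) (schlaefli_to_gosset x) (schlaefli_to_gosset y)"
      using adj_schlaefli_to_gosset_iff[of x y] bij_betwE[OF bij_betw_schlaefli_to_gosset]
        adj_schlaefli_graph[of x y]
      by (auto simp: local_adj_def)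
  qed
qed

subsection \<open>Isomorphisms found by enumeration\<close>

lemma iso_on_set_listI:
  assumes "distinct (map f xs)" "set (map f xs) = set ys"
    and "\<And>x y. x \<in> set xs \<Longrightarrow> y \<in> set xs \<Longrightarrow> A x y \<longleftrightarrow> B (f x) (f y)"
  shows "iso_on (set xs) A (set ys) B"
  by (rule iso_onI[of f]) (use assms in \<open>auto simp: bij_betw_def distinct_map\<close>)

definition demicube_list :: "nat \<Rightarrow> bool list list" where
  "demicube_list n = filter (\<lambda>w. even (count_list w True)) (List.n_lists n [True, False])"

definition mismatches :: "bool list \<Rightarrow> bool list \<Rightarrow> nat" where
  "mismatches v w = length (filter (\<lambda>(a, b). a \<noteq> b) (zip v w))"

lemma pverts_demicube_graph_eq_set: "pverts (demicube_graph n) = set (demicube_list n)"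
  by (auto simp: demicube_graph_def pverts_graph_on demicube_list_def set_n_lists)

lemma adj_demicube_graph_iff_mismatches:
  assumes "v \<in> set (demicube_list n)" "w \<in> set (demicube_list n)"
  shows "adj (demicube_graph n) v w \<longleftrightarrow> mismatches v w = 2"
proof -
  have V: "v \<in> pverts (demicube_graph n)" "w \<in> pverts (demicube_graph n)"
    using assms by (simp_all add: pverts_demicube_graph_eq_set)
  then have "mismatches v w = card {i. i < n \<and> v ! i \<noteq> w ! i}"
    by (auto simp: mismatches_def length_filter_conv_card pverts_demicube_graph intro!: arg_cong[of _ _ card])
  then show ?thesis using V by (simp add: adj_demicube_graph disagreements_eq_card)
qed

definition demicube_4_of_nat :: "nat \<Rightarrow> bool list" where
  "demicube_4_of_nat i = map (\<lambda>b. b = even i)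
     ([[True, True, True, True], [True, True, False, False], [True, False, True, False],
       [True, False, False, True]] ! (i div 2))"

lemma demicube_4_check:
  "distinct (map demicube_4_of_nat [0..<8])"
  "set (map demicube_4_of_nat [0..<8]) = set (demicube_list 4)"
  "list_all (\<lambda>i. list_all (\<lambda>j. (i div 2 \<noteq> j div 2) =
      (mismatches (demicube_4_of_nat i) (demicube_4_of_nat j) = 2)) [0..<8]) [0..<8]"
  by code_simp+

lemma demicube_4_iso:
  "iso_on (pverts (demicube_graph 4)) (adj (demicube_graph 4))
    (pverts (cocktail_party_graph 4)) (adj (cocktail_party_graph 4))"
proof (rule iso_on_sym)
  have V: "pverts (cocktail_party_graph 4) = set [0..<8]" by (auto simp: atLeast0LessThan)
  show "iso_on (pverts (cocktail_party_graph 4)) (adj (cocktail_party_graph 4))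
      (pverts (demicube_graph 4)) (adj (demicube_graph 4))"
    unfolding V pverts_demicube_graph_eq_set
  proof (rule iso_on_set_listI[OF demicube_4_check(1,2)])
    fix i j :: nat assume ij: "i \<in> set [0..<8]" "j \<in> set [0..<8]"
    then have "demicube_4_of_nat i \<in> set (demicube_list 4)" "demicube_4_of_nat j \<in> set (demicube_list 4)"
      unfolding demicube_4_check(2)[symmetric] by auto
    then show "adj (cocktail_party_graph 4) i j \<longleftrightarrow>
        adj (demicube_graph 4) (demicube_4_of_nat i) (demicube_4_of_nat j)"
      using ij demicube_4_check(3)
      by (simp add: adj_demicube_graph_iff_mismatches adj_cocktail_party_graph list_all_iff)
  qed
qed

fun schlaefli_to_demicube :: "cubic_line \<Rightarrow> bool list" where
  "schlaefli_to_demicube (LineA i) = map (\<lambda>j. j \<noteq> i) [0..<5]"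
| "schlaefli_to_demicube (LineB i) = replicate 5 False"
| "schlaefli_to_demicube (LineC S) = map (\<lambda>j. j \<in> S) [0..<5]"

definition schlaefli_nbhd_list :: "cubic_line list" where
  "schlaefli_nbhd_list = filter (skew_lines (LineA 5)) schlaefli_list"

lemma schlaefli_nbhd_check:
  "distinct (map schlaefli_to_demicube schlaefli_nbhd_list)"
  "set (map schlaefli_to_demicube schlaefli_nbhd_list) = set (demicube_list 5)"
  "list_all (\<lambda>x. list_all (\<lambda>y. skew_lines x y =
      (mismatches (schlaefli_to_demicube x) (schlaefli_to_demicube y) = 2)) schlaefli_nbhd_list)
    schlaefli_nbhd_list"
  by code_simp+

lemma schlaefli_graph_local_iso:
  shows "LineA 5 \<in> pverts schlaefli_graph"
    and "iso_on (pverts (demicube_graph 5)) (adj (demicube_graph 5))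
      (nbhd (adj schlaefli_graph) (LineA 5)) (adj schlaefli_graph)"
proof -
  let ?f = schlaefli_to_demicube
  show base: "LineA 5 \<in> pverts schlaefli_graph" by (simp add: pverts_schlaefli_graph)
  have N: "nbhd (adj schlaefli_graph) (LineA 5) = set schlaefli_nbhd_list"
    using base by (auto simp: adj_schlaefli_graph schlaefli_nbhd_list_def pverts_schlaefli)
  have "iso_on (set schlaefli_nbhd_list) (adj schlaefli_graph) (set (demicube_list 5)) (adj (demicube_graph 5))"
  proof (rule iso_on_set_listI[OF schlaefli_nbhd_check(1,2)])
    fix x y assume xy: "x \<in> set schlaefli_nbhd_list" "y \<in> set schlaefli_nbhd_list"
    then have "?f x \<in> set (demicube_list 5)" "?f y \<in> set (demicube_list 5)"
      unfolding schlaefli_nbhd_check(2)[symmetric] by auto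
    moreover have "x \<in> pverts schlaefli_graph" "y \<in> pverts schlaefli_graph"
      using xy unfolding N[symmetric] by (auto simp: adj_schlaefli_graph)
    moreover have "skew_lines x y \<longleftrightarrow> mismatches (?f x) (?f y) = 2"
      using schlaefli_nbhd_check(3) xy unfolding list_all_iff by blast
    ultimately show "adj schlaefli_graph x y \<longleftrightarrow> adj (demicube_graph 5) (?f x) (?f y)"
      by (simp add: adj_schlaefli_graph adj_demicube_graph_iff_mismatches)
  qed
  then show "iso_on (pverts (demicube_graph 5)) (adj (demicube_graph 5))
      (nbhd (adj schlaefli_graph) (LineA 5)) (adj schlaefli_graph)"
    unfolding N pverts_demicube_graph_eq_set by (rule iso_on_sym)
qed

subsection \<open>Classification of the minuscule graphs with constant \<open>c\<^sub>2\<close>\<close>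

lemma complete_on_if_iso:
  assumes "iso_on V A W B" "complete_on W B" shows "complete_on V A"
proof -
  obtain f where "bij_betw f V W" "\<And>x y. x \<in> V \<Longrightarrow> y \<in> V \<Longrightarrow> A x y \<longleftrightarrow> B (f x) (f y)"
    by (rule iso_onE[OF assms(1)]) blast
  then show ?thesis using assms(2) unfolding complete_on_def bij_betw_def inj_on_def by blast
qed

lemma complete_on_box_graph:
  assumes "length qs \<le> 1" shows "complete_on (pverts (box_graph qs)) (adj (box_graph qs))"
  unfolding complete_on_def
proof (intro ballI impI)
  interpret minuscule "pverts (box_graph qs)" "adj (box_graph qs)"
    "\<lambda>v w. real (disagreements (length qs) ((!) v) ((!) w))" by (rule minuscule_box_graph)
  fix v w assume vw: "v \<in> pverts (box_graph qs)" "w \<in> pverts (box_graph qs)" "v \<noteq> w"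
  have "disagreements (length qs) ((!) v) ((!) w) \<le> length qs"
    unfolding disagreements_def
    using sum_bounded_above[of "{..<length qs}" "\<lambda>i. of_bool (v ! i \<noteq> w ! i)" "1 :: nat"] by simp
  moreover have "disagreements (length qs) ((!) v) ((!) w) \<noteq> 0" using D_eq_0_iff[OF vw(1,2)] vw(3) by simp
  ultimately show "adj (box_graph qs) v w" using vw assms by (simp add: adj_box_graph)
qed

text \<open>The first argument is the constant value of \<open>c\<^sub>2\<close>.\<close>

inductive minuscule_type :: "nat \<Rightarrow> 'a set \<Rightarrow> ('a \<Rightarrow> 'a \<Rightarrow> bool) \<Rightarrow> bool" where
  box: "iso_on V A (pverts (box_graph qs)) (adj (box_graph qs)) \<Longrightarrow> 2 \<le> length qs \<Longrightarrow>
    \<forall>q\<in>set qs. 2 \<le> q \<Longrightarrow> minuscule_type 2 V A"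
| johnson: "iso_on V A (pverts (johnson_graph n k)) (adj (johnson_graph n k)) \<Longrightarrow> 2 \<le> k \<Longrightarrow> 2 * k \<le> n \<Longrightarrow>
    minuscule_type 4 V A"
| demicube: "iso_on V A (pverts (demicube_graph n)) (adj (demicube_graph n)) \<Longrightarrow> 4 \<le> n \<Longrightarrow>
    minuscule_type 6 V A"
| cocktail_party: "iso_on V A (pverts (cocktail_party_graph n)) (adj (cocktail_party_graph n)) \<Longrightarrow> 5 \<le> n \<Longrightarrow>
    minuscule_type (2 * n - 2) V A"
| schlaefli: "iso_on V A (pverts schlaefli_graph) (adj schlaefli_graph) \<Longrightarrow> minuscule_type 8 V A"
| gosset: "iso_on V A gosset_verts (adj gosset_graph) \<Longrightarrow> minuscule_type 10 V A"

locale locally_minuscule = minuscule V A D for V :: "'a set" and A and D +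
  fixes x :: 'a
  assumes x: "x \<in> V" and local: "minuscule (nbhd A x) (local_adj A x) D"
begin

abbreviation local_iso :: "'b pair_pre_digraph \<Rightarrow> bool" where
  "local_iso H \<equiv> iso_on (nbhd A x) (local_adj A x) (pverts H) (adj H)"

lemma D_le_2_if_local_iso:
  assumes "minuscule (pverts H) (adj H) E" "local_iso H" "u \<in> pverts H" "v \<in> pverts H"
  shows "E u v \<le> 2"
  using minuscule_axioms local assms by (rule D_le_2_if_iso_local)

lemma iso_if_local_iso:
  assumes "minuscule (pverts H) (adj H) E" "y \<in> pverts H" "local_iso K"
    and "iso_on (pverts K) (adj K) (nbhd (adj H) y) (adj H)"
  shows "iso_on V A (pverts H) (adj H)"
  using iso_on_if_local_iso[OF minuscule_axioms assms(1) x assms(2-4)] .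

lemma johnson_if_local_box:
  assumes local_box: "local_iso (box_graph qs)" and qs: "2 \<le> length qs" "\<forall>q\<in>set qs. 2 \<le> q"
  shows "minuscule_type 4 V A"
proof -
  let ?v = "\<lambda>c. replicate (length qs) (c :: nat)"
  have "?v c \<in> pverts (box_graph qs)" if "c < 2" for c
    using that qs(2) by (auto simp: pverts_box_graph intro: less_le_trans)
  moreover have "disagreements (length qs) ((!) (?v 0)) ((!) (?v 1)) = length qs"
    by (simp add: disagreements_def)
  ultimately have "length qs \<le> 2"
    using D_le_2_if_local_iso[OF minuscule_box_graph local_box, of "?v 0" "?v 1"] by simp
  then have "length qs = Suc (Suc 0)" using qs(1) by simp
  then obtain p q where pq: "qs = [p, q]" by (auto simp: length_Suc_conv)
  define k where "k = min p q"
  have "local_iso (box_graph [k, p + q - k])"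
    using local_box iso_on_trans[OF local_box[unfolded pq] box_graph_swap_iso] by (simp add: k_def pq min_def)
  moreover have k: "2 \<le> k" "2 * k \<le> p + q" using qs(2) by (auto simp: pq k_def)
  moreover have "{..<k} \<in> pverts (johnson_graph (p + q) k)" using k by (auto simp: pverts_johnson_graph)
  ultimately have "iso_on V A (pverts (johnson_graph (p + q) k)) (adj (johnson_graph (p + q) k))"
    using iso_if_local_iso[OF minuscule_johnson_graph _ _ johnson_graph_local_iso] by simp
  then show ?thesis using k by (rule minuscule_type.johnson)
qed

lemma demicube_if_local_johnson:
  assumes local_johnson: "local_iso (johnson_graph n k)" and k: "2 \<le> k" "2 * k \<le> n"
  shows "minuscule_type 6 V A"
proof -
  have "k = 2"
  proof (rule ccontr)
    assume "k \<noteq> 2"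
    then have k_ge_3: "3 \<le> k" using k by simp
    let ?S = "{..<k}" and ?T = "{3..<k+3}"
    have V: "?S \<in> pverts (johnson_graph n k)" "?T \<in> pverts (johnson_graph n k)"
      using k k_ge_3 by (auto simp: pverts_johnson_graph)
    have "?S \<inter> ?T = {3..<k}" by auto
    then have "disagreements n (\<lambda>i. i \<in> ?S) (\<lambda>i. i \<in> ?T) = 6"
      using johnson_graph_disagreements[OF V] k_ge_3 by simp
    then show False using D_le_2_if_local_iso[OF minuscule_johnson_graph local_johnson V] by simp
  qed
  then have "iso_on V A (pverts (demicube_graph n)) (adj (demicube_graph n))"
    using iso_if_local_iso[OF minuscule_demicube_graph demicube_graph_local_iso(1) _ demicube_graph_local_iso(2)]
      local_johnson by blast
  then show ?thesis using k by (intro minuscule_type.demicube) auto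
qed

lemma schlaefli_or_cocktail_party_if_local_demicube:
  assumes local_demicube: "local_iso (demicube_graph n)" and n: "4 \<le> n"
  shows "minuscule_type 8 V A"
proof -
  have "n \<le> 5"
  proof (rule ccontr)
    assume "\<not> n \<le> 5"
    define w where "w = map (\<lambda>i. i < (6::nat)) [0..<n]"
    have "{i. i < n \<and> replicate n False ! i \<noteq> w ! i} = {..<6}" using \<open>\<not> n \<le> 5\<close> by (auto simp: w_def)
    then have six: "disagreements n ((!) (replicate n False)) ((!) w) = 6" by (simp add: disagreements_eq_card)
    have V: "replicate n False \<in> pverts (demicube_graph n)" by (rule demicube_graph_local_iso(1))
    then have "w \<in> pverts (demicube_graph n)"
      using even_disagreements_iff[of n "(!) (replicate n False)" "(!) w"] six
      by (simp add: pverts_demicube_graph) (simp add: w_def)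
    then show False using D_le_2_if_local_iso[OF minuscule_demicube_graph local_demicube V] six by fastforce
  qed
  then consider (four) "n = 4" | (five) "n = 5" using n by linarith
  then show ?thesis
  proof cases
    case four
    have "local_iso (cocktail_party_graph 4)"
      using iso_on_trans[OF local_demicube[unfolded four] demicube_4_iso] .
    then have "iso_on V A (pverts (cocktail_party_graph (Suc 4))) (adj (cocktail_party_graph (Suc 4)))"
      using iso_if_local_iso[OF minuscule_cocktail_party_graph _ _ cocktail_party_graph_local_iso[of 4]] by simp
    then show ?thesis using minuscule_type.cocktail_party[of V A 5] by simp
  next
    case five
    have "iso_on V A (pverts schlaefli_graph) (adj schlaefli_graph)"
      using minuscule_schlaefli_graph schlaefli_graph_local_iso(1) local_demicube[unfolded five]
        schlaefli_graph_local_iso(2) by (rule iso_if_local_iso)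
    then show ?thesis by (rule minuscule_type.schlaefli)
  qed
qed

lemma cocktail_party_if_local_cocktail_party:
  assumes "local_iso (cocktail_party_graph n)" "5 \<le> n"
  shows "minuscule_type (2 * n) V A"
proof -
  have "iso_on V A (pverts (cocktail_party_graph (Suc n))) (adj (cocktail_party_graph (Suc n)))"
    using iso_if_local_iso[OF minuscule_cocktail_party_graph _ _ cocktail_party_graph_local_iso[of n]] assms
    by simp
  then show ?thesis using minuscule_type.cocktail_party[of V A "Suc n"] assms(2) by simp
qed

lemma gosset_if_local_schlaefli:
  assumes "local_iso schlaefli_graph" shows "minuscule_type 10 V A"
  using iso_if_local_iso[OF minuscule_gosset_graph gosset_base_in_verts assms gosset_graph_local_iso]
  by (rule minuscule_type.gosset)

lemma not_local_gosset: "\<not> local_iso gosset_graph"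
proof
  assume gosset: "local_iso gosset_graph"
  have V: "(True, {0, 1}) \<in> gosset_verts" "(False, {0, 1}) \<in> gosset_verts" by (simp_all add: mem_gosset)
  have "gosset_dist (True, {0, 1}) (False, {0, 1}) \<le> 2"
    using D_le_2_if_local_iso[OF minuscule_gosset_graph gosset V] by simp
  then show False by simp
qed

lemma minuscule_type_if_local:
  assumes "minuscule_type m (nbhd A x) (local_adj A x)" shows "minuscule_type (m + 2) V A"
  using assms
proof cases
  case (box qs)
  then show ?thesis using johnson_if_local_box by simp
next
  case (johnson n k)
  then show ?thesis using demicube_if_local_johnson by simp
next
  case (demicube n)
  then show ?thesis using schlaefli_or_cocktail_party_if_local_demicube by simp
next
  case (cocktail_party n)
  then have "m + 2 = 2 * n" by simp
  with cocktail_party show ?thesis using cocktail_party_if_local_cocktail_party[of n] by metis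
next
  case schlaefli
  then show ?thesis using gosset_if_local_schlaefli by simp
next
  case gosset
  then show ?thesis using not_local_gosset by simp
qed

end

theorem minuscule_classification:
  assumes "minuscule V A D" "\<not> complete_on V A" "constant_mu A m"
  shows "minuscule_type m V A"
  using assms
proof (induction m arbitrary: V A rule: less_induct)
  case (less m)
  interpret minuscule V A D by (rule less.prems(1))
  obtain x where x: "x \<in> V" using less.prems(2) unfolding complete_on_def by blast
  consider (base) "m = 2" | (step) "m \<ge> 3" using constant_mu_ge_2[OF less.prems(2,3)] by linarith
  then show ?case
  proof cases
    case base
    obtain qs where qs: "\<forall>q\<in>set qs. \<exists>y\<in>nbhd A x. q = card (nbhd A x \<inter> nbhd A y) + 2"
      and iso: "iso_on V A (pverts (box_graph qs)) (adj (box_graph qs))"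
      using box_graph_recognition[OF less.prems(1) x] local_adj_transitive less.prems(3) base by blast
    have "2 \<le> length qs"
      using complete_on_if_iso[OF iso] complete_on_box_graph[of qs] less.prems(2) by linarith
    moreover have "\<forall>q\<in>set qs. 2 \<le> q" using qs by auto
    ultimately show ?thesis unfolding base using iso by (intro minuscule_type.box)
  next
    case step
    interpret locally_minuscule V A D x
      by (intro locally_minuscule.intro locally_minuscule_axioms.intro minuscule_axioms x
          minuscule_local[OF less.prems(3) step x])
    have "minuscule_type (m - 2) (nbhd A x) (local_adj A x)"
      using less.IH[OF _ local local_not_complete[OF less.prems(2) x] local_constant_mu[OF less.prems(3)]] step
      by simp
    then have "minuscule_type (m - 2 + 2) V A" by (rule minuscule_type_if_local)
    moreover have "m - 2 + 2 = m" using step by simp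
    ultimately show ?thesis by (simp only:)
  qed
qed

subsection \<open>Eigenvalues of finite matrices\<close>

definition eigenfunction_on :: "'a set \<Rightarrow> ('a \<Rightarrow> 'a \<Rightarrow> 'k :: field) \<Rightarrow> 'k \<Rightarrow> ('a \<Rightarrow> 'k) \<Rightarrow> bool" where
  "eigenfunction_on V M l f \<longleftrightarrow> (\<exists>x\<in>V. f x \<noteq> 0) \<and> (\<forall>x\<in>V. (\<Sum>y\<in>V. M x y * f y) = l * f x)"

lemma matrix_eigenvalue_on_iff: "matrix_eigenvalue_on V M l \<longleftrightarrow> (\<exists>f. eigenfunction_on V M l f)"
  unfolding matrix_eigenvalue_on_def eigenfunction_on_def ..

lemma eigenvector_enumeration_iff:
  assumes h: "bij_betw h {0..<n} V"
  shows "eigenvector (mat n n (\<lambda>(i, j). M (h i) (h j))) (vec n (\<lambda>i. f (h i))) l \<longleftrightarrow> eigenfunction_on V M l f"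
proof -
  let ?B = "mat n n (\<lambda>(i, j). M (h i) (h j))" and ?v = "vec n (\<lambda>i. f (h i))"
  have V: "(\<forall>x\<in>V. P x) \<longleftrightarrow> (\<forall>i<n. P (h i))" for P
    using bij_betw_imp_surj_on[OF h] by auto
  have "?v = 0\<^sub>v n \<longleftrightarrow> (\<forall>x\<in>V. f x = 0)" unfolding V by (auto simp: vec_eq_iff)
  moreover have "?B *\<^sub>v ?v = l \<cdot>\<^sub>v ?v \<longleftrightarrow> (\<forall>x\<in>V. (\<Sum>y\<in>V. M x y * f y) = l * f x)"
    unfolding V sum.reindex_bij_betw[OF h, symmetric] by (auto simp: vec_eq_iff scalar_prod_def)
  ultimately show ?thesis by (auto simp: eigenvector_def eigenfunction_on_def)
qed

lemma finite_matrix_eigenvalues: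
  assumes "finite V" shows "finite {l. matrix_eigenvalue_on V M l}"
proof -
  define n where "n = card V"
  obtain h where h: "bij_betw h {0..<n} V" using ex_bij_betw_nat_finite[OF assms] n_def by blast
  let ?B = "mat n n (\<lambda>(i, j). M (h i) (h j))"
  have "{l. matrix_eigenvalue_on V M l} \<subseteq> spectrum ?B"
    unfolding spectrum_def eigenvalue_def matrix_eigenvalue_on_iff
    using eigenvector_enumeration_iff[OF h] by blast
  then show ?thesis using card_finite_spectrum(1)[of ?B n] finite_subset by auto
qed

lemma ex_complex_eigenfunction:
  fixes M :: "'a \<Rightarrow> 'a \<Rightarrow> complex"
  assumes "finite V" "V \<noteq> {}" obtains l f where "eigenfunction_on V M l f"
proof -
  define n where "n = card V"
  obtain h where h: "bij_betw h {0..<n} V" using ex_bij_betw_nat_finite[OF assms(1)] n_def by blast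
  let ?B = "mat n n (\<lambda>(i, j). M (h i) (h j))"
  have "n > 0" using assms by (simp add: n_def card_gt_0_iff)
  then obtain l v where v: "eigenvector ?B v l"
    using spectrum_non_empty[of ?B n] unfolding spectrum_def eigenvalue_def by auto
  define f where "f x = v $ the_inv_into {0..<n} h x" for x
  have "dim_vec v = n" using v by (simp add: eigenvector_def)
  then have "vec n (\<lambda>i. f (h i)) = v"
    using bij_betw_imp_inj_on[OF h] by (intro eq_vecI) (simp_all add: f_def the_inv_into_f_f)
  then have "eigenfunction_on V M l f" using v eigenvector_enumeration_iff[OF h, of M f l] by simp
  then show ?thesis by (rule that)
qed

lemma sum_matrix_mult_eq_0:
  fixes M :: "'a \<Rightarrow> 'a \<Rightarrow> 'k :: comm_ring"
  assumes "\<And>y. y \<in> V \<Longrightarrow> (\<Sum>x\<in>V. M x y) = s" "(\<Sum>x\<in>V. f x) = 0"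
  shows "(\<Sum>x\<in>V. \<Sum>y\<in>V. M x y * f y) = 0"
proof -
  have "(\<Sum>x\<in>V. \<Sum>y\<in>V. M x y * f y) = (\<Sum>y\<in>V. s * f y)"
    by (subst sum.swap, rule sum.cong) (simp_all add: sum_distrib_right[symmetric] assms(1))
  then show ?thesis using assms(2) by (simp add: sum_distrib_left[symmetric])
qed

text \<open>
  On the functions with sum zero the matrix acts through the coordinates of all vertices but one.
\<close>

lemma ex_complex_eigenfunction_sum_zero:
  fixes M :: "'a \<Rightarrow> 'a \<Rightarrow> complex"
  assumes V: "finite V" "card V \<ge> 2" and col: "\<And>y. y \<in> V \<Longrightarrow> (\<Sum>x\<in>V. M x y) = s"
  obtains l f where "eigenfunction_on V M l f" "(\<Sum>x\<in>V. f x) = 0"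
proof -
  obtain z where z: "z \<in> V" using V by fastforce
  define U where "U = V - {z}"
  have U: "finite U" "U \<noteq> {}" "z \<notin> U" "V = insert z U"
    using V z card_mono[of "{z}" V] by (auto simp: U_def)
  obtain l g where g: "eigenfunction_on U (\<lambda>x y. M x y - M x z) l g"
    by (rule ex_complex_eigenfunction[OF U(1,2)])
  define f where "f x = (if x = z then - (\<Sum>y\<in>U. g y) else g x)" for x
  have f_U: "(\<Sum>y\<in>U. c y * f y) = (\<Sum>y\<in>U. c y * g y)" for c
    using U(3) by (intro sum.cong) (auto simp: f_def)
  have sum_0: "(\<Sum>x\<in>V. f x) = 0" using U f_U[of "\<lambda>_. 1"] by (simp add: f_def)
  have row: "(\<Sum>y\<in>V. M x y * f y) = l * f x" if "x \<in> U" for x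
  proof -
    have "(\<Sum>y\<in>V. M x y * f y) = (\<Sum>y\<in>U. M x y * g y) - M x z * (\<Sum>y\<in>U. g y)"
      using U f_U[of "M x"] by (simp add: f_def)
    also have "\<dots> = (\<Sum>y\<in>U. (M x y - M x z) * g y)"
      by (simp add: left_diff_distrib sum_subtractf sum_distrib_left)
    also have "\<dots> = l * f x" using g that U(3) by (auto simp: eigenfunction_on_def f_def)
    finally show ?thesis .
  qed
  have "(\<Sum>y\<in>V. M z y * f y) = l * f z"
  proof -
    define r where "r x = (\<Sum>y\<in>V. M x y * f y)" for x
    have "(\<Sum>x\<in>V. r x) = 0" unfolding r_def using col sum_0 by (rule sum_matrix_mult_eq_0)
    then have "r z + (\<Sum>x\<in>U. r x) = 0" using U by simp
    then have "(\<Sum>y\<in>V. M z y * f y) = - (\<Sum>x\<in>U. l * f x)"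
      using row by (simp add: r_def eq_neg_iff_add_eq_0)
    also have "\<dots> = l * f z" using f_U[of "\<lambda>_. l"] by (simp add: f_def sum_distrib_left)
    finally show ?thesis .
  qed
  moreover have "\<exists>x\<in>V. f x \<noteq> 0" using g U(3,4) by (auto simp: eigenfunction_on_def f_def)
  ultimately have "eigenfunction_on V M l f" using row U(4) by (simp add: eigenfunction_on_def)
  then show ?thesis using sum_0 by (rule that)
qed

lemma symmetric_eigenvalue_real:
  fixes M :: "'a \<Rightarrow> 'a \<Rightarrow> real"
  assumes V: "finite V" and sym: "\<And>x y. x \<in> V \<Longrightarrow> y \<in> V \<Longrightarrow> M x y = M y x"
    and f: "eigenfunction_on V (\<lambda>x y. complex_of_real (M x y)) l f"
  shows "l = complex_of_real (Re l)"
proof -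
  define q where "q = (\<Sum>x\<in>V. \<Sum>y\<in>V. cnj (f x) * (complex_of_real (M x y) * f y))"
  define r where "r = (\<Sum>x\<in>V. (cmod (f x))\<^sup>2)"
  have "q = (\<Sum>x\<in>V. cnj (f x) * (l * f x))"
    unfolding q_def using f by (simp add: sum_distrib_left[symmetric] eigenfunction_on_def)
  also have "\<dots> = (\<Sum>x\<in>V. l * complex_of_real ((cmod (f x))\<^sup>2))"
    by (rule sum.cong) (simp_all only: complex_norm_square, simp_all add: algebra_simps)
  finally have q: "q = l * complex_of_real r" by (simp add: r_def sum_distrib_left)
  have "cnj q = (\<Sum>x\<in>V. \<Sum>y\<in>V. cnj (f y) * (complex_of_real (M x y) * f x))"
    unfolding q_def by (simp add: algebra_simps)
  also have "\<dots> = (\<Sum>y\<in>V. \<Sum>x\<in>V. cnj (f y) * (complex_of_real (M x y) * f x))" by (rule sum.swap)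
  also have "\<dots> = q" unfolding q_def using sym by (intro sum.cong refl) simp
  finally have "cnj q = q" .
  moreover have "r > 0"
  proof -
    obtain x where x: "x \<in> V" "f x \<noteq> 0" using f by (auto simp: eigenfunction_on_def)
    have "(cmod (f x))\<^sup>2 \<le> r" unfolding r_def by (rule member_le_sum) (use x V in auto)
    moreover have "(cmod (f x))\<^sup>2 > 0" using x by simp
    ultimately show ?thesis by linarith
  qed
  ultimately have "cnj l = l" using q by simp
  then show ?thesis by (simp add: complex_eq_iff)
qed

lemma ex_eigenfunction_sum_zero:
  fixes M :: "'a \<Rightarrow> 'a \<Rightarrow> real"
  assumes V: "finite V" "card V \<ge> 2" and col: "\<And>y. y \<in> V \<Longrightarrow> (\<Sum>x\<in>V. M x y) = s"
    and sym: "\<And>x y. x \<in> V \<Longrightarrow> y \<in> V \<Longrightarrow> M x y = M y x"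
  obtains l f where "eigenfunction_on V M l f" "(\<Sum>x\<in>V. f x) = 0"
proof -
  have "(\<Sum>x\<in>V. complex_of_real (M x y)) = complex_of_real s" if "y \<in> V" for y
    using col[OF that] by (metis of_real_sum)
  then obtain l g where g: "eigenfunction_on V (\<lambda>x y. complex_of_real (M x y)) l g" "(\<Sum>x\<in>V. g x) = 0"
    by (rule ex_complex_eigenfunction_sum_zero[OF V])
  have l: "l = complex_of_real (Re l)" by (rule symmetric_eigenvalue_real[OF V(1) sym g(1)])
  have row: "(\<Sum>y\<in>V. complex_of_real (M x y) * g y) = l * g x" if "x \<in> V" for x
    using g(1) that by (simp add: eigenfunction_on_def)
  have Re: "(\<Sum>y\<in>V. M x y * Re (g y)) = Re l * Re (g x)"
    and Im: "(\<Sum>y\<in>V. M x y * Im (g y)) = Re l * Im (g x)" if "x \<in> V" for x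
    using arg_cong[OF row[OF that], of Re] arg_cong[OF row[OF that], of Im] l
    by (simp_all add: complex_eq_iff)
  have sums: "(\<Sum>x\<in>V. Re (g x)) = 0" "(\<Sum>x\<in>V. Im (g x)) = 0"
    using g(2) by (simp_all add: complex_eq_iff Re_sum Im_sum)
  obtain x where "x \<in> V" "Re (g x) \<noteq> 0 \<or> Im (g x) \<noteq> 0"
    using g(1) by (auto simp: eigenfunction_on_def complex_eq_iff)
  then have "eigenfunction_on V M (Re l) (\<lambda>x. Re (g x)) \<or> eigenfunction_on V M (Re l) (\<lambda>x. Im (g x))"
    using Re Im by (auto simp: eigenfunction_on_def)
  with sums that show ?thesis by blast
qed

subsection \<open>Transport on connected graphs\<close>

locale connected_graph = pair_graph G for G :: "'a pair_pre_digraph" +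
  assumes connected: "Digraph_Component.connected (with_proj G)"
begin

abbreviation "V \<equiv> pverts G"
abbreviation "A \<equiv> adj G"

lemma adj_commute: "A x y \<Longrightarrow> A y x"
  using pair_sym_arcs unfolding Digraph.symmetric_def by (auto dest: symD)

lemma rtranclp_adj:
  assumes "x \<in> V" "y \<in> V" shows "A\<^sup>*\<^sup>* x y"
proof -
  have "mk_symmetric (with_proj G) = G"
  proof -
    have "(\<Union>e\<in>parcs G. {e, (snd e, fst e)}) = parcs G" using adj_commute by auto
    then show ?thesis by (intro pair_pre_digraph.equality) (simp_all add: mk_symmetric_def)
  qed
  then have "x \<rightarrow>\<^sup>*\<^bsub>with_proj G\<^esub> y"
    using connected assms unfolding Digraph_Component.connected_def strongly_connected_def by simp
  then show ?thesis
    by (induction rule: reachable_induct) (auto intro: rtranclp.rtrancl_into_rtrancl)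
qed

sublocale connected_simple_graph V A
proof
  show "\<not> A x x" for x using no_loops' by blast
qed (use pair_finite_verts rtranclp_adj adj_commute in \<open>auto dest: in_arcsD1\<close>)

lemma V_nonempty: "V \<noteq> {}"
  using connected unfolding Digraph_Component.connected_def strongly_connected_def by simp

lemma neighbours_eq: "neighbours G x = nbhd A x" by (simp add: neighbours_def nbhd_def)

lemma deg_eq: "deg G x = card (nbhd A x)" by (simp add: deg_def neighbours_eq)

lemma gdist_eq_walk_dist:
  assumes "x \<in> V" "y \<in> V" shows "gdist G x y = walk_dist A x y"
proof (rule gdist_eqI(1)[OF pair_graph_axioms _ _ _ _ assms])
  show "\<exists>z. A z y \<and> walk_dist A x z = n"
    if "x \<in> V" "y \<in> V" "walk_dist A x y = Suc n" for x y n
    using walk_dist_Suc_right[OF that] by blast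
qed (simp_all add: walk_dist_eq_0_iff walk_dist_step_right)

definition transport_cost :: "('a \<Rightarrow> 'a \<Rightarrow> real) \<Rightarrow> real" where
  "transport_cost \<pi> = (\<Sum>x\<in>V. \<Sum>y\<in>V. real (walk_dist A x y) * \<pi> x y)"

lemma wasserstein_eq: "wasserstein G m1 m2 = (INF \<pi>\<in>{\<pi>. coupling G m1 m2 \<pi>}. transport_cost \<pi>)"
  unfolding wasserstein_def transport_cost_def by (simp add: gdist_eq_walk_dist)

lemma coupling_nonneg: "coupling G m1 m2 \<pi> \<Longrightarrow> x \<in> V \<Longrightarrow> y \<in> V \<Longrightarrow> 0 \<le> \<pi> x y"
  unfolding coupling_def by blast

lemma transport_cost_nonneg: "coupling G m1 m2 \<pi> \<Longrightarrow> 0 \<le> transport_cost \<pi>"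
  unfolding transport_cost_def by (intro sum_nonneg mult_nonneg_nonneg) (auto simp: coupling_nonneg)

lemma wasserstein_le: "coupling G m1 m2 \<pi> \<Longrightarrow> wasserstein G m1 m2 \<le> transport_cost \<pi>"
  unfolding wasserstein_eq by (rule cINF_lower) (auto intro!: bdd_belowI2[of _ 0] transport_cost_nonneg)

lemma wasserstein_ge:
  assumes "\<exists>\<pi>. coupling G m1 m2 \<pi>" "\<And>\<pi>. coupling G m1 m2 \<pi> \<Longrightarrow> c \<le> transport_cost \<pi>"
  shows "c \<le> wasserstein G m1 m2"
  unfolding wasserstein_eq by (rule cINF_greatest) (use assms in auto)

lemma couplingI:
  assumes nonneg: "\<And>x y. x \<in> V \<Longrightarrow> y \<in> V \<Longrightarrow> 0 \<le> \<pi> x y"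
    and rows: "\<And>x. x \<in> V \<Longrightarrow> (\<Sum>y\<in>V. \<pi> x y) = m1 x" and cols: "\<And>y. y \<in> V \<Longrightarrow> (\<Sum>x\<in>V. \<pi> x y) = m2 y"
    and mass: "(\<Sum>x\<in>V. m1 x) = 1"
  shows "coupling G m1 m2 \<pi>"
proof -
  have "\<pi> x y \<le> 1" if "x \<in> V" "y \<in> V" for x y
  proof -
    have "\<pi> x y \<le> (\<Sum>y\<in>V. \<pi> x y)" by (rule member_le_sum) (use that nonneg finite_V in auto)
    also have "\<dots> \<le> (\<Sum>x\<in>V. \<Sum>y\<in>V. \<pi> x y)"
      by (rule member_le_sum) (use that nonneg finite_V in \<open>auto intro: sum_nonneg\<close>)
    finally show ?thesis using rows mass by simp
  qed
  then show ?thesis unfolding coupling_def using nonneg rows cols by blast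
qed

lemma ex_coupling:
  assumes "\<And>x. x \<in> V \<Longrightarrow> 0 \<le> m1 x" "\<And>x. x \<in> V \<Longrightarrow> 0 \<le> m2 x" "(\<Sum>x\<in>V. m1 x) = 1" "(\<Sum>x\<in>V. m2 x) = 1"
  shows "\<exists>\<pi>. coupling G m1 m2 \<pi>"
proof
  show "coupling G m1 m2 (\<lambda>x y. m1 x * m2 y)"
    by (rule couplingI) (use assms in \<open>simp_all add: sum_distrib_left[symmetric] sum_distrib_right[symmetric]\<close>)
qed

lemma coupling_convex:
  assumes \<pi>: "coupling G m1 m2 \<pi>" and \<rho>: "coupling G m1' m2' \<rho>" and t: "0 \<le> t" "t \<le> 1"
  shows "coupling G (\<lambda>x. t * m1 x + (1 - t) * m1' x) (\<lambda>y. t * m2 y + (1 - t) * m2' y)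
    (\<lambda>x y. t * \<pi> x y + (1 - t) * \<rho> x y)"
proof -
  have "t * p + (1 - t) * q \<le> 1" if "p \<le> 1" "q \<le> 1" for p q
    using that t by (intro convex_bound_le) auto
  then show ?thesis
    using \<pi> \<rho> t unfolding coupling_def by (simp add: sum.distrib sum_distrib_left[symmetric])
qed

lemma wasserstein_convex:
  assumes ex: "\<exists>\<pi>. coupling G m1 m2 \<pi>" and \<rho>: "coupling G m1' m2' \<rho>" and t: "0 < t" "t \<le> 1"
  shows "wasserstein G (\<lambda>x. t * m1 x + (1 - t) * m1' x) (\<lambda>y. t * m2 y + (1 - t) * m2' y) \<le>
    t * wasserstein G m1 m2 + (1 - t) * transport_cost \<rho>"
proof -
  let ?W = "wasserstein G (\<lambda>x. t * m1 x + (1 - t) * m1' x) (\<lambda>y. t * m2 y + (1 - t) * m2' y)"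
  have "(?W - (1 - t) * transport_cost \<rho>) / t \<le> wasserstein G m1 m2"
  proof (rule wasserstein_ge[OF ex])
    fix \<pi> assume \<pi>: "coupling G m1 m2 \<pi>"
    have "?W \<le> transport_cost (\<lambda>x y. t * \<pi> x y + (1 - t) * \<rho> x y)"
      using t by (intro wasserstein_le coupling_convex \<pi> \<rho>) auto
    also have "\<dots> = t * transport_cost \<pi> + (1 - t) * transport_cost \<rho>"
      unfolding transport_cost_def sum_distrib_left sum.distrib[symmetric]
      by (intro sum.cong refl) (simp add: algebra_simps)
    finally show "(?W - (1 - t) * transport_cost \<rho>) / t \<le> transport_cost \<pi>"
      using t by (simp add: field_simps)
  qed
  then show ?thesis using t by (simp add: field_simps)
qed

lemma coupling_potential:
  assumes "coupling G m1 m2 \<pi>"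
  shows "(\<Sum>x\<in>V. \<Sum>y\<in>V. \<pi> x y * (f x - f y)) = (\<Sum>x\<in>V. m1 x * f x) - (\<Sum>y\<in>V. m2 y * f y)"
proof -
  have "(\<Sum>x\<in>V. \<Sum>y\<in>V. \<pi> x y * f x) = (\<Sum>x\<in>V. m1 x * f x)"
    using assms unfolding coupling_def by (simp add: sum_distrib_right[symmetric])
  moreover have "(\<Sum>x\<in>V. \<Sum>y\<in>V. \<pi> x y * f y) = (\<Sum>y\<in>V. m2 y * f y)"
    using assms unfolding coupling_def by (subst sum.swap) (simp add: sum_distrib_right[symmetric])
  ultimately show ?thesis by (simp add: right_diff_distrib sum_subtractf)
qed

lemma wasserstein_ge_potential_slack:
  fixes f :: "'a \<Rightarrow> real"
  assumes ex: "\<exists>\<pi>. coupling G m1 m2 \<pi>" and L: "L > 0" "\<And>x y. A x y \<Longrightarrow> f x - f y \<le> L"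
    and z: "z \<in> V" and slack: "\<And>w. w \<in> V \<Longrightarrow> m2 w \<noteq> 0 \<Longrightarrow> \<delta> \<le> L * walk_dist A z w - (f z - f w)"
  shows "(\<Sum>x\<in>V. m1 x * f x) - (\<Sum>y\<in>V. m2 y * f y) + m1 z * \<delta> \<le> L * wasserstein G m1 m2"
proof -
  define gap where "gap x y = L * walk_dist A x y - (f x - f y)" for x y
  let ?diff = "(\<Sum>x\<in>V. m1 x * f x) - (\<Sum>y\<in>V. m2 y * f y)"
  have "(?diff + m1 z * \<delta>) / L \<le> wasserstein G m1 m2"
  proof (rule wasserstein_ge[OF ex])
    fix \<pi> assume \<pi>: "coupling G m1 m2 \<pi>"
    have \<pi>_gap: "0 \<le> \<pi> x y * gap x y" if "x \<in> V" "y \<in> V" for x y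
      using diff_le_walk_dist[of f L, OF L(2) that] coupling_nonneg[OF \<pi> that] by (simp add: gap_def)
    have \<pi>_z: "\<pi> z w * \<delta> \<le> \<pi> z w * gap z w" if w: "w \<in> V" for w
    proof (cases "m2 w = 0")
      case True
      then have "(\<Sum>x\<in>V. \<pi> x w) = 0" using \<pi> w unfolding coupling_def by simp
      then have "\<pi> z w = 0" using coupling_nonneg[OF \<pi> _ w] finite_V z by (simp add: sum_nonneg_eq_0_iff)
      then show ?thesis by simp
    next
      case False
      then show ?thesis unfolding gap_def by (intro mult_left_mono slack w coupling_nonneg[OF \<pi> z])
    qed
    have "m1 z * \<delta> = (\<Sum>w\<in>V. \<pi> z w * \<delta>)"
      using \<pi> z unfolding coupling_def by (simp add: sum_distrib_right[symmetric])
    also have "\<dots> \<le> (\<Sum>w\<in>V. \<pi> z w * gap z w)" by (intro sum_mono \<pi>_z)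
    also have "\<dots> \<le> (\<Sum>x\<in>V. \<Sum>w\<in>V. \<pi> x w * gap x w)"
      by (rule member_le_sum[OF z, of "\<lambda>x. \<Sum>w\<in>V. \<pi> x w * gap x w"])
        (use \<pi>_gap finite_V in \<open>auto intro!: sum_nonneg\<close>)
    also have "\<dots> = L * transport_cost \<pi> - ?diff"
      unfolding coupling_potential[OF \<pi>, symmetric] transport_cost_def gap_def
      by (simp add: algebra_simps sum_distrib_left sum.distrib[symmetric] sum_subtractf[symmetric])
    finally show "(?diff + m1 z * \<delta>) / L \<le> transport_cost \<pi>" using L(1) by (simp add: field_simps)
  qed
  then show ?thesis using L(1) by (simp add: field_simps)
qed

lemma wasserstein_ge_potential:
  fixes f :: "'a \<Rightarrow> real"
  assumes "\<exists>\<pi>. coupling G m1 m2 \<pi>" and L: "L > 0" "\<And>x y. A x y \<Longrightarrow> f x - f y \<le> L"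
  shows "(\<Sum>x\<in>V. m1 x * f x) - (\<Sum>y\<in>V. m2 y * f y) \<le> L * wasserstein G m1 m2"
proof -
  obtain z where z: "z \<in> V" using V_nonempty by blast
  have "0 \<le> L * walk_dist A z w - (f z - f w)" if "w \<in> V" for w
    using diff_le_walk_dist[of f L, OF L(2) z that] by simp
  then show ?thesis using wasserstein_ge_potential_slack[where \<delta> = 0 and f = f, OF assms(1) L z] by simp
qed

end

subsection \<open>Monotone limits\<close>

lemma tendsto_at_left_Sup:
  fixes F :: "real \<Rightarrow> real"
  assumes "a < b" and mono: "mono_on {a..<b} F" and bdd: "bdd_above (F ` {a..<b})"
  shows "(F \<longlongrightarrow> Sup (F ` {a..<b})) (at_left b)"
proof (rule tendstoI)
  let ?s = "Sup (F ` {a..<b})"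
  fix e :: real assume e: "0 < e"
  have "F ` {a..<b} \<noteq> {}" using \<open>a < b\<close> by auto
  then obtain p where p: "a \<le> p" "p < b" "?s - e < F p"
    using e less_cSup_iff[OF _ bdd, of "?s - e"] by auto
  have "dist (F q) ?s < e" if "p < q" "q < b" for q
  proof -
    have "F p \<le> F q" using p that by (intro mono_onD[OF mono]) auto
    moreover have "F q \<le> ?s" by (rule cSup_upper[OF _ bdd]) (use p that in auto)
    ultimately show ?thesis using p by (simp add: dist_real_def)
  qed
  then show "\<forall>\<^sub>F q in at_left b. dist (F q) ?s < e"
    unfolding eventually_at_left_field using p by blast
qed

subsection \<open>The adjacency spectrum of a regular graph\<close>

locale regular_graph = connected_graph +
  fixes k :: nat
  assumes regular: "x \<in> pverts G \<Longrightarrow> card (nbhd (adj G) x) = k" and k_pos: "k > 0"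
begin

lemma ex_edge: "\<exists>x y. A x y"
proof -
  obtain x where x: "x \<in> V" using V_nonempty by blast
  then have "nbhd A x \<noteq> {}" using regular k_pos by (metis card.empty less_numeral_extra(3))
  then show ?thesis by (auto simp: nbhd_def)
qed

lemma sum_adjacency: "(\<Sum>y\<in>V. adjacency G x y * f y) = (\<Sum>y\<in>nbhd A x. f y)"
proof -
  have "(\<Sum>y\<in>V. adjacency G x y * f y) = (\<Sum>y\<in>V. if y \<in> nbhd A x then f y else 0)"
    by (rule sum.cong) (auto simp: adjacency_def)
  also have "\<dots> = (\<Sum>y\<in>V \<inter> nbhd A x. f y)" by (rule sum.inter_restrict[OF finite_V, symmetric])
  finally show ?thesis using nbhd_subset[of x] by (simp add: Int_absorb1)
qed

definition adjacency_eigenfunction :: "real \<Rightarrow> ('a \<Rightarrow> real) \<Rightarrow> bool" where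
  "adjacency_eigenfunction \<theta> f \<longleftrightarrow> (\<forall>x\<in>V. (\<Sum>y\<in>nbhd A x. f y) = \<theta> * f x)"

lemma adjacency_eigenfunctionD:
  "adjacency_eigenfunction \<theta> f \<Longrightarrow> x \<in> V \<Longrightarrow> (\<Sum>y\<in>nbhd A x. f y) = \<theta> * f x"
  unfolding adjacency_eigenfunction_def by blast

lemma adjacency_eigenfunction_diff:
  "adjacency_eigenfunction \<theta> f \<Longrightarrow> adjacency_eigenfunction \<theta> g \<Longrightarrow> adjacency_eigenfunction \<theta> (\<lambda>x. f x - g x)"
  unfolding adjacency_eigenfunction_def by (simp add: sum_subtractf right_diff_distrib)

lemma adjacency_eigenfunction_const: "adjacency_eigenfunction k (\<lambda>_. c)"
  unfolding adjacency_eigenfunction_def by (simp add: regular)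

lemma sum_normalized_laplacian:
  assumes x: "x \<in> V"
  shows "(\<Sum>y\<in>V. normalized_laplacian G x y * f y) = f x - (\<Sum>y\<in>nbhd A x. f y) / k"
proof -
  have powr: "real k powr (-1/2) * real k powr (-1/2) = 1 / k"
    using k_pos by (simp add: powr_add[symmetric] powr_minus_divide)
  have "(\<Sum>y\<in>V. normalized_laplacian G x y * f y) =
      (\<Sum>y\<in>V. (if x = y then f y else 0) - 1 / k * (adjacency G x y * f y))"
  proof (rule sum.cong)
    fix y assume y: "y \<in> V"
    have "real k powr (-1/2) * adjacency G x y * real k powr (-1/2) = 1 / k * adjacency G x y"
      using powr by (metis mult.assoc mult.commute)
    then show "normalized_laplacian G x y * f y = (if x = y then f y else 0) - 1 / k * (adjacency G x y * f y)"
      using regular x y by (simp add: normalized_laplacian_def deg_eq left_diff_distrib)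
  qed simp
  also have "\<dots> = f x - 1 / k * (\<Sum>y\<in>V. adjacency G x y * f y)"
    using finite_V x by (simp add: sum_subtractf sum_distrib_left)
  finally show ?thesis by (simp add: sum_adjacency)
qed

lemma laplacian_eigenvalue_iff:
  fixes l :: real
  shows "matrix_eigenvalue_on V (normalized_laplacian G) l \<longleftrightarrow>
    (\<exists>f. (\<exists>x\<in>V. f x \<noteq> 0) \<and> adjacency_eigenfunction (k * (1 - l)) f)"
proof -
  have "f x - s / k = l * f x \<longleftrightarrow> s = k * (1 - l) * f x" for f :: "'a \<Rightarrow> real" and x s
    using k_pos by (auto simp: field_simps)
  then show ?thesis
    unfolding matrix_eigenvalue_on_def adjacency_eigenfunction_def using sum_normalized_laplacian by simp
qed

lemma ex_steepest_edge:
  assumes f: "adjacency_eigenfunction \<theta> f" "x \<in> V" "f x \<noteq> 0" and "\<theta> \<noteq> k"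
  obtains u v where "A u v" "0 < f u - f v" "\<And>y z. A y z \<Longrightarrow> f y - f z \<le> f u - f v"
proof -
  let ?slopes = "(\<lambda>(y, z). f y - f z) ` parcs G"
  have fin: "finite ?slopes" using pair_finite_arcs by simp
  have "Max ?slopes \<in> ?slopes" using fin ex_edge by (intro Max_in) auto
  then obtain u v where uv: "A u v" "f u - f v = Max ?slopes" by auto
  have max: "f y - f z \<le> f u - f v" if "A y z" for y z
    unfolding uv(2) by (rule Max_ge[OF fin]) (use that in auto)
  have "0 < f u - f v"
  proof (rule ccontr)
    assume "\<not> 0 < f u - f v"
    then have "f y = f x" if "y \<in> nbhd A x" for y using max[of x y] max[of y x] that A_sym by fastforce
    then have "(\<Sum>y\<in>nbhd A x. f y) = k * f x" using f(2) by (simp add: regular)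
    then show False using adjacency_eigenfunctionD[OF f(1,2)] f(3) \<open>\<theta> \<noteq> k\<close> by simp
  qed
  with uv(1) max that show ?thesis by blast
qed

lemma adjacency_eigenfunction_k_constant:
  assumes f: "adjacency_eigenfunction k f" and V: "x \<in> V" "y \<in> V" shows "f x = f y"
proof -
  define m where "m = Max (f ` V)"
  have le: "f z \<le> m" if "z \<in> V" for z unfolding m_def using that finite_V by simp
  have "m \<in> f ` V" unfolding m_def using V_nonempty finite_V by (intro Max_in) auto
  then obtain z where z: "z \<in> V" "f z = m" by blast
  have "f w = m" if "w \<in> V" for w
    using z(1) that
  proof (induction rule: V_induct)
    case (step u v)
    show ?case
    proof (rule ccontr)
      assume "f v \<noteq> m"
      then have "f v < m" using le A_V2[OF step.hyps(2)] by fastforce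
      then have "(\<Sum>y\<in>nbhd A u. f y) < (\<Sum>y\<in>nbhd A u. m)"
        using le A_V2 step.hyps(2) by (intro sum_strict_mono_ex1[OF finite_nbhd] bexI[of _ v]) auto
      then show False using adjacency_eigenfunctionD[OF f] step regular by simp
    qed
  qed (rule z)
  then show ?thesis using V by simp
qed

lemma ex_adjacency_eigenfunction: "\<exists>f \<theta>. (\<exists>x\<in>V. f x \<noteq> 0) \<and> adjacency_eigenfunction \<theta> f \<and> \<theta> \<noteq> k"
proof -
  obtain x y where xy: "A x y" using ex_edge by blast
  then have "card {x, y} \<le> card V" using A_V A_V2 finite_V by (intro card_mono) auto
  then have card: "card V \<ge> 2" using xy A_irrefl by (cases "x = y") auto
  have sym: "adjacency G u v = adjacency G v u" for u v using A_sym by (auto simp: adjacency_def)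
  have "(\<Sum>x\<in>V. adjacency G x y) = k" if "y \<in> V" for y
    using sum_adjacency[of y "\<lambda>_. 1"] regular[OF that] by (simp add: sym[of _ y])
  then obtain \<theta> f where f: "eigenfunction_on V (adjacency G) \<theta> f" "(\<Sum>x\<in>V. f x) = 0"
    by (rule ex_eigenfunction_sum_zero[OF finite_V card _ sym])
  have eigen: "adjacency_eigenfunction \<theta> f"
    using f(1) by (simp add: eigenfunction_on_def adjacency_eigenfunction_def sum_adjacency)
  obtain x where x: "x \<in> V" "f x \<noteq> 0" using f(1) by (auto simp: eigenfunction_on_def)
  have "\<theta> \<noteq> k"
  proof
    assume "\<theta> = k"
    then have "f y = f x" if "y \<in> V" for y using adjacency_eigenfunction_k_constant eigen that x(1) by blast
    then have "(\<Sum>y\<in>V. f y) = card V * f x" by simp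
    then show False using f(2) x(2) card by simp
  qed
  with eigen x show ?thesis by blast
qed

lemma nonzero_laplacian_spectrum:
  defines "S \<equiv> {l. matrix_eigenvalue_on V (normalized_laplacian G) l \<and> l \<noteq> 0}"
  shows "finite S" "S \<noteq> {}"
proof -
  show "finite S" unfolding S_def
    by (rule finite_subset[OF _ finite_matrix_eigenvalues[OF finite_V]]) blast
  obtain f \<theta> where f: "\<exists>x\<in>V. f x \<noteq> 0" "adjacency_eigenfunction \<theta> f" "\<theta> \<noteq> k"
    using ex_adjacency_eigenfunction by blast
  define l where "l = 1 - \<theta> / k"
  have "k * (1 - l) = \<theta>" "l \<noteq> 0" using k_pos f(3) by (auto simp: l_def)
  then have "l \<in> S" unfolding S_def laplacian_eigenvalue_iff using f by auto
  then show "S \<noteq> {}" by blast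
qed

lemma lambda1_eigenfunction:
  obtains f where "adjacency_eigenfunction (k * (1 - lambda1 G)) f" "\<exists>x\<in>V. f x \<noteq> 0" "lambda1 G \<noteq> 0"
proof -
  have "lambda1 G \<in> {l. matrix_eigenvalue_on V (normalized_laplacian G) l \<and> l \<noteq> 0}"
    unfolding lambda1_def using nonzero_laplacian_spectrum by (rule Min_in)
  then show ?thesis using that unfolding laplacian_eigenvalue_iff by blast
qed

lemma lambda1_eqI:
  fixes l :: real
  assumes f: "adjacency_eigenfunction (k * (1 - l)) f" "x \<in> V" "f x \<noteq> 0" and "l \<noteq> 0"
    and least: "\<And>(\<theta> :: real) f x. adjacency_eigenfunction \<theta> f \<Longrightarrow> x \<in> V \<Longrightarrow> f x \<noteq> 0 \<Longrightarrow> \<theta> \<noteq> k \<Longrightarrow> l \<le> 1 - \<theta> / k"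
  shows "lambda1 G = l"
  unfolding lambda1_def
proof (rule Min_eqI[OF nonzero_laplacian_spectrum(1)])
  show "l \<in> {l. matrix_eigenvalue_on V (normalized_laplacian G) l \<and> l \<noteq> 0}"
    unfolding laplacian_eigenvalue_iff using assms by auto
  fix l' assume "l' \<in> {l. matrix_eigenvalue_on V (normalized_laplacian G) l \<and> l \<noteq> 0}"
  then obtain g y where "adjacency_eigenfunction (k * (1 - l')) g" "y \<in> V" "g y \<noteq> 0" "l' \<noteq> 0"
    unfolding laplacian_eigenvalue_iff by auto
  then show "l \<le> l'" using least[of "real k * (1 - l')" g y] k_pos by simp
qed

subsection \<open>Lin--Lu--Yau curvature of a regular graph\<close>

abbreviation lazy :: "real \<Rightarrow> 'a \<Rightarrow> 'a \<Rightarrow> real" where "lazy \<equiv> lazy_walk_measure G"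

abbreviation lazy_wasserstein :: "real \<Rightarrow> 'a \<Rightarrow> 'a \<Rightarrow> real" where
  "lazy_wasserstein p x y \<equiv> wasserstein G (lazy p x) (lazy p y)"

lemma lazy_eq:
  "x \<in> V \<Longrightarrow> lazy p x y = (if y = x then p else if A x y then (1 - p) / k else 0)"
  by (simp add: lazy_walk_measure_def deg_eq regular)

lemma lazy_sum:
  assumes x: "x \<in> V"
  shows "(\<Sum>y\<in>V. lazy p x y * f y) = p * f x + (1 - p) / k * (\<Sum>y\<in>nbhd A x. f y)"
proof -
  have "(\<Sum>y\<in>V. lazy p x y * f y) =
      (\<Sum>y\<in>V. (if y = x then p * f y else 0) + (1 - p) / k * (adjacency G x y * f y))"
    by (rule sum.cong) (auto simp: lazy_eq[OF x] adjacency_def A_irrefl)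
  also have "\<dots> = p * f x + (1 - p) / k * (\<Sum>y\<in>V. adjacency G x y * f y)"
    using finite_V x by (simp add: sum.distrib sum_distrib_left)
  finally show ?thesis by (simp add: sum_adjacency)
qed

lemma lazy_mass: "x \<in> V \<Longrightarrow> (\<Sum>y\<in>V. lazy p x y) = 1"
  using lazy_sum[of x p "\<lambda>_. 1"] regular k_pos by (simp add: field_simps)

lemma ex_lazy_coupling:
  assumes "x \<in> V" "y \<in> V" "0 \<le> p" "p \<le> 1" shows "\<exists>\<pi>. coupling G (lazy p x) (lazy p y) \<pi>"
  by (rule ex_coupling) (use assms lazy_mass in \<open>auto simp: lazy_eq\<close>)

lemma point_coupling:
  assumes "x \<in> V" "y \<in> V"
  shows "coupling G (lazy 1 x) (lazy 1 y) (\<lambda>u v. of_bool (u = x \<and> v = y))"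
    and "transport_cost (\<lambda>u v. of_bool (u = x \<and> v = y)) = walk_dist A x y"
proof -
  have row: "(\<Sum>v\<in>V. c v * of_bool (u = x \<and> v = y)) = c y * of_bool (u = x)" for u and c :: "'a \<Rightarrow> real"
    using assms finite_V by (cases "u = x") (simp_all add: of_bool_def if_distrib sum.delta cong: if_cong)
  have col: "(\<Sum>u\<in>V. c u * of_bool (u = x \<and> v = y)) = c x * of_bool (v = y)" for v and c :: "'a \<Rightarrow> real"
    using assms finite_V by (cases "v = y") (simp_all add: of_bool_def if_distrib sum.delta cong: if_cong)
  show "coupling G (lazy 1 x) (lazy 1 y) (\<lambda>u v. of_bool (u = x \<and> v = y))"
    using assms row[of "\<lambda>_. 1"] col[of "\<lambda>_. 1"] lazy_mass by (intro couplingI) (simp_all add: lazy_eq)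
  show "transport_cost (\<lambda>u v. of_bool (u = x \<and> v = y)) = walk_dist A x y"
    unfolding transport_cost_def row using assms finite_V
    by (simp add: of_bool_def if_distrib sum.delta cong: if_cong)
qed

lemma lazy_curvature_edge: "A x y \<Longrightarrow> lazy_curvature G p x y = 1 - lazy_wasserstein p x y"
  using A_V A_V2 by (simp add: lazy_curvature_def gdist_eq_walk_dist walk_dist_adj)

text \<open>Increasing the idleness mixes the walk with the point mass, and \<open>wasserstein\<close> is convex.\<close>

lemma lazy_curvature_quotient_mono:
  assumes xy: "A x y" and pq: "0 \<le> p" "p \<le> q" "q < 1"
  shows "lazy_curvature G p x y / (1 - p) \<le> lazy_curvature G q x y / (1 - q)"
proof -
  have V: "x \<in> V" "y \<in> V" using xy A_V A_V2 by auto
  define t where "t = (1 - q) / (1 - p)"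
  have t: "0 < t" "t \<le> 1" "1 - q = t * (1 - p)" using pq by (auto simp: t_def)
  have mix: "lazy q z = (\<lambda>u. t * lazy p z u + (1 - t) * lazy 1 z u)" for z
  proof -
    have "q = t * p + (1 - t)" using t(3) by (simp add: algebra_simps)
    then show ?thesis using t(3) by (auto simp: lazy_walk_measure_def)
  qed
  have "lazy_wasserstein q x y \<le> t * lazy_wasserstein p x y + (1 - t)"
    unfolding mix
    using wasserstein_convex[OF ex_lazy_coupling[OF V] point_coupling(1)[OF V] t(1,2), of p] pq
      point_coupling(2)[OF V] walk_dist_adj[OF xy] by simp
  then have "t * (1 - lazy_wasserstein p x y) \<le> 1 - lazy_wasserstein q x y" by (simp add: algebra_simps)
  then have "t * (1 - lazy_wasserstein p x y) / (1 - q) \<le> (1 - lazy_wasserstein q x y) / (1 - q)"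
    using pq by (intro divide_right_mono) auto
  then show ?thesis using t(1) by (simp add: lazy_curvature_edge[OF xy] t(3))
qed

lemma lazy_curvature_quotient_le_2:
  assumes xy: "A x y" and p: "0 \<le> p" "p < 1"
  shows "lazy_curvature G p x y / (1 - p) \<le> 2"
proof -
  have V: "x \<in> V" "y \<in> V" using xy A_V A_V2 by auto
  let ?f = "\<lambda>u. real (walk_dist A u y)"
  have "(\<Sum>u\<in>nbhd A y. ?f u) = k" using regular[OF V(2)] walk_dist_adj A_sym by simp
  then have "(\<Sum>u\<in>V. lazy p y u * ?f u) = 1 - p"
    using lazy_sum[OF V(2), of p ?f] k_pos by simp
  moreover have "p \<le> (\<Sum>u\<in>V. lazy p x u * ?f u)"
    using lazy_sum[OF V(1), of p ?f] walk_dist_adj[OF xy] p by (simp add: sum_nonneg)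
  moreover have "?f u - ?f v \<le> 1" if "A u v" for u v using walk_dist_step_left[OF that V(2)] by simp
  ultimately have "2 * p - 1 \<le> lazy_wasserstein p x y"
    using wasserstein_ge_potential[where f = ?f and L = 1, OF ex_lazy_coupling[OF V]] p by fastforce
  then show ?thesis using p by (simp add: lazy_curvature_edge[OF xy] field_simps)
qed

lemma lly_curvature_tendsto:
  assumes xy: "A x y"
  shows "((\<lambda>p. lazy_curvature G p x y / (1 - p)) \<longlongrightarrow> lly_curvature G x y) (at_left 1)"
proof -
  define F where "F = (\<lambda>p. lazy_curvature G p x y / (1 - p))"
  have "mono_on {0..<1} F"
    using lazy_curvature_quotient_mono[OF xy] by (intro mono_onI) (auto simp: F_def)
  moreover have "bdd_above (F ` {0..<1})"
    by (rule bdd_aboveI[of _ 2]) (use lazy_curvature_quotient_le_2[OF xy] in \<open>auto simp: F_def\<close>)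
  ultimately have "(F \<longlongrightarrow> Sup (F ` {0..<1})) (at_left 1)" by (intro tendsto_at_left_Sup) auto
  moreover from this have "lly_curvature G x y = Sup (F ` {0..<1})"
    unfolding lly_curvature_def F_def by (intro tendsto_Lim) auto
  ultimately show ?thesis by (simp add: F_def)
qed

lemma lly_curvature_le:
  assumes "A x y" "\<And>p. 0 < p \<Longrightarrow> p < 1 \<Longrightarrow> lazy_curvature G p x y / (1 - p) \<le> c"
  shows "lly_curvature G x y \<le> c"
  by (rule tendsto_upperbound[OF lly_curvature_tendsto[OF assms(1)]])
    (use assms(2) in \<open>auto simp: eventually_at_left_field intro: exI[of _ 0]\<close>)

lemma lazy_curvature_quotient_le_lly_curvature:
  assumes "A x y" "0 \<le> p" "p < 1" shows "lazy_curvature G p x y / (1 - p) \<le> lly_curvature G x y"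
  by (rule tendsto_lowerbound[OF lly_curvature_tendsto[OF assms(1)]])
    (use assms lazy_curvature_quotient_mono[OF assms(1,2)] in
      \<open>auto simp: eventually_at_left_field intro!: exI[of _ p]\<close>)

text \<open>
  A steepest edge of an eigenfunction makes it an optimal potential. The curvature is strictly smaller if
  the mass at some neighbour \<open>z\<close> of \<open>x\<close> cannot be transported along steepest edges.
\<close>

lemma lly_curvature_le_eigenfunction_slack:
  fixes f :: "'a \<Rightarrow> real" and \<theta> L \<delta> :: real
  assumes xy: "A x y" and f: "adjacency_eigenfunction \<theta> f"
    and L: "L > 0" "\<And>u v. A u v \<Longrightarrow> f u - f v \<le> L" "f x - f y = L"
    and xz: "A x z" and slack: "\<And>w. w \<in> closed_nbhd A y \<Longrightarrow> \<delta> \<le> L * walk_dist A z w - (f z - f w)"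
  shows "lly_curvature G x y \<le> 1 - \<theta> / k - \<delta> / (k * L)"
proof (rule lly_curvature_le[OF xy])
  fix p :: real assume p: "0 < p" "p < 1"
  have V: "x \<in> V" "y \<in> V" "z \<in> V" using xy xz A_V A_V2 by auto
  have "(\<Sum>u\<in>V. lazy p x u * f u) - (\<Sum>u\<in>V. lazy p y u * f u) = (p + (1 - p) * \<theta> / k) * L"
    unfolding lazy_sum[OF V(1)] lazy_sum[OF V(2)] adjacency_eigenfunctionD[OF f V(1)]
      adjacency_eigenfunctionD[OF f V(2)] L(3)[symmetric]
    by (simp add: algebra_simps diff_divide_distrib add_divide_distrib)
  moreover have "lazy p x z = (1 - p) / k" using xz A_irrefl by (auto simp: lazy_eq[OF V(1)])
  moreover have "(\<Sum>u\<in>V. lazy p x u * f u) - (\<Sum>u\<in>V. lazy p y u * f u) + lazy p x z * \<delta> \<le>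
      L * lazy_wasserstein p x y"
  proof (rule wasserstein_ge_potential_slack[OF _ L(1,2) V(3)])
    show "\<exists>\<pi>. coupling G (lazy p x) (lazy p y) \<pi>" using ex_lazy_coupling V p by simp
    show "\<delta> \<le> L * walk_dist A z w - (f z - f w)" if "lazy p y w \<noteq> 0" for w
      using slack that by (auto simp: lazy_eq[OF V(2)] mem_closed_nbhd split: if_splits)
  qed
  ultimately have "(p + (1 - p) * \<theta> / k) * L + (1 - p) / k * \<delta> \<le> L * lazy_wasserstein p x y" by simp
  also have "(p + (1 - p) * \<theta> / k) * L + (1 - p) / k * \<delta> = L * (p + (1 - p) * (\<theta> / k + \<delta> / (k * L)))"
    using L(1) k_pos by (simp add: field_simps)
  finally have "p + (1 - p) * (\<theta> / k + \<delta> / (k * L)) \<le> lazy_wasserstein p x y"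
    using L(1) by simp
  then show "lazy_curvature G p x y / (1 - p) \<le> 1 - \<theta> / k - \<delta> / (k * L)"
    using p by (simp add: lazy_curvature_edge[OF xy] pos_divide_le_eq) (simp add: algebra_simps)
qed

lemma lly_curvature_le_eigenfunction:
  assumes xy: "A x y" and f: "adjacency_eigenfunction \<theta> f"
    and L: "L > 0" "\<And>u v. A u v \<Longrightarrow> f u - f v \<le> L" "f x - f y = L"
  shows "lly_curvature G x y \<le> 1 - \<theta> / k"
proof -
  have "0 \<le> L * walk_dist A y w - (f y - f w)" if "w \<in> closed_nbhd A y" for w
    using diff_le_walk_dist[of f L, OF L(2), of y w] that closed_nbhd_subset A_V2[OF xy] by auto
  then show ?thesis using lly_curvature_le_eigenfunction_slack[where \<delta> = 0, OF xy f L xy] by simp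
qed

lemma ex_edge_lly_curvature_le:
  assumes "adjacency_eigenfunction \<theta> f" "x \<in> V" "f x \<noteq> 0" "\<theta> \<noteq> k"
  obtains u v where "A u v" "lly_curvature G u v \<le> 1 - \<theta> / k"
proof -
  obtain u v where "A u v" "0 < f u - f v" "\<And>y z. A y z \<Longrightarrow> f y - f z \<le> f u - f v"
    using ex_steepest_edge[OF assms] by blast
  then show ?thesis using lly_curvature_le_eigenfunction[OF _ assms(1)] that by blast
qed

lemma lazy_wasserstein_le_bij:
  fixes \<sigma> :: "'a \<Rightarrow> 'a"
  assumes V: "x \<in> V" "y \<in> V" and \<sigma>: "bij_betw \<sigma> (closed_nbhd A x) (closed_nbhd A y)"
  defines "p \<equiv> 1 / (real k + 1)"
  shows "lazy_wasserstein p x y \<le> p * (\<Sum>u\<in>closed_nbhd A x. real (walk_dist A u (\<sigma> u)))"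
proof -
  let ?C = "closed_nbhd A x"
  have C_V: "?C \<subseteq> V" "\<And>u. u \<in> ?C \<Longrightarrow> \<sigma> u \<in> V"
    using closed_nbhd_subset V bij_betwE[OF \<sigma>] by blast+
  have "1 - p = p * k" by (simp add: p_def field_simps)
  then have lazy_p: "lazy p z u = of_bool (u \<in> closed_nbhd A z) * p" if "z \<in> V" for z u
    using k_pos by (simp add: lazy_eq[OF that] mem_closed_nbhd)
  define \<pi> where "\<pi> u v = (if u \<in> ?C then if v = \<sigma> u then p else 0 else 0)" for u v
  have row: "(\<Sum>v\<in>V. c v * \<pi> u v) = (if u \<in> ?C then p * c (\<sigma> u) else 0)" for u c
    using C_V(2)[of u] finite_V by (simp add: \<pi>_def if_distrib[of "times a" for a] sum.delta cong: if_cong)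
  have col: "(\<Sum>u\<in>V. \<pi> u v) = lazy p y v" for v
  proof -
    have "(\<Sum>u\<in>V. \<pi> u v) = (\<Sum>u\<in>?C. if v = \<sigma> u then p else 0)"
      unfolding \<pi>_def using C_V(1) finite_V by (simp add: sum.inter_restrict[symmetric] Int_absorb1)
    also have "\<dots> = (\<Sum>w\<in>closed_nbhd A y. if v = w then p else 0)"
      by (rule sum.reindex_bij_betw[OF \<sigma>])
    also have "\<dots> = lazy p y v"
      using finite_nbhd[of y] by (simp add: lazy_p[OF V(2)] closed_nbhd_def sum.delta')
    finally show ?thesis .
  qed
  have "coupling G (lazy p x) (lazy p y) \<pi>"
  proof (rule couplingI)
    show "(\<Sum>v\<in>V. \<pi> u v) = lazy p x u" for u using row[of "\<lambda>_. 1" u] by (simp add: lazy_p[OF V(1)])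
  qed (use col lazy_mass[OF V(1)] in \<open>auto simp: \<pi>_def p_def\<close>)
  then have "lazy_wasserstein p x y \<le> transport_cost \<pi>" by (rule wasserstein_le)
  also have "\<dots> = p * (\<Sum>u\<in>?C. real (walk_dist A u (\<sigma> u)))"
    unfolding transport_cost_def row sum_distrib_left
    using C_V(1) finite_V by (simp add: sum.inter_restrict[symmetric] Int_absorb1)
  finally show ?thesis .
qed

lemma lly_curvature_ge_bij:
  assumes xy: "A x y" and \<sigma>: "bij_betw \<sigma> (closed_nbhd A x) (closed_nbhd A y)"
  shows "(real k + 1 - (\<Sum>u\<in>closed_nbhd A x. real (walk_dist A u (\<sigma> u)))) / k \<le> lly_curvature G x y"
proof -
  define cost where "cost = (\<Sum>u\<in>closed_nbhd A x. real (walk_dist A u (\<sigma> u)))"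
  define p where "p = 1 / (real k + 1)"
  have p: "0 \<le> p" "p < 1" "1 - p = p * k" using k_pos by (simp_all add: p_def field_simps)
  have "(1 - p * cost) / (1 - p) \<le> lazy_curvature G p x y / (1 - p)"
    using p(2) lazy_wasserstein_le_bij[OF A_V[OF xy] A_V2[OF xy] \<sigma>]
    by (intro divide_right_mono) (simp_all add: lazy_curvature_edge[OF xy] p_def cost_def)
  also have "\<dots> \<le> lly_curvature G x y" using p by (intro lazy_curvature_quotient_le_lly_curvature[OF xy])
  also have "1 - p * cost = p * (real k + 1 - cost)" by (simp add: p_def divide_simps)
  also have "p * (real k + 1 - cost) / (1 - p) = (real k + 1 - cost) / k"
    unfolding p(3) using p(1,2) by (simp add: p_def)
  finally show ?thesis by (simp only: cost_def)
qed

end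

subsection \<open>Regular minuscule graphs are Lichnerowicz sharp\<close>

context minuscule
begin

lemma ex_translate_outside:
  assumes xy: "A x y" and u: "u \<in> closed_nbhd A x - closed_nbhd A y"
  shows "\<exists>w\<in>closed_nbhd A y - closed_nbhd A x. A u w \<and> parallel x y u w"
proof -
  have "A x u" "u \<noteq> y" "\<not> A y u" using xy u A_sym by (auto simp: mem_closed_nbhd)
  then obtain w where "A y w" "A u w" "parallel x y u w" "w \<noteq> x" "\<not> A x w"
    using ex_translate[OF xy] by metis
  then show ?thesis by (intro bexI[of _ w]) (auto simp: mem_closed_nbhd)
qed

lemma ex_translation_bij:
  assumes xy: "A x y"
  obtains \<sigma> where "bij_betw \<sigma> (closed_nbhd A x) (closed_nbhd A y)"
    "\<And>u. u \<in> closed_nbhd A x \<inter> closed_nbhd A y \<Longrightarrow> \<sigma> u = u"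
    "\<And>u. u \<in> closed_nbhd A x - closed_nbhd A y \<Longrightarrow> A u (\<sigma> u)"
proof -
  let ?X = "closed_nbhd A x" and ?Y = "closed_nbhd A y"
  obtain \<tau> where \<tau>: "\<tau> u \<in> ?Y - ?X" "A u (\<tau> u)" "parallel x y u (\<tau> u)" if "u \<in> ?X - ?Y" for u
    using ex_translate_outside[OF xy] by metis
  have V: "?X \<subseteq> V" "?Y \<subseteq> V" using closed_nbhd_subset A_V[OF xy] A_V2[OF xy] by auto
  define \<sigma> where "\<sigma> u = (if u \<in> ?Y then u else \<tau> u)" for u
  have "bij_betw \<sigma> (?X - ?Y) (?Y - ?X)"
  proof (rule bij_betwI')
    fix u v assume uv: "u \<in> ?X - ?Y" "v \<in> ?X - ?Y"
    have "u = v" if "\<tau> u = \<tau> v"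
    proof (rule parallel_unique)
      show "parallel y x (\<tau> u) u" "parallel y x (\<tau> u) v"
        using \<tau>(3)[OF uv(1)] \<tau>(3)[OF uv(2)] that parallel_reverse by auto
    qed (use uv V in auto)
    then show "\<sigma> u = \<sigma> v \<longleftrightarrow> u = v" using uv by (auto simp: \<sigma>_def)
  next
    fix w assume w: "w \<in> ?Y - ?X"
    then obtain u where u: "u \<in> ?X - ?Y" "parallel y x w u" using ex_translate_outside[OF A_sym[OF xy]] by blast
    have "\<tau> u = w"
      using \<tau>(1)[OF u(1)] w V by (intro parallel_unique[OF \<tau>(3)[OF u(1)] parallel_reverse[OF u(2)]]) auto
    then show "\<exists>u\<in>?X - ?Y. w = \<sigma> u" using u(1) by (auto simp: \<sigma>_def)
  qed (use \<tau>(1) in \<open>auto simp: \<sigma>_def\<close>)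
  moreover have "bij_betw \<sigma> (?X \<inter> ?Y) (?X \<inter> ?Y)"
    by (subst bij_betw_cong[of _ \<sigma> id]) (auto simp: \<sigma>_def)
  ultimately have "bij_betw \<sigma> ((?X - ?Y) \<union> (?X \<inter> ?Y)) ((?Y - ?X) \<union> (?X \<inter> ?Y))"
    by (rule bij_betw_combine) blast
  moreover have "(?X - ?Y) \<union> (?X \<inter> ?Y) = ?X" "(?Y - ?X) \<union> (?X \<inter> ?Y) = ?Y" by blast+
  ultimately show ?thesis using that \<tau>(2) by (simp add: \<sigma>_def)
qed

end

locale minuscule_regular_graph = regular_graph G k + minuscule "pverts G" "adj G" D
  for G :: "'a pair_pre_digraph" and k D +
  fixes a :: nat
  assumes triangles: "adj G x y \<Longrightarrow> card (nbhd (adj G) x \<inter> nbhd (adj G) y) = a"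
begin

lemma sum_D_nbhd:
  assumes tv: "A t v" shows "(\<Sum>w\<in>nbhd A t. D w v) = 2 * real k - 2 - a"
proof -
  have "(\<Sum>w\<in>nbhd A t. D w v) =
      (\<Sum>w\<in>nbhd A t. 2 - (if w = v then 2 else 0) - (if w \<in> nbhd A v then 1 else 0))"
  proof (rule sum.cong[OF refl])
    fix w assume "w \<in> nbhd A t"
    then show "D w v = 2 - (if w = v then 2 else 0) - (if w \<in> nbhd A v then 1 else 0)"
      using D_common_neighbour[OF _ tv, of w] A_sym[of w v] A_sym[of v w] A_irrefl by auto
  qed
  also have "\<dots> = 2 * real (card (nbhd A t)) - 2 - real (card (nbhd A t \<inter> nbhd A v))"
    using tv finite_nbhd[of t]
    by (simp add: sum_subtractf sum.delta sum.inter_restrict[symmetric] del: mem_nbhd) (simp add: nbhd_def)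
  finally show ?thesis using regular A_V[OF tv] triangles[OF tv] by simp
qed

lemma sum_root_nbhd:
  assumes tv: "A t v" shows "(\<Sum>w\<in>nbhd A t. D w v - D w t) = real k - 2 - a"
proof -
  have "(\<Sum>w\<in>nbhd A t. D w t) = k" using regular A_V[OF tv] D_adj A_sym by simp
  then show ?thesis using sum_D_nbhd[OF tv] by (simp add: sum_subtractf)
qed

lemma root_eigenfunction:
  assumes xy: "A x y" shows "adjacency_eigenfunction (real k - 2 - a) (\<lambda>t. D t y - D t x)"
  unfolding adjacency_eigenfunction_def
proof
  fix t assume t: "t \<in> V"
  have shift: "(\<Sum>w\<in>nbhd A t. D w y - D w x) = (\<Sum>w\<in>nbhd A t. D w q - D w p)" if "parallel x y p q" for p q
    by (rule sum.cong) (use parallelD[OF that] A_V2 in auto)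
  from root_trichotomy[OF xy t]
  show "(\<Sum>w\<in>nbhd A t. D w y - D w x) = (real k - 2 - a) * (D t y - D t x)"
  proof (cases rule: root_trichotomy_cases)
    case (minus t')
    then have "D t y - D t x = 1" by simp
    then show ?thesis using shift[OF minus(3)] sum_root_nbhd[OF minus(2)] by simp
  next
    case (plus t')
    then have "D t y - D t x = -1" by simp
    moreover have "(\<Sum>w\<in>nbhd A t. D w t - D w t') = - (\<Sum>w\<in>nbhd A t. D w t' - D w t)"
      by (simp add: sum_negf[symmetric])
    ultimately show ?thesis using shift[OF plus(3)] sum_root_nbhd[OF plus(2)] by simp
  next
    case (zero u u')
    then have "D t y - D t x = 0" by simp
    then show ?thesis using shift[OF zero(5)] sum_D_nbhd[OF zero(2)] sum_D_nbhd[OF zero(3)]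
      by (simp add: sum_subtractf)
  qed
qed

lemma card_closed_nbhd_diff:
  assumes xy: "A x y"
  shows "card (closed_nbhd A x - closed_nbhd A y) + (a + 2) = k + 1"
proof -
  have "closed_nbhd A x \<inter> closed_nbhd A y = insert x (insert y (nbhd A x \<inter> nbhd A y))"
    using xy A_sym[OF xy] by (auto simp: mem_closed_nbhd)
  moreover have "x \<noteq> y" using xy A_irrefl by auto
  ultimately have "card (closed_nbhd A x \<inter> closed_nbhd A y) = a + 2"
    using triangles[OF xy] finite_nbhd A_irrefl by simp
  moreover have "card (closed_nbhd A x) = k + 1"
    using regular A_V[OF xy] finite_nbhd A_irrefl by (simp add: closed_nbhd_def)
  moreover have "finite (closed_nbhd A x)" using finite_nbhd by (simp add: closed_nbhd_def)
  ultimately show ?thesis using card_Int_Diff[of "closed_nbhd A x" "closed_nbhd A y"] by simp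
qed

lemma lly_curvature_eq:
  assumes xy: "A x y" shows "lly_curvature G x y = (a + 2) / k"
proof (rule antisym)
  have V: "x \<in> V" "y \<in> V" using xy A_V A_V2 by auto
  have "lly_curvature G x y \<le> 1 - (real k - 2 - a) / k"
  proof (rule lly_curvature_le_eigenfunction[OF xy root_eigenfunction[OF xy], of 2])
    show "D u y - D u x - (D v y - D v x) \<le> 2" if "A u v" for u v
      using root_values[OF xy, of u] root_values[OF xy, of v] A_V[OF that] A_V2[OF that] by auto
    show "D x y - D x x - (D y y - D y x) = 2"
      using D_adj[OF xy] D_adj[OF A_sym[OF xy]] D_self V by simp
  qed simp
  then show "lly_curvature G x y \<le> (a + 2) / k" using k_pos by (simp add: field_simps)
  let ?X = "closed_nbhd A x" and ?Y = "closed_nbhd A y"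
  obtain \<sigma> where \<sigma>: "bij_betw \<sigma> ?X ?Y" "\<And>u. u \<in> ?X \<inter> ?Y \<Longrightarrow> \<sigma> u = u" "\<And>u. u \<in> ?X - ?Y \<Longrightarrow> A u (\<sigma> u)"
    using ex_translation_bij[OF xy] by blast
  have "(\<Sum>u\<in>?X. real (walk_dist A u (\<sigma> u))) = (\<Sum>u\<in>?X. if u \<in> ?X - ?Y then 1 else 0)"
    by (rule sum.cong) (use \<sigma>(2,3) walk_dist_adj in auto)
  also have "\<dots> = card (?X - ?Y)"
    using finite_nbhd by (subst sum.inter_restrict[symmetric]) (auto simp: closed_nbhd_def Int_absorb1)
  also have "real k + 1 - \<dots> = a + 2" using card_closed_nbhd_diff[OF xy] by (simp flip: of_nat_add)
  finally have "real k + 1 - (\<Sum>u\<in>?X. real (walk_dist A u (\<sigma> u))) = real (a + 2)" by simp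
  then show "(a + 2) / k \<le> lly_curvature G x y" using lly_curvature_ge_bij[OF xy \<sigma>(1)] by (simp only:)
qed

theorem lichnerowicz_sharp: "lichnerowicz_sharp G"
proof -
  obtain x y where xy: "A x y" using ex_edge by blast
  have "lambda1 G = (a + 2) / k"
  proof (rule lambda1_eqI)
    have "real k * (1 - (a + 2) / k) = real k - 2 - a" using k_pos by (simp add: field_simps)
    then show "adjacency_eigenfunction (k * (1 - (a + 2) / k)) (\<lambda>t. D t y - D t x)"
      using root_eigenfunction[OF xy] by simp
    show "x \<in> V" "D x y - D x x \<noteq> 0" using D_adj[OF xy] D_self A_V[OF xy] by simp_all
    show "(a + 2) / k \<le> 1 - \<theta> / k"
      if "adjacency_eigenfunction \<theta> f" "z \<in> V" "f z \<noteq> 0" "\<theta> \<noteq> k" for \<theta> :: real and f z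
      using ex_edge_lly_curvature_le[OF that] lly_curvature_eq by metis
  qed (use k_pos in simp)
  moreover have "{lly_curvature G x y |x y. A x y} = {(a + 2) / k}"
  proof (rule subset_singletonD[THEN disjE])
    show "{lly_curvature G x y |x y. A x y} \<subseteq> {(a + 2) / k}" using lly_curvature_eq by auto
  qed (use xy in blast)+
  ultimately show ?thesis using xy by (auto simp: lichnerowicz_sharp_def)
qed

end

subsection \<open>Sharp spherical representations\<close>

text \<open>
  \<open>K\<close> is a multiple of the orthogonal projection onto the \<open>\<theta>\<close>-eigenspace: the inner product of the images
  of two vertices on a sphere in that space.
\<close>

locale spherical_representation = regular_graph G k for G :: "'a pair_pre_digraph" and k +
  fixes K :: "'a \<Rightarrow> 'a \<Rightarrow> real" and \<theta> \<alpha> \<beta> C :: real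
  assumes K_self: "x \<in> pverts G \<Longrightarrow> K x x = 1"
    and K_sym: "x \<in> pverts G \<Longrightarrow> y \<in> pverts G \<Longrightarrow> K x y = K y x"
    and K_adj: "adj G x y \<Longrightarrow> K x y = \<alpha>" and \<alpha>_neq_1: "\<alpha> \<noteq> 1"
    and K_two: "adj G x y \<Longrightarrow> adj G y z \<Longrightarrow> x \<noteq> z \<Longrightarrow> \<not> adj G x z \<Longrightarrow> K x z = \<beta>"
    and K_eigenfunction: "x \<in> pverts G \<Longrightarrow> adjacency_eigenfunction \<theta> (K x)"
    and C_pos: "C > 0"
    and K_reproducing: "x \<in> pverts G \<Longrightarrow> adjacency_eigenfunction \<theta> f \<Longrightarrow> (\<Sum>t\<in>pverts G. K x t * f t) = C * f x"
begin

definition edge_function :: "'a \<Rightarrow> 'a \<Rightarrow> 'a \<Rightarrow> real" where "edge_function x y t = K x t - K y t"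

abbreviation (input) L :: real where "L \<equiv> 2 * (1 - \<alpha>)"

lemma edge_function_eigen:
  "x \<in> V \<Longrightarrow> y \<in> V \<Longrightarrow> adjacency_eigenfunction \<theta> (edge_function x y)"
  unfolding edge_function_def by (intro adjacency_eigenfunction_diff K_eigenfunction)

lemma inner_edge_functions:
  assumes "x \<in> V" "y \<in> V" "z \<in> V" "w \<in> V"
  shows "(\<Sum>t\<in>V. edge_function z w t * edge_function x y t) = C * (edge_function x y z - edge_function x y w)"
  using K_reproducing[OF assms(3) edge_function_eigen[OF assms(1,2)]]
    K_reproducing[OF assms(4) edge_function_eigen[OF assms(1,2)]]
  by (simp add: edge_function_def[of z w] left_diff_distrib sum_subtractf right_diff_distrib)

lemma edge_function_ends: "A x y \<Longrightarrow> edge_function x y x - edge_function x y y = L"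
  using K_self A_V A_V2 K_adj[of x y] K_adj[of y x] A_sym by (simp add: edge_function_def)

lemma norm_edge_function:
  "A x y \<Longrightarrow> (\<Sum>t\<in>V. edge_function x y t * edge_function x y t) = C * L"
  using inner_edge_functions[of x y x y] A_V A_V2 edge_function_ends[of x y] by simp

lemma L_pos: "0 < L"
proof -
  obtain x y where "A x y" using ex_edge by blast
  moreover have "0 \<le> (\<Sum>t\<in>V. edge_function x y t * edge_function x y t)" by (rule sum_nonneg) simp
  ultimately have "0 \<le> C * L" using norm_edge_function by simp
  then show ?thesis using C_pos \<alpha>_neq_1 by (simp add: zero_le_mult_iff)
qed

lemma norm_edge_function_diff:
  assumes xy: "A x y" and zw: "A z w"
  shows "(\<Sum>t\<in>V. (edge_function x y t - edge_function z w t)\<^sup>2) =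
    2 * C * (L - (edge_function x y z - edge_function x y w))"
proof -
  have "(\<Sum>t\<in>V. (edge_function x y t - edge_function z w t)\<^sup>2) =
      (\<Sum>t\<in>V. edge_function x y t * edge_function x y t) + (\<Sum>t\<in>V. edge_function z w t * edge_function z w t)
      - 2 * (\<Sum>t\<in>V. edge_function z w t * edge_function x y t)"
    by (simp add: power2_eq_square algebra_simps sum.distrib sum_subtractf sum_distrib_left)
  then show ?thesis
    using norm_edge_function[OF xy] norm_edge_function[OF zw] inner_edge_functions[of x y z w]
      A_V[OF xy] A_V2[OF xy] A_V[OF zw] A_V2[OF zw] by (simp add: algebra_simps)
qed

lemma edge_function_slope_le:
  assumes "A x y" "A z w" shows "edge_function x y z - edge_function x y w \<le> L"
proof -
  have "0 \<le> (\<Sum>t\<in>V. (edge_function x y t - edge_function z w t)\<^sup>2)" by (rule sum_nonneg) simp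
  then show ?thesis using norm_edge_function_diff[OF assms] C_pos by (simp add: zero_le_mult_iff)
qed

lemma edge_function_eq_if_steepest:
  assumes "A x y" "A z w" "edge_function x y z - edge_function x y w = L" "t \<in> V"
  shows "edge_function z w t = edge_function x y t"
proof -
  have "(\<Sum>t\<in>V. (edge_function x y t - edge_function z w t)\<^sup>2) = 0"
    using norm_edge_function_diff[OF assms(1,2)] assms(3) by simp
  then have "\<forall>t\<in>V. (edge_function x y t - edge_function z w t)\<^sup>2 = 0"
    using finite_V by (subst (asm) sum_nonneg_eq_0_iff) auto
  then show ?thesis using assms(4) by simp
qed

lemma edge_function_lipschitz:
  "A x y \<Longrightarrow> z \<in> V \<Longrightarrow> w \<in> V \<Longrightarrow> edge_function x y z - edge_function x y w \<le> L * walk_dist A z w"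
  by (rule diff_le_walk_dist[OF edge_function_slope_le])

text \<open>Two consecutive steepest edges would be three collinear points on a sphere.\<close>

lemma edge_function_not_steepest_twice:
  assumes xy: "A x y" and z: "A z z1" "A z1 z2"
  shows "edge_function x y z - edge_function x y z2 \<noteq> 2 * L"
proof
  assume sum: "edge_function x y z - edge_function x y z2 = 2 * L"
  have V: "z1 \<in> V" using z A_V by blast
  have "edge_function x y z - edge_function x y z1 = L" "edge_function x y z1 - edge_function x y z2 = L"
    using sum edge_function_slope_le[OF xy z(1)] edge_function_slope_le[OF xy z(2)] by linarith+
  then have "edge_function z1 z2 z1 = edge_function z z1 z1"
    using edge_function_eq_if_steepest[OF xy z(1) _ V] edge_function_eq_if_steepest[OF xy z(2) _ V] by simp
  then show False
    using K_self[OF V] K_adj[OF z(1)] K_adj[OF A_sym[OF z(2)]] \<alpha>_neq_1 by (simp add: edge_function_def)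
qed

lemma steepest_walk_cases:
  assumes xy: "A x y" and V: "z \<in> V" "w \<in> V" "z \<noteq> w"
    and steepest: "edge_function x y z - edge_function x y w = L * walk_dist A z w"
  shows "A z w \<and> (\<forall>t\<in>V. edge_function z w t = edge_function x y t)"
proof -
  obtain m where m: "walk_dist A z w = Suc m"
    using walk_dist_eq_0_iff[OF V(1,2)] V(3) by (cases "walk_dist A z w") auto
  obtain z1 where z1: "A z z1" "walk_dist A z1 w = m" by (rule walk_dist_Suc_left[OF V(1,2) m])
  have z1V: "z1 \<in> V" using z1 A_V2 by blast
  have "m = 0"
  proof (rule ccontr)
    assume "m \<noteq> 0"
    then obtain m' where m': "walk_dist A z1 w = Suc m'" using z1(2) by (cases m) auto
    obtain z2 where z2: "A z1 z2" "walk_dist A z2 w = m'" by (rule walk_dist_Suc_left[OF z1V V(2) m'])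
    have "edge_function x y z2 - edge_function x y w \<le> L * real m'"
      using edge_function_lipschitz[OF xy A_V2[OF z2(1)] V(2)] z2(2) by simp
    moreover have "edge_function x y z - edge_function x y w = L * real m' + 2 * L"
      using steepest m m' z1(2) by (simp add: algebra_simps)
    ultimately have "edge_function x y z - edge_function x y z2 = 2 * L"
      using edge_function_slope_le[OF xy z1(1)] edge_function_slope_le[OF xy z2(1)] by linarith
    then show False using edge_function_not_steepest_twice[OF xy z1(1) z2(1)] by simp
  qed
  then have "z1 = w" using z1(2) walk_dist_eq_0_iff[OF z1V V(2)] by simp
  then show ?thesis
    using z1(1) steepest m \<open>m = 0\<close> edge_function_eq_if_steepest[OF xy, of z w] by simp
qed

lemma ex_translate_if_curvature_ge:
  assumes curvature: "1 - \<theta> / k \<le> lly_curvature G x y"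
    and xy: "A x y" and xz: "A x z" and zy: "z \<noteq> y" "\<not> A y z"
  shows "\<exists>w. A y w \<and> A z w \<and> (\<forall>t\<in>V. edge_function z w t = edge_function x y t)"
proof (rule ccontr)
  assume none: "\<not> ?thesis"
  let ?B = "closed_nbhd A y"
  define gap where "gap w = L * walk_dist A z w - (edge_function x y z - edge_function x y w)" for w
  have V: "x \<in> V" "y \<in> V" "z \<in> V" using xy xz A_V A_V2 by auto
  have B: "finite ?B" "?B \<noteq> {}" "?B \<subseteq> V" using finite_nbhd closed_nbhd_subset V by (auto simp: closed_nbhd_def)
  have gap_pos: "0 < gap w" if w: "w \<in> ?B" for w
  proof (rule ccontr)
    assume "\<not> 0 < gap w"
    moreover have "w \<in> V" "z \<noteq> w" using w B(3) zy A_sym by (auto simp: mem_closed_nbhd)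
    ultimately have "A z w \<and> (\<forall>t\<in>V. edge_function z w t = edge_function x y t)"
      using edge_function_lipschitz[OF xy V(3)]
      by (intro steepest_walk_cases[OF xy V(3)]) (auto simp: gap_def intro: antisym)
    moreover from this have "A y w" using w zy A_sym by (auto simp: mem_closed_nbhd)
    ultimately show False using none by blast
  qed
  define \<delta> where "\<delta> = Min (gap ` ?B)"
  have \<delta>: "0 < \<delta>" "\<And>w. w \<in> ?B \<Longrightarrow> \<delta> \<le> gap w" using B gap_pos by (simp_all add: \<delta>_def)
  have "lly_curvature G x y \<le> 1 - \<theta> / k - \<delta> / (k * L)"
    using lly_curvature_le_eigenfunction_slack[OF xy edge_function_eigen[OF V(1,2)] L_pos
      edge_function_slope_le[OF xy] edge_function_ends[OF xy] xz, of \<delta>] \<delta>(2)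
    unfolding gap_def by blast
  moreover have "0 < \<delta> / (k * L)" using \<delta>(1) k_pos L_pos by simp
  ultimately show False using curvature by simp
qed

theorem minuscule_if_curvature_ge:
  assumes curvature: "\<And>x y. A x y \<Longrightarrow> 1 - \<theta> / k \<le> lly_curvature G x y"
  shows "minuscule V A (\<lambda>x y. (1 - K x y) / (1 - \<alpha>))"
proof
  fix x y z
  assume xyz: "A x y" "A y z" "x \<noteq> z" "\<not> A x z"
  obtain w where w: "A z w" "A x w" "\<And>t. t \<in> V \<Longrightarrow> edge_function x w t = edge_function y z t"
    using ex_translate_if_curvature_ge[OF curvature[OF xyz(2)] xyz(2) A_sym[OF xyz(1)]] xyz A_sym by metis
  have V: "y \<in> V" "w \<in> V" using xyz w A_V A_V2 by auto
  have "K w y = 2 * \<alpha> - 1"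
    using w(3)[OF V(1)] K_self[OF V(1)] K_adj[OF xyz(1)] K_adj[OF A_sym[OF xyz(2)]]
    by (simp add: edge_function_def)
  moreover from this have "w \<noteq> y" "\<not> A w y" using K_self[OF V(1)] K_adj \<alpha>_neq_1 by auto
  then have "K w y = \<beta>" using K_two[OF A_sym[OF w(1)] A_sym[OF xyz(2)]] by blast
  ultimately have "K x z = 2 * \<alpha> - 1" using K_two[OF xyz] by simp
  then show "(1 - K x z) / (1 - \<alpha>) = 2" using \<alpha>_neq_1 by (simp add: field_simps)
next
  fix x y z
  assume xyz: "A x y" "A x z" "z \<noteq> y" "\<not> A y z"
  obtain w where w: "A y w" "A z w" "\<And>t. t \<in> V \<Longrightarrow> edge_function z w t = edge_function x y t"
    using ex_translate_if_curvature_ge[OF curvature[OF xyz(1)] xyz] by blast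
  have V: "x \<in> V" "y \<in> V" "z \<in> V" "w \<in> V" using xyz w A_V A_V2 by auto
  have "parallel_on V (\<lambda>x y. (1 - K x y) / (1 - \<alpha>)) x y z w"
    unfolding parallel_on_def diff_divide_distrib[symmetric]
  proof
    fix t assume t: "t \<in> V"
    have "K t z - K t w = K t x - K t y"
      using w(3)[OF t] K_sym[OF t] V by (simp add: edge_function_def)
    then show "(1 - K t w - (1 - K t z)) / (1 - \<alpha>) = (1 - K t y - (1 - K t x)) / (1 - \<alpha>)" by simp
  qed
  with w show "\<exists>w. A y w \<and> A z w \<and> parallel_on V (\<lambda>x y. (1 - K x y) / (1 - \<alpha>)) x y z w" by blast
qed (use K_self K_sym K_adj \<alpha>_neq_1 in auto)

end

subsection \<open>Distance-regular graphs\<close>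

locale distance_regular_graph = connected_graph +
  fixes c a b :: "nat \<Rightarrow> nat"
  assumes intersection_numbers: "intersection_numbers G c a b" and edges: "parcs G \<noteq> {}"
begin

lemma card_nbhd_intersection_numbers:
  assumes V: "x \<in> V" "y \<in> V"
  shows "card {z \<in> nbhd A y. walk_dist A x z + 1 = walk_dist A x y} = c (walk_dist A x y)"
    and "card {z \<in> nbhd A y. walk_dist A x z = walk_dist A x y} = a (walk_dist A x y)"
    and "card {z \<in> nbhd A y. walk_dist A x z = walk_dist A x y + 1} = b (walk_dist A x y)"
proof -
  have "finite {gdist G x y |x y. x \<in> V \<and> y \<in> V}" by (rule finite_image_set2) (simp_all add: finite_V)
  then have le: "gdist G x y \<le> gdiameter G" unfolding gdiameter_def using V by (intro Max_ge) auto
  have nbhd: "{z \<in> neighbours G y. P (gdist G x z)} = {z \<in> nbhd A y. P (walk_dist A x z)}" for P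
    using V A_V2 by (auto simp: neighbours_eq gdist_eq_walk_dist)
  have "card {z \<in> neighbours G y. gdist G x z + 1 = gdist G x y} = c (gdist G x y)"
    "card {z \<in> neighbours G y. gdist G x z = gdist G x y} = a (gdist G x y)"
    "card {z \<in> neighbours G y. gdist G x z = gdist G x y + 1} = b (gdist G x y)"
    using intersection_numbers le V unfolding intersection_numbers_def by blast+
  then show "card {z \<in> nbhd A y. walk_dist A x z + 1 = walk_dist A x y} = c (walk_dist A x y)"
    and "card {z \<in> nbhd A y. walk_dist A x z = walk_dist A x y} = a (walk_dist A x y)"
    and "card {z \<in> nbhd A y. walk_dist A x z = walk_dist A x y + 1} = b (walk_dist A x y)"
    unfolding gdist_eq_walk_dist[OF V] using nbhd[of "\<lambda>d. d + 1 = walk_dist A x y"]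
      nbhd[of "\<lambda>d. d = walk_dist A x y"] nbhd[of "\<lambda>d. d = walk_dist A x y + 1"] by simp_all
qed

sublocale regular_graph G "b 0"
proof
  show deg: "card (nbhd A x) = b 0" if "x \<in> V" for x
  proof -
    have "{z \<in> nbhd A x. walk_dist A x z = walk_dist A x x + 1} = nbhd A x" using walk_dist_adj by auto
    then show ?thesis using card_nbhd_intersection_numbers(3)[OF that that] by simp
  qed
  obtain x y where "A x y" using edges by auto
  then have "card (nbhd A x) > 0" using finite_nbhd by (auto simp: card_gt_0_iff)
  then show "b 0 > 0" using deg A_V[OF \<open>A x y\<close>] by simp
qed

lemma card_triangles: "A x y \<Longrightarrow> card (nbhd A x \<inter> nbhd A y) = a 1"
proof -
  assume xy: "A x y"
  have V: "x \<in> V" "y \<in> V" using xy A_V A_V2 by auto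
  have "{z \<in> nbhd A y. walk_dist A x z = walk_dist A x y} = nbhd A x \<inter> nbhd A y"
    using walk_dist_adj[OF xy] walk_dist_eq_1_iff[OF V(1)] A_V2 by auto
  then show ?thesis using card_nbhd_intersection_numbers(2)[OF V] walk_dist_adj[OF xy] by simp
qed

lemma constant_mu_c2: "constant_mu A (c 2)"
  unfolding constant_mu_def
proof (intro allI impI)
  fix x y z assume xyz: "A x y" "A x z" "y \<noteq> z" "\<not> A y z"
  have V: "y \<in> V" "z \<in> V" using xyz A_V2 by auto
  have yz: "walk_dist A y z = 2" using walk_dist_eq_2[OF A_sym[OF xyz(1)] xyz(2-4)] .
  have "{t \<in> nbhd A z. walk_dist A y t + 1 = walk_dist A y z} = nbhd A y \<inter> nbhd A z"
    using yz walk_dist_eq_1_iff[OF V(1)] A_V2 by auto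
  then show "card (nbhd A y \<inter> nbhd A z) = c 2" using card_nbhd_intersection_numbers(1)[OF V] yz by simp
qed

subsection \<open>The standard sequence of an eigenvalue\<close>

definition intersection_number :: "nat \<Rightarrow> nat \<Rightarrow> nat" where
  "intersection_number j i = (if i + 1 = j then c j else if i = j then a j else if i = j + 1 then b j else 0)"

lemma card_nbhd_at_distance:
  assumes V: "x \<in> V" "z \<in> V"
  shows "card {y \<in> nbhd A z. walk_dist A x y = i} = intersection_number (walk_dist A x z) i"
proof -
  consider (closer) "i + 1 = walk_dist A x z" | (level) "i = walk_dist A x z"
    | (farther) "i = walk_dist A x z + 1" | (apart) "i + 1 \<noteq> walk_dist A x z" "i \<noteq> walk_dist A x z" "i \<noteq> walk_dist A x z + 1" by blast
  then show ?thesis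
  proof cases
    case closer
    then have "{y \<in> nbhd A z. walk_dist A x y = i} = {y \<in> nbhd A z. walk_dist A x y + 1 = walk_dist A x z}"
      by auto
    then show ?thesis using card_nbhd_intersection_numbers(1)[OF V] closer by (simp add: intersection_number_def)
  next
    case level
    then show ?thesis using card_nbhd_intersection_numbers(2)[OF V] by (simp add: intersection_number_def)
  next
    case farther
    then show ?thesis using card_nbhd_intersection_numbers(3)[OF V] by (simp add: intersection_number_def)
  next
    case apart
    have "walk_dist A x z \<le> Suc (walk_dist A x y)" "walk_dist A x y \<le> Suc (walk_dist A x z)" if "A z y" for y
      using walk_dist_step_right that A_sym V by blast+
    then have "walk_dist A x y \<noteq> i" if "A z y" for y using that apart by fastforce
    then have "{y \<in> nbhd A z. walk_dist A x y = i} = {}" by auto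
    then have "card {y \<in> nbhd A z. walk_dist A x y = i} = 0" by (simp only: card.empty)
    then show ?thesis using apart by (simp add: intersection_number_def)
  qed
qed

definition sphere :: "'a \<Rightarrow> nat \<Rightarrow> 'a set" where "sphere x i = {y \<in> V. walk_dist A x y = i}"

definition sphere_sum :: "('a \<Rightarrow> real) \<Rightarrow> 'a \<Rightarrow> nat \<Rightarrow> real" where "sphere_sum h x i = (\<Sum>y\<in>sphere x i. h y)"

lemma finite_sphere: "finite (sphere x i)" using finite_V by (simp add: sphere_def)

lemma sphere_0: "x \<in> V \<Longrightarrow> sphere x 0 = {x}" using walk_dist_eq_0_iff by (auto simp: sphere_def)

lemma sphere_sum_0: "x \<in> V \<Longrightarrow> sphere_sum h x 0 = h x" by (simp add: sphere_sum_def sphere_0)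

lemma sphere_sum_radial:
  fixes w :: "nat \<Rightarrow> real" shows "sphere_sum (\<lambda>z. w (walk_dist A x z)) x j = real (card (sphere x j)) * w j"
  unfolding sphere_sum_def by (simp add: sphere_def)

lemma sum_radial_weight:
  "(\<Sum>z\<in>V. w (walk_dist A x z) * h z) = (\<Sum>j\<in>walk_dist A x ` V. w j * sphere_sum h x j)"
proof -
  have "(\<Sum>z\<in>V. w (walk_dist A x z) * h z) =
      (\<Sum>j\<in>walk_dist A x ` V. \<Sum>z\<in>{z \<in> V. walk_dist A x z = j}. w (walk_dist A x z) * h z)"
    by (rule sum.image_gen[OF finite_V])
  also have "\<dots> = (\<Sum>j\<in>walk_dist A x ` V. w j * sphere_sum h x j)"
    by (rule sum.cong) (simp_all add: sphere_sum_def sphere_def sum_distrib_left)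
  finally show ?thesis .
qed

lemma sum_sphere_nbhd:
  assumes x: "x \<in> V"
  shows "(\<Sum>y\<in>sphere x i. \<Sum>z\<in>nbhd A y. h z) =
    (\<Sum>j\<in>walk_dist A x ` V. real (intersection_number j i) * sphere_sum h x j)"
proof -
  have "(\<Sum>y\<in>sphere x i. \<Sum>z\<in>nbhd A y. h z) = (\<Sum>y\<in>sphere x i. \<Sum>z\<in>V. if A y z then h z else 0)"
  proof (rule sum.cong[OF refl])
    fix y
    have "nbhd A y = {z \<in> V. A y z}" using A_V2 by auto
    then show "(\<Sum>z\<in>nbhd A y. h z) = (\<Sum>z\<in>V. if A y z then h z else 0)"
      using finite_V by (simp add: sum.inter_filter[symmetric])
  qed
  also have "\<dots> = (\<Sum>z\<in>V. \<Sum>y\<in>sphere x i. if A y z then h z else 0)" by (rule sum.swap)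
  also have "\<dots> = (\<Sum>z\<in>V. real (intersection_number (walk_dist A x z) i) * h z)"
  proof (rule sum.cong[OF refl])
    fix z assume z: "z \<in> V"
    have "{y \<in> sphere x i. A y z} = {y \<in> nbhd A z. walk_dist A x y = i}"
      using A_sym A_V by (auto simp: sphere_def)
    then show "(\<Sum>y\<in>sphere x i. if A y z then h z else 0) =
        real (intersection_number (walk_dist A x z) i) * h z"
      using card_nbhd_at_distance[OF x z, of i] finite_sphere by (simp add: sum.inter_filter[symmetric])
  qed
  also have "\<dots> = (\<Sum>j\<in>walk_dist A x ` V. real (intersection_number j i) * sphere_sum h x j)"
    by (rule sum_radial_weight[of "\<lambda>j. real (intersection_number j i)"])
  finally show ?thesis .
qed

lemma sum_sphere_nbhd_eigenfunction:
  assumes "adjacency_eigenfunction \<theta> h"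
  shows "(\<Sum>y\<in>sphere x i. \<Sum>z\<in>nbhd A y. h z) = \<theta> * sphere_sum h x i"
  unfolding sphere_sum_def sum_distrib_left
  using adjacency_eigenfunctionD[OF assms] by (intro sum.cong) (auto simp: sphere_def)

lemma sphere_sum_recurrence:
  assumes h: "adjacency_eigenfunction \<theta> h" and x: "x \<in> V"
  shows "real (intersection_number (Suc i) i) * sphere_sum h x (Suc i) =
    \<theta> * sphere_sum h x i - (\<Sum>j\<le>i. real (intersection_number j i) * sphere_sum h x j)"
proof -
  let ?r = "\<lambda>j. real (intersection_number j i) * sphere_sum h x j"
  have "\<theta> * sphere_sum h x i = (\<Sum>j\<in>walk_dist A x ` V. ?r j)"
    using sum_sphere_nbhd_eigenfunction[OF h] sum_sphere_nbhd[OF x] by metis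
  also have "\<dots> = (\<Sum>j\<in>walk_dist A x ` V \<union> {..Suc i}. ?r j)"
  proof (rule sum.mono_neutral_left)
    show "\<forall>j\<in>walk_dist A x ` V \<union> {..Suc i} - walk_dist A x ` V. ?r j = 0"
    proof
      fix j assume "j \<in> walk_dist A x ` V \<union> {..Suc i} - walk_dist A x ` V"
      then have "sphere x j = {}" by (auto simp: sphere_def)
      then show "?r j = 0" by (simp add: sphere_sum_def)
    qed
  qed (use finite_V in auto)
  also have "\<dots> = (\<Sum>j\<in>{..Suc i}. ?r j)"
    by (rule sum.mono_neutral_right) (use finite_V in \<open>auto simp: intersection_number_def\<close>)
  finally show ?thesis by simp
qed

lemma sphere_Suc_empty:
  assumes "intersection_number (Suc i) i = 0" "x \<in> V" shows "sphere x (Suc i) = {}"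
proof (rule ccontr)
  assume "sphere x (Suc i) \<noteq> {}"
  then obtain y where y: "y \<in> V" "walk_dist A x y = Suc i" by (auto simp: sphere_def)
  obtain z where "A z y" "walk_dist A x z = i" by (rule walk_dist_Suc_right[OF assms(2) y])
  then have "{z \<in> nbhd A y. walk_dist A x z = i} \<noteq> {}" using A_sym by auto
  moreover have "finite {z \<in> nbhd A y. walk_dist A x z = i}" by (rule finite_subset[OF _ finite_nbhd]) auto
  ultimately have "card {z \<in> nbhd A y. walk_dist A x z = i} \<noteq> 0" by (simp only: card_0_eq not_False_eq_True)
  then show False using card_nbhd_at_distance[OF assms(2) y(1), of i] y(2) assms(1) by simp
qed

lemma sphere_sum_proportional:
  assumes h: "adjacency_eigenfunction \<theta> h" and h': "adjacency_eigenfunction \<theta> h'" and V: "x \<in> V" "x' \<in> V"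
  shows "sphere_sum h x i * h' x' = sphere_sum h' x' i * h x"
proof (induction i rule: less_induct)
  case (less i)
  consider (zero) "i = 0" | (empty) m where "i = Suc m" "intersection_number (Suc m) m = 0"
    | (step) m where "i = Suc m" "intersection_number (Suc m) m \<noteq> 0" by (cases i) auto
  then show ?case
  proof cases
    case zero
    then show ?thesis using sphere_sum_0 V by simp
  next
    case empty
    then show ?thesis using sphere_Suc_empty V by (simp add: sphere_sum_def)
  next
    case (step m)
    let ?n = "\<lambda>j. real (intersection_number j m)"
    have IH: "sphere_sum h x j * h' x' = sphere_sum h' x' j * h x" if "j \<le> m" for j
      using less step(1) that by simp
    have "?n (Suc m) * (sphere_sum h x (Suc m) * h' x') =
        \<theta> * (sphere_sum h x m * h' x') - (\<Sum>j\<le>m. ?n j * (sphere_sum h x j * h' x'))"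
      using arg_cong[OF sphere_sum_recurrence[OF h V(1), of m], of "\<lambda>s. s * h' x'"]
      by (simp add: left_diff_distrib sum_distrib_right mult.assoc)
    also have "\<dots> = \<theta> * (sphere_sum h' x' m * h x) - (\<Sum>j\<le>m. ?n j * (sphere_sum h' x' j * h x))"
      by (simp add: IH cong: sum.cong_simp)
    also have "\<dots> = ?n (Suc m) * (sphere_sum h' x' (Suc m) * h x)"
      using arg_cong[OF sphere_sum_recurrence[OF h' V(2), of m], of "\<lambda>s. s * h x"]
      by (simp add: left_diff_distrib sum_distrib_right mult.assoc)
    finally show ?thesis using step by simp
  qed
qed

lemma card_sphere_eq: "x \<in> V \<Longrightarrow> x' \<in> V \<Longrightarrow> card (sphere x i) = card (sphere x' i)"
  using sphere_sum_proportional[OF adjacency_eigenfunction_const adjacency_eigenfunction_const, of x x' 1 i 1]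
  by (simp add: sphere_sum_def)

lemma walk_dist_image_V:
  assumes "x \<in> V" "x' \<in> V" shows "walk_dist A x ` V = walk_dist A x' ` V"
proof -
  have "j \<in> walk_dist A x ` V \<longleftrightarrow> card (sphere x j) > 0" for x j
    using finite_sphere[of x j] by (auto simp: card_gt_0_iff sphere_def)
  then show ?thesis by (simp add: set_eq_iff card_sphere_eq[OF assms] del: image_iff)
qed

definition standard_sequence :: "real \<Rightarrow> (nat \<Rightarrow> real) \<Rightarrow> bool" where
  "standard_sequence \<theta> u \<longleftrightarrow> u 0 = 1 \<and>
     (\<forall>(h :: 'a \<Rightarrow> real) x i. adjacency_eigenfunction \<theta> h \<longrightarrow> x \<in> V \<longrightarrow>
        sphere_sum h x i = real (card (sphere x i)) * u i * h x)"

lemma standard_sequenceD: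
  fixes u :: "nat \<Rightarrow> real" and h :: "'a \<Rightarrow> real"
  assumes "standard_sequence \<theta> u"
  shows "u 0 = 1"
    and "adjacency_eigenfunction \<theta> h \<Longrightarrow> x \<in> V \<Longrightarrow> sphere_sum h x i = real (card (sphere x i)) * u i * h x"
  using assms unfolding standard_sequence_def by blast+

lemma ex_standard_sequence:
  assumes f: "adjacency_eigenfunction \<theta> f" "x0 \<in> V" "f x0 \<noteq> 0"
  obtains u :: "nat \<Rightarrow> real" where "standard_sequence \<theta> u"
proof -
  define u where "u i = sphere_sum f x0 i / (f x0 * card (sphere x0 i))" for i
  have "sphere_sum h x i = card (sphere x i) * u i * h x" if h: "adjacency_eigenfunction \<theta> h" "x \<in> V" for h x i
  proof (cases "sphere x i = {}")
    case False
    then have "card (sphere x0 i) > 0"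
      using card_sphere_eq[OF h(2) f(2), of i] finite_sphere[of x i] by (metis card_gt_0_iff)
    then have "sphere_sum f x0 i = u i * (f x0 * card (sphere x0 i))" using f(3) by (simp add: u_def)
    then have "sphere_sum h x i * f x0 = card (sphere x i) * u i * h x * f x0"
      using sphere_sum_proportional[OF h(1) f(1) h(2) f(2), of i] card_sphere_eq[OF h(2) f(2), of i]
      by (simp add: algebra_simps)
    then show ?thesis using f(3) by simp
  qed (simp add: sphere_sum_def)
  moreover have "u 0 = 1" using f by (simp add: u_def sphere_sum_0 sphere_0)
  ultimately show ?thesis using that unfolding standard_sequence_def by blast
qed

lemma sum_nbhd_radial:
  assumes V: "x \<in> V" "y \<in> V"
  shows "(\<Sum>z\<in>nbhd A y. u (walk_dist A x z)) =
    (\<Sum>j\<le>Suc (walk_dist A x y). real (intersection_number (walk_dist A x y) j) * u j)"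
proof -
  have "walk_dist A x ` nbhd A y \<subseteq> {..Suc (walk_dist A x y)}" using walk_dist_step_right[OF _ V(1)] by auto
  then have "(\<Sum>z\<in>nbhd A y. u (walk_dist A x z)) =
      (\<Sum>j\<in>{..Suc (walk_dist A x y)}. \<Sum>z\<in>{z \<in> nbhd A y. walk_dist A x z = j}. u (walk_dist A x z))"
    by (intro sum.group[symmetric]) (use finite_nbhd in auto)
  also have "\<dots> = (\<Sum>j\<le>Suc (walk_dist A x y). real (intersection_number (walk_dist A x y) j) * u j)"
    by (rule sum.cong) (simp_all add: card_nbhd_at_distance[OF V, simplified])
  finally show ?thesis .
qed

text \<open>
  Summing over a sphere around \<open>x0\<close>, the eigenvalue equation for the radial function is that for \<open>f\<close>.
\<close>

lemma standard_sequence_eigenfunction: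
  assumes u: "standard_sequence \<theta> u" and f: "adjacency_eigenfunction \<theta> f" "x0 \<in> V" "f x0 \<noteq> 0" and x: "x \<in> V"
  shows "adjacency_eigenfunction \<theta> (\<lambda>y. u (walk_dist A x y))"
  unfolding adjacency_eigenfunction_def
proof
  fix y assume y: "y \<in> V"
  define i where "i = walk_dist A x y"
  define r where "r = (\<Sum>j\<le>Suc i. real (intersection_number i j) * u j)"
  have "sphere x i \<noteq> {}" using y by (auto simp: sphere_def i_def)
  then have "card (sphere x0 i) > 0"
    using card_sphere_eq[OF x f(2), of i] finite_sphere[of x i] by (metis card_gt_0_iff)
  moreover have "card (sphere x0 i) * r * f x0 = card (sphere x0 i) * (\<theta> * u i) * f x0"
  proof -
    let ?n = "\<lambda>j. real (intersection_number j i)"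
    have "card (sphere x0 i) * r = (\<Sum>y\<in>sphere x0 i. \<Sum>z\<in>nbhd A y. u (walk_dist A x0 z))"
      using sum_nbhd_radial[OF f(2)] by (simp add: sphere_def r_def)
    also have "\<dots> * f x0 = (\<Sum>j\<in>walk_dist A x0 ` V. ?n j * (card (sphere x0 j) * u j)) * f x0"
      unfolding sum_sphere_nbhd[OF f(2)] sphere_sum_radial ..
    also have "\<dots> = (\<Sum>j\<in>walk_dist A x0 ` V. ?n j * sphere_sum f x0 j)"
      by (simp add: standard_sequenceD(2)[OF u f(1,2)] sum_distrib_right mult.assoc)
    also have "\<dots> = \<theta> * sphere_sum f x0 i"
      using sum_sphere_nbhd[OF f(2)] sum_sphere_nbhd_eigenfunction[OF f(1)] by metis
    also have "\<dots> = card (sphere x0 i) * (\<theta> * u i) * f x0" by (simp add: standard_sequenceD(2)[OF u f(1,2)])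
    finally show ?thesis .
  qed
  ultimately have "r = \<theta> * u i" using f(3) by simp
  then show "(\<Sum>z\<in>nbhd A y. u (walk_dist A x z)) = \<theta> * u (walk_dist A x y)"
    using sum_nbhd_radial[OF x y] by (simp add: r_def i_def)
qed

lemma standard_sequence_reproducing:
  fixes u :: "nat \<Rightarrow> real"
  assumes u: "standard_sequence \<theta> u"
  obtains C :: real where "C > 0" "\<And>x (h :: 'a \<Rightarrow> real). x \<in> V \<Longrightarrow> adjacency_eigenfunction \<theta> h \<Longrightarrow>
    (\<Sum>z\<in>V. u (walk_dist A x z) * h z) = C * h x"
proof -
  obtain x0 where x0: "x0 \<in> V" using V_nonempty by blast
  define C :: real where "C = (\<Sum>j\<in>walk_dist A x0 ` V. card (sphere x0 j) * (u j)\<^sup>2)"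
  have "(\<Sum>z\<in>V. u (walk_dist A x z) * h z) = C * h x"
    if x: "x \<in> V" and h: "adjacency_eigenfunction \<theta> h" for x h
  proof -
    have "(\<Sum>z\<in>V. u (walk_dist A x z) * h z) = (\<Sum>j\<in>walk_dist A x0 ` V. u j * sphere_sum h x j)"
      unfolding sum_radial_weight walk_dist_image_V[OF x x0] ..
    also have "\<dots> = C * h x"
      by (simp add: C_def standard_sequenceD(2)[OF u h x] card_sphere_eq[OF x x0] sum_distrib_left
          power2_eq_square mult_ac)
    finally show ?thesis .
  qed
  moreover have "C > 0"
  proof -
    have "0 \<in> walk_dist A x0 ` V" using x0 by (intro image_eqI[of _ _ x0]) auto
    then have "card (sphere x0 0) * (u 0)\<^sup>2 \<le> C" unfolding C_def using finite_V by (intro member_le_sum) auto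
    then show ?thesis using standard_sequenceD(1)[OF u] by (simp add: sphere_0[OF x0])
  qed
  ultimately show ?thesis using that by blast
qed

theorem minuscule_if_lichnerowicz_sharp:
  assumes sharp: "lichnerowicz_sharp G" shows "\<exists>D. minuscule V A D"
proof -
  define \<theta> where "\<theta> = b 0 * (1 - lambda1 G)"
  obtain f x0 where f: "adjacency_eigenfunction \<theta> f" "x0 \<in> V" "f x0 \<noteq> 0" and "lambda1 G \<noteq> 0"
    using lambda1_eigenfunction unfolding \<theta>_def by metis
  then have \<theta>: "1 - \<theta> / b 0 = lambda1 G" "\<theta> \<noteq> b 0" using k_pos by (simp_all add: \<theta>_def)
  obtain u where u: "standard_sequence \<theta> u" by (rule ex_standard_sequence[OF f])
  obtain C :: real where C: "C > 0" "\<And>x (h :: 'a \<Rightarrow> real). x \<in> V \<Longrightarrow> adjacency_eigenfunction \<theta> h \<Longrightarrow>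
      (\<Sum>z\<in>V. u (walk_dist A x z) * h z) = C * h x"
    using standard_sequence_reproducing[OF u] by blast
  have eigen: "adjacency_eigenfunction \<theta> (\<lambda>y. u (walk_dist A x y))" if "x \<in> V" for x
    by (rule standard_sequence_eigenfunction[OF u f that])
  have "u 1 \<noteq> 1"
  proof
    assume "u 1 = 1"
    then have "(\<Sum>y\<in>nbhd A x0. u (walk_dist A x0 y)) = b 0" using regular[OF f(2)] by (simp add: walk_dist_adj)
    then show False
      using adjacency_eigenfunctionD[OF eigen[OF f(2)] f(2)] standard_sequenceD(1)[OF u] \<theta>(2) by simp
  qed
  interpret spherical_representation G "b 0" "\<lambda>x y. u (walk_dist A x y)" \<theta> "u 1" "u 2" C
    by unfold_locales
      (use \<open>u 1 \<noteq> 1\<close> eigen C standard_sequenceD(1)[OF u] in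
        \<open>auto simp: walk_dist_sym walk_dist_adj walk_dist_eq_2\<close>)
  have "1 - \<theta> / b 0 \<le> lly_curvature G x y" if "A x y" for x y
  proof -
    have "{lly_curvature G x y |x y. A x y} = (\<lambda>(x, y). lly_curvature G x y) ` parcs G" by force
    then have "finite {lly_curvature G x y |x y. A x y}" using pair_finite_arcs by simp
    then have "Min {lly_curvature G x y |x y. A x y} \<le> lly_curvature G x y" by (rule Min_le) (use that in blast)
    then show ?thesis using sharp unfolding lichnerowicz_sharp_def \<theta>(1) by simp
  qed
  then show ?thesis using minuscule_if_curvature_ge by blast
qed

theorem lichnerowicz_sharp_iff_minuscule: "lichnerowicz_sharp G \<longleftrightarrow> (\<exists>D. minuscule V A D)"
proof
  assume "\<exists>D. minuscule V A D"
  then obtain D where "minuscule V A D" by blast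
  then interpret minuscule_regular_graph G "b 0" D "a 1"
    by (intro minuscule_regular_graph.intro minuscule_regular_graph_axioms.intro regular_graph_axioms
        card_triangles)
  show "lichnerowicz_sharp G" by (rule lichnerowicz_sharp)
qed (rule minuscule_if_lichnerowicz_sharp)

end

subsection \<open>The classification\<close>

lemma pair_wf_digraph_graph_on: "pair_wf_digraph (graph_on V R)"
  by unfold_locales (auto simp: graph_on_def)

lemma digraph_iso_iff_map_prod:
  assumes "pair_wf_digraph G"
  shows "digraph_iso (with_proj G) (with_proj H) \<longleftrightarrow>
    (\<exists>f. bij_betw f (pverts G) (pverts H) \<and> parcs H = map_prod f f ` parcs G)"
proof
  interpret pair_wf_digraph G by fact
  assume "digraph_iso (with_proj G) (with_proj H)"
  then obtain f where f: "digraph_isomorphism f" and H: "with_proj H = app_iso f (with_proj G)"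
    unfolding digraph_iso_def by blast
  have eqs: "pverts H = iso_verts f ` pverts G" "parcs H = iso_arcs f ` parcs G"
      "fst = iso_tail f" "snd = iso_head f"
    using arg_cong[OF H, of verts] arg_cong[OF H, of arcs] arg_cong[OF H, of tail] arg_cong[OF H, of head]
    by simp_all
  have "iso_arcs f e = map_prod (iso_verts f) (iso_verts f) e" if "e \<in> parcs G" for e
    using f that eqs(3,4) unfolding digraph_isomorphism_def by (cases e) (auto simp: prod_eq_iff)
  then have "parcs H = map_prod (iso_verts f) (iso_verts f) ` parcs G" using eqs(2) by (auto simp: image_iff)
  moreover have "bij_betw (iso_verts f) (pverts G) (pverts H)"
    using f eqs(1) unfolding digraph_isomorphism_def bij_betw_def by simp
  ultimately show "\<exists>f. bij_betw f (pverts G) (pverts H) \<and> parcs H = map_prod f f ` parcs G" by blast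
next
  interpret pair_wf_digraph G by fact
  assume "\<exists>f. bij_betw f (pverts G) (pverts H) \<and> parcs H = map_prod f f ` parcs G"
  then obtain f where f: "bij_betw f (pverts G) (pverts H)" "parcs H = map_prod f f ` parcs G" by blast
  define h where "h = \<lparr>iso_verts = f, iso_arcs = map_prod f f, iso_head = snd, iso_tail = fst\<rparr>"
  have inj: "inj_on f (pverts G)" using f(1) by (simp add: bij_betw_def)
  have "inj_on (map_prod f f) (parcs G)"
    by (rule inj_on_subset[OF map_prod_inj_on[OF inj inj]]) (use in_arcsD1 in_arcsD2 in auto)
  then have "digraph_isomorphism h"
    unfolding digraph_isomorphism_def using inj wf_digraph_axioms by (simp add: h_def)
  moreover have "with_proj H = app_iso h (with_proj G)"
    using f by (simp add: with_proj_def app_iso_def h_def bij_betw_def)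
  ultimately show "digraph_iso (with_proj G) (with_proj H)" unfolding digraph_iso_def by blast
qed

lemma arcs_eq_image_iff:
  assumes "pair_wf_digraph G" "pair_wf_digraph H" and f: "bij_betw f (pverts G) (pverts H)"
  shows "parcs H = map_prod f f ` parcs G \<longleftrightarrow>
    (\<forall>x\<in>pverts G. \<forall>y\<in>pverts G. adj G x y \<longleftrightarrow> adj H (f x) (f y))"
proof -
  interpret G: pair_wf_digraph G by fact
  interpret H: pair_wf_digraph H by fact
  show ?thesis
  proof
    assume eq: "parcs H = map_prod f f ` parcs G"
    show "\<forall>x\<in>pverts G. \<forall>y\<in>pverts G. adj G x y \<longleftrightarrow> adj H (f x) (f y)"
    proof (intro ballI iffI)
      fix x y assume xy: "x \<in> pverts G" "y \<in> pverts G" and "adj H (f x) (f y)"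
      then obtain u v where uv: "adj G u v" "f x = f u" "f y = f v" using eq by auto
      then have "x = u" "y = v"
        using f xy G.in_arcsD1 G.in_arcsD2 unfolding bij_betw_def inj_on_def by blast+
      then show "adj G x y" using uv by simp
    qed (use eq in force)
  next
    assume iff: "\<forall>x\<in>pverts G. \<forall>y\<in>pverts G. adj G x y \<longleftrightarrow> adj H (f x) (f y)"
    have "e \<in> parcs H \<longleftrightarrow> e \<in> map_prod f f ` parcs G" for e
    proof
      assume "e \<in> parcs H"
      then obtain u v where e: "e = (u, v)" "adj H u v" by (cases e) auto
      then obtain x y where "x \<in> pverts G" "y \<in> pverts G" "f x = u" "f y = v"
        using bij_betw_imp_surj_on[OF f] H.in_arcsD1 H.in_arcsD2 by (metis imageE)
      then show "e \<in> map_prod f f ` parcs G" using iff e by force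
    next
      assume "e \<in> map_prod f f ` parcs G"
      then obtain x y where "adj G x y" "e = (f x, f y)" by auto
      then show "e \<in> parcs H" using iff G.in_arcsD1 G.in_arcsD2 by blast
    qed
    then show "parcs H = map_prod f f ` parcs G" by blast
  qed
qed

lemma digraph_iso_iff_iso_on:
  assumes "pair_wf_digraph G" "pair_wf_digraph H"
  shows "digraph_iso (with_proj G) (with_proj H) \<longleftrightarrow> iso_on (pverts G) (adj G) (pverts H) (adj H)"
  using digraph_iso_iff_map_prod[OF assms(1)] arcs_eq_image_iff[OF assms] unfolding iso_on_def by metis

lemma digraph_iso_graph_on_iff:
  assumes "pair_wf_digraph G" "H = graph_on W R"
  shows "digraph_iso (with_proj G) (with_proj H) \<longleftrightarrow> iso_on (pverts G) (adj G) (pverts H) (adj H)"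
  unfolding assms(2) by (rule digraph_iso_iff_iso_on[OF assms(1) pair_wf_digraph_graph_on])

definition minuscule_family :: "'a set \<Rightarrow> ('a \<Rightarrow> 'a \<Rightarrow> bool) \<Rightarrow> bool" where
  "minuscule_family V A \<longleftrightarrow>
     (\<exists>n\<ge>2. iso_on V A (pverts (cocktail_party_graph n)) (adj (cocktail_party_graph n))) \<or>
     (\<exists>d n. d \<ge> 1 \<and> n \<ge> 2 \<and> iso_on V A (pverts (hamming_graph d n)) (adj (hamming_graph d n))) \<or>
     (\<exists>n k. 1 \<le> k \<and> k \<le> n - 1 \<and> iso_on V A (pverts (johnson_graph n k)) (adj (johnson_graph n k))) \<or>
     (\<exists>n\<ge>2. iso_on V A (pverts (demicube_graph n)) (adj (demicube_graph n))) \<or>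
     iso_on V A (pverts schlaefli_graph) (adj schlaefli_graph) \<or>
     iso_on V A (pverts gosset_graph) (adj gosset_graph)"

definition nontrivial_minuscule :: "'a set \<Rightarrow> ('a \<Rightarrow> 'a \<Rightarrow> bool) \<Rightarrow> bool" where
  "nontrivial_minuscule V A \<longleftrightarrow> (\<exists>D. minuscule V A D) \<and> (\<exists>x y. A x y)"

lemma nontrivial_minuscule_if_iso:
  assumes iso: "iso_on V A W B" and W: "nontrivial_minuscule W B" and A_V: "\<And>x y. A x y \<Longrightarrow> x \<in> V \<and> y \<in> V"
  shows "nontrivial_minuscule V A"
proof -
  obtain E u v where E: "minuscule W B E" and uv: "B u v"
    using W unfolding nontrivial_minuscule_def by blast
  interpret minuscule W B E by (rule E)
  obtain f where f: "bij_betw f V W" "\<And>x y. x \<in> V \<Longrightarrow> y \<in> V \<Longrightarrow> A x y \<longleftrightarrow> B (f x) (f y)"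
    by (rule iso_onE[OF iso]) blast
  have "minuscule V A (\<lambda>x y. E (f x) (f y))"
    by (rule minuscule_pullback[OF E f(1)]) (use f(2) assms(3) in blast)
  moreover obtain x y where "x \<in> V" "y \<in> V" "f x = u" "f y = v"
    using bij_betw_imp_surj_on[OF f(1)] A_V[OF uv] A_V2[OF uv] by (metis imageE)
  ultimately show ?thesis using f(2) uv unfolding nontrivial_minuscule_def by blast
qed

lemma nontrivial_minusculeI: "minuscule V A D \<Longrightarrow> A x y \<Longrightarrow> nontrivial_minuscule V A"
  unfolding nontrivial_minuscule_def by blast

lemma nontrivial_minuscule_cocktail_party_graph:
  assumes "n \<ge> 2" shows "nontrivial_minuscule (pverts (cocktail_party_graph n)) (adj (cocktail_party_graph n))"
  by (rule nontrivial_minusculeI[OF minuscule_cocktail_party_graph[OF assms], of 0 2])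
    (use assms in \<open>simp add: adj_cocktail_party_graph\<close>)

lemma nontrivial_minuscule_hamming_graph:
  assumes "d \<ge> 1" "n \<ge> 2" shows "nontrivial_minuscule (pverts (hamming_graph d n)) (adj (hamming_graph d n))"
proof -
  have "(0, 1) \<in> clique_points (replicate d n)" using assms by (simp add: clique_points_def)
  moreover have "\<And>q. q \<in> set (replicate d n) \<Longrightarrow> 0 < q" using assms by auto
  ultimately have "nbhd (adj (hamming_graph d n)) (replicate d 0) \<noteq> {}"
    using box_graph_local_iso(2)[of "replicate d n"]
    by (auto simp: hamming_graph_eq_box_graph iso_on_def bij_betw_def)
  then show ?thesis
    using nontrivial_minusculeI[OF minuscule_box_graph] by (auto simp: hamming_graph_eq_box_graph)
qed

lemma nontrivial_minuscule_johnson_graph: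
  assumes "1 \<le> k" "k \<le> n - 1"
  shows "nontrivial_minuscule (pverts (johnson_graph n k)) (adj (johnson_graph n k))"
proof (rule nontrivial_minusculeI[OF minuscule_johnson_graph])
  show "adj (johnson_graph n k) {..<k} (insert (k + 0) ({..<k} - {0}))"
    using assms by (subst adj_johnson_graph_initial_iff) (auto intro!: exI[of _ "0::nat"])
qed

lemma nontrivial_minuscule_demicube_graph:
  assumes "n \<ge> 2" shows "nontrivial_minuscule (pverts (demicube_graph n)) (adj (demicube_graph n))"
proof -
  have "{0, 1} \<in> pverts (johnson_graph n 2)" using assms by (simp add: pverts_johnson_graph)
  then have "nbhd (adj (demicube_graph n)) (replicate n False) \<noteq> {}"
    using demicube_graph_local_iso(2)[of n] by (auto simp: iso_on_def bij_betw_def)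
  then show ?thesis using nontrivial_minusculeI[OF minuscule_demicube_graph] by auto
qed

lemma nontrivial_minuscule_schlaefli_graph:
  "nontrivial_minuscule (pverts schlaefli_graph) (adj schlaefli_graph)"
  by (rule nontrivial_minusculeI[OF minuscule_schlaefli_graph, of "LineA 0" "LineA 1"])
    (simp add: adj_schlaefli_graph pverts_schlaefli_graph)

lemma nontrivial_minuscule_gosset_graph:
  "nontrivial_minuscule (pverts gosset_graph) (adj gosset_graph)"
  by (rule nontrivial_minusculeI[OF minuscule_gosset_graph, of "(True, {0, 1})" "(False, {2, 3})"])
    (simp add: adj_gosset_graph)

lemma nontrivial_minuscule_if_family:
  assumes "minuscule_family V A" "\<And>x y. A x y \<Longrightarrow> x \<in> V \<and> y \<in> V"
  shows "nontrivial_minuscule V A"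
  using assms(1) unfolding minuscule_family_def
  by - (elim disjE exE conjE; rule nontrivial_minuscule_if_iso[OF _ _ assms(2)];
    (assumption | rule nontrivial_minuscule_cocktail_party_graph nontrivial_minuscule_hamming_graph
      nontrivial_minuscule_johnson_graph nontrivial_minuscule_demicube_graph
      nontrivial_minuscule_schlaefli_graph nontrivial_minuscule_gosset_graph)+)

context distance_regular_graph
begin

lemma hamming_if_complete_or_mu_2:
  assumes D: "minuscule V A D" and mu: "complete_on V A \<or> c 2 = 2"
  shows "\<exists>d n. d \<ge> 1 \<and> n \<ge> 2 \<and> iso_on V A (pverts (hamming_graph d n)) (adj (hamming_graph d n))"
proof -
  interpret minuscule V A D by (rule D)
  obtain x y where xy: "A x y" using ex_edge by blast
  have "complete_on V A \<or> constant_mu A 2" using mu constant_mu_c2 by auto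
  note transitive = local_adj_transitive[OF this]
  obtain qs where qs: "\<forall>q\<in>set qs. \<exists>y\<in>nbhd A x. q = card (nbhd A x \<inter> nbhd A y) + 2"
    and iso: "iso_on V A (pverts (box_graph qs)) (adj (box_graph qs))"
    by (rule exE[OF box_graph_recognition[OF D A_V[OF xy]]]) (rule transitive, assumption+, blast)
  have "q = a 1 + 2" if "q \<in> set qs" for q using bspec[OF qs that] card_triangles by auto
  then have "qs = replicate (length qs) (a 1 + 2)" by (intro replicate_eqI) blast+
  then have "box_graph qs = hamming_graph (length qs) (a 1 + 2)" by (simp only: hamming_graph_eq_box_graph)
  then have "iso_on V A (pverts (hamming_graph (length qs) (a 1 + 2)))
      (adj (hamming_graph (length qs) (a 1 + 2)))"
    using iso by simp
  moreover have "length qs \<ge> 1"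
  proof -
    obtain f where "adj (box_graph qs) (f x) (f y)"
      by (rule iso_onE[OF iso]) (use xy A_V[OF xy] A_V2[OF xy] in blast)
    then have "disagreements (length qs) ((!) (f x)) ((!) (f y)) = 1" by (simp add: adj_box_graph)
    then show ?thesis by (cases qs) (simp_all add: disagreements_def)
  qed
  ultimately show ?thesis by (intro exI[of _ "length qs"] exI[of _ "a 1 + 2"]) auto
qed

theorem minuscule_family_if_minuscule:
  assumes D: "minuscule V A D" shows "minuscule_family V A"
proof (cases "complete_on V A \<or> c 2 = 2")
  case True
  then show ?thesis using hamming_if_complete_or_mu_2[OF D] unfolding minuscule_family_def by blast
next
  case False
  then have "minuscule_type (c 2) V A" using minuscule_classification[OF D _ constant_mu_c2] by blast
  then show ?thesis
  proof cases
    case (johnson n k)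
    then have "1 \<le> k \<and> k \<le> n - 1" by auto
    then show ?thesis using johnson(2) unfolding minuscule_family_def by blast
  next
    case (demicube n)
    then have "2 \<le> n" by simp
    then show ?thesis using demicube(2) unfolding minuscule_family_def by blast
  next
    case (cocktail_party n)
    then have "2 \<le> n" by simp
    then show ?thesis using cocktail_party(2) unfolding minuscule_family_def by blast
  qed (use False in \<open>auto simp: minuscule_family_def\<close>)
qed

end

lemma distance_regular_graphI:
  assumes "pair_graph G" "distance_regular G" "parcs G \<noteq> {}"
  obtains c a b where "distance_regular_graph G c a b"
  using assms that unfolding distance_regular_def distance_regular_graph_def connected_graph_def
    connected_graph_axioms_def distance_regular_graph_axioms_def by blast

lemma lichnerowicz_sharp_iff_minuscule_family:
  assumes "pair_graph G" "distance_regular G"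
  shows "lichnerowicz_sharp G \<longleftrightarrow> minuscule_family (pverts G) (adj G)"
proof (cases "parcs G = {}")
  case True
  then show ?thesis
    using nontrivial_minuscule_if_family[of "pverts G" "adj G"]
    by (auto simp: lichnerowicz_sharp_def nontrivial_minuscule_def)
next
  case False
  obtain c a b where "distance_regular_graph G c a b"
    by (rule distance_regular_graphI[OF assms False])
  then interpret distance_regular_graph G c a b .
  show ?thesis
    unfolding lichnerowicz_sharp_iff_minuscule
    using minuscule_family_if_minuscule nontrivial_minuscule_if_family[of V A] A_V A_V2
    unfolding nontrivial_minuscule_def by blast
qed

theorem theorem1p3:
  fixes G :: "'a pair_pre_digraph"
  assumes "pair_graph G"
    and "Digraph_Component.connected (with_proj G)"
    and "distance_regular G"
  shows "lichnerowicz_sharp G \<longleftrightarrow>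
      (\<exists>n\<ge>2. digraph_iso (with_proj G) (with_proj (cocktail_party_graph n))) \<or>
      (\<exists>d n. d \<ge> 1 \<and> n \<ge> 2 \<and> digraph_iso (with_proj G) (with_proj (hamming_graph d n))) \<or>
      (\<exists>n k. 1 \<le> k \<and> k \<le> n - 1 \<and> digraph_iso (with_proj G) (with_proj (johnson_graph n k))) \<or>
      (\<exists>n\<ge>2. digraph_iso (with_proj G) (with_proj (demicube_graph n))) \<or>
      digraph_iso (with_proj G) (with_proj schlaefli_graph) \<or>
      digraph_iso (with_proj G) (with_proj gosset_graph)"
proof -
  interpret pair_graph G by fact
  note iso_iff = digraph_iso_graph_on_iff[OF pair_wf_digraph_axioms]
  have "lichnerowicz_sharp G \<longleftrightarrow> minuscule_family (pverts G) (adj G)"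
    by (rule lichnerowicz_sharp_iff_minuscule_family[OF assms(1,3)])
  then show ?thesis
    unfolding minuscule_family_def iso_iff[OF cocktail_party_graph_def] iso_iff[OF hamming_graph_def]
      iso_iff[OF johnson_graph_def] iso_iff[OF demicube_graph_def] iso_iff[OF schlaefli_graph_def]
      iso_iff[OF gosset_graph_def] .
qed

end
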